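(* Let $\alpha>4$ and $K,c_1,c_2>0$. For any $\varepsilon\in(0,1)$ there exists a constant $C>0$ depending only on $\alpha$, $K$, $c_1$, $c_2$ and $\varepsilon$ such that, for every even integer $n\ge4$ and every integer $p\ge1$, there exists a test $\phi_{\mathcal{P}_{\mathrm{Temp}}}$, allowed to depend on the noise distribution $P_e$ only through the second moments $v(P_e)$ described in the context (which are assumed known), that satisfies $$\mathcal{R}_{\mathcal{P}_{\mathrm{Temp}}}(\rho,\phi_{\mathcal{P}_{\mathrm{Temp}}})\le\varepsilon$$ as long as $$\rho^2\ge C\,p^{1/2}\{\log\log(8n)\}\{\log\log\log(64n)\}^2.$$
   Context: Notation: $[m]=\{1,\dots,m\}$; $x\wedge y=\min(x,y)$; $\log$ is the natural logarithm. Model: $X=\theta+E\in\mathbb{R}^{p\times n}$, with deterministic $\theta$ and random $E\sim P_e$; $X_t,\theta_t,E_t\in\mathbb{R}^p$ denote the $t$-th columns and $E_t(j)$ the $j$-th entry of $E_t$. $\mathbb{E}_{\theta,P_e}$ is expectation under the law of $X$. Null space: $\Theta_0(p,n)=\{\theta:\exists\mu\in\mathbb{R}^p,\ \theta_t=\mu\ \forall t\in[n]\}$. Alternative space: $\Theta(p,n,p,\rho)$, the set of $\theta$ for which there are $t_0\in[n-1]$ and $\mu_1,\mu_2\in\mathbb{R}^p$ with $\theta_t=\mu_1$ for $t\le t_0$, $\theta_t=\mu_2$ for $t>t_0$ and $\frac{t_0(n-t_0)}n\|\mu_1-\mu_2\|_2^2\ge\rho^2$. Noise class: $\mathcal{P}_{\alpha,K}$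 is the class of distributions of real random variables $W$ with $\mathbb{E}W=0$, $\mathbb{E}W^2=1$, $\mathbb{E}|W/K|^\alpha\le1$. The interlaced $\alpha$-mixing coefficient of $\{E_i\}_{i\in[n]}$ is $$\alpha^*(i)=\sup_{S,T\subseteq[n]:\ \min_{s\in S,t\in T}|s-t|\ge i}\ \ \sup_{A\in\sigma(E_j:j\in S),\ B\in\sigma(E_j:j\in T)}|\mathbb{P}(A\cap B)-\mathbb{P}(A)\mathbb{P}(B)|.$$ $\mathcal{P}_{\mathrm{Temp}}$ is the class of all distributions of $E$ such that (1) the rows of $E$ are independent; (2) the marginal distribution of each entry of $E$ belongs to $\mathcal{P}_{\alpha,K}$; (3) $\alpha^*(i)\le c_1e^{-c_2i}$ for all $i\in[n-1]$. Known second moments: let $\mathcal{T}=\{1,2,4,\dots,2^{\lfloor\log_2(n/2)\rfloor}\}$, and let $G_t=t\wedge\Delta$ for $t\in\mathcal{T}$, where $\Delta$ is a power of two chosen as part of the construction of the test and depending only on $n,\alpha,K,c_1,c_2,\varepsilon$. For $g\in[G_t]$ and $j\in[p]$ put $$v_{t,g,j}(P_e)=\mathbb{E}\Bigl[\Bigl(\frac{G_t}{t}\sum_{i=(g-1)t/G_t+1}^{gt/G_t}\frac{E_i(j)-E_{n+1-i}(j)}{\sqrt2}\Bigr)^2\Bigr],\qquad v(P_e)=(v_{t,g,j}(P_e))_{t,g,j}.$$ A test depending on $P_e$ only through $v(P_e)$ is a family of measurable maps $\phi_v:\mathbb{R}^{p\times n}\to\{0,1\}$ indexed by arrays $v$,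 with $\phi=\phi_{v(P_e)}$ used when the noise distribution is $P_e$. Worst-case testing error: $$\mathcal{R}_{\mathcal{P}_{\mathrm{Temp}}}(\rho,\phi)=\sup_{P_e\in\mathcal{P}_{\mathrm{Temp}}}\sup_{\theta\in\Theta_0(p,n)}\mathbb{E}_{\theta,P_e}(\phi)+\sup_{P_e\in\mathcal{P}_{\mathrm{Temp}}}\sup_{\theta\in\Theta(p,n,p,\rho)}\mathbb{E}_{\theta,P_e}(1-\phi).$$ *)

theory Defs
  imports "HOL-Probability.Probability"
begin

text \<open>A real \<open>p \<times> n\<close> matrix is an element of the product space over the index set
  \<open>{1..p} \<times> {1..n}\<close>, with entry \<open>(j, t)\<close> in row \<open>j\<close> and column \<open>t\<close>.\<close>

definition mat_space :: "nat \<Rightarrow> nat \<Rightarrow> (nat \<times> nat \<Rightarrow> real) measure" where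
  "mat_space p n = (\<Pi>\<^sub>M x\<in>{1..p} \<times> {1..n}. borel)"

definition mat_row :: "nat \<Rightarrow> nat \<Rightarrow> (nat \<times> nat \<Rightarrow> real) \<Rightarrow> nat \<Rightarrow> real" where
  "mat_row n j X = (\<lambda>t\<in>{1..n}. X (j, t))"

definition mat_col :: "nat \<Rightarrow> nat \<Rightarrow> (nat \<times> nat \<Rightarrow> real) \<Rightarrow> nat \<Rightarrow> real" where
  "mat_col p t X = (\<lambda>j\<in>{1..p}. X (j, t))"

definition Theta_null :: "nat \<Rightarrow> nat \<Rightarrow> (nat \<times> nat \<Rightarrow> real) set" where
  "Theta_null p n = {\<theta> \<in> space (mat_space p n).
     \<exists>\<mu> \<in> space (\<Pi>\<^sub>M j\<in>{1..p}. borel). \<forall>t\<in>{1..n}. mat_col p t \<theta> = \<mu>}"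

definition Theta_alt :: "nat \<Rightarrow> nat \<Rightarrow> real \<Rightarrow> (nat \<times> nat \<Rightarrow> real) set" where
  "Theta_alt p n \<rho> = {\<theta> \<in> space (mat_space p n).
     \<exists>t\<^sub>0\<in>{1..n-1}. \<exists>\<mu>\<^sub>1 \<in> space (\<Pi>\<^sub>M j\<in>{1..p}. borel). \<exists>\<mu>\<^sub>2 \<in> space (\<Pi>\<^sub>M j\<in>{1..p}. borel).
       (\<forall>t\<in>{1..t\<^sub>0}. mat_col p t \<theta> = \<mu>\<^sub>1) \<and> (\<forall>t\<in>{t\<^sub>0<..n}. mat_col p t \<theta> = \<mu>\<^sub>2) \<and>
       real t\<^sub>0 * (real n - real t\<^sub>0) / real n * (L2_set (\<lambda>j. \<mu>\<^sub>1 j - \<mu>\<^sub>2 j) {1..p})\<^sup>2 \<ge> \<rho>\<^sup>2}"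

definition law_data ::
    "nat \<Rightarrow> nat \<Rightarrow> (nat \<times> nat \<Rightarrow> real) \<Rightarrow> (nat \<times> nat \<Rightarrow> real) measure \<Rightarrow> (nat \<times> nat \<Rightarrow> real) measure" where
  "law_data p n \<theta> P = distr P (mat_space p n) (\<lambda>E. \<lambda>x\<in>{1..p} \<times> {1..n}. \<theta> x + E x)"

definition noise_class :: "real \<Rightarrow> real \<Rightarrow> real measure set" where
  "noise_class \<alpha> K = {Q. prob_space Q \<and> sets Q = sets borel \<and>
     integrable Q (\<lambda>w. w) \<and> (\<integral>w. w \<partial>Q) = 0 \<and>
     integrable Q (\<lambda>w. w\<^sup>2) \<and> (\<integral>w. w\<^sup>2 \<partial>Q) = 1 \<and>
     integrable Q (\<lambda>w. \<bar>w / K\<bar> powr \<alpha>) \<and> (\<integral>w. \<bar>w / K\<bar> powr \<alpha> \<partial>Q) \<le> 1}"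

definition col_events :: "nat \<Rightarrow> (nat \<times> nat \<Rightarrow> real) measure \<Rightarrow> nat set \<Rightarrow> (nat \<times> nat \<Rightarrow> real) set set" where
  "col_events p P S = sigma_sets (space P)
     (\<Union>t\<in>S. {mat_col p t -` B \<inter> space P | B. B \<in> sets (\<Pi>\<^sub>M j\<in>{1..p}. borel)})"

text \<open>The sets \<open>S\<close>, \<open>T\<close> are interlaced: only their mutual distance is constrained, not their order.
  The supremum is over a nonempty set of reals in \<open>[0, 1]\<close>.\<close>

definition alpha_mix :: "nat \<Rightarrow> nat \<Rightarrow> (nat \<times> nat \<Rightarrow> real) measure \<Rightarrow> nat \<Rightarrow> real" where
  "alpha_mix p n P i = Sup {\<bar>measure P (A \<inter> B) - measure P A * measure P B\<bar> | A B S T.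
     S \<subseteq> {1..n} \<and> T \<subseteq> {1..n} \<and> (\<forall>s\<in>S. \<forall>t\<in>T. \<bar>int s - int t\<bar> \<ge> int i) \<and>
     A \<in> col_events p P S \<and> B \<in> col_events p P T}"

definition P_Temp ::
    "real \<Rightarrow> real \<Rightarrow> real \<Rightarrow> real \<Rightarrow> nat \<Rightarrow> nat \<Rightarrow> (nat \<times> nat \<Rightarrow> real) measure set" where
  "P_Temp \<alpha> K c\<^sub>1 c\<^sub>2 p n = {P. prob_space P \<and> sets P = sets (mat_space p n) \<and>
     prob_space.indep_vars P (\<lambda>_. \<Pi>\<^sub>M t\<in>{1..n}. borel) (mat_row n) {1..p} \<and>
     (\<forall>j\<in>{1..p}. \<forall>t\<in>{1..n}. distr P borel (\<lambda>E. E (j, t)) \<in> noise_class \<alpha> K) \<and>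
     (\<forall>i\<in>{1..n-1}. alpha_mix p n P i \<le> c\<^sub>1 * exp (- c\<^sub>2 * real i))}"

definition dyadic_grid :: "nat \<Rightarrow> nat set" where
  "dyadic_grid n = (\<lambda>k. 2 ^ k) ` {0..nat \<lfloor>log 2 (real n / 2)\<rfloor>}"

text \<open>For \<open>t\<close> in the grid and \<open>\<Delta>\<close> a power of two, \<open>min t \<Delta>\<close> divides \<open>t\<close>, so the natural-number
  divisions below are exact. The restriction to the index set matters: outside of it the array must
  not reveal anything about \<open>P\<close>.\<close>

definition second_moments ::
    "nat \<Rightarrow> nat \<Rightarrow> nat \<Rightarrow> (nat \<times> nat \<Rightarrow> real) measure \<Rightarrow> nat \<times> nat \<times> nat \<Rightarrow> real" where
  "second_moments p n \<Delta> P =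
     (\<lambda>(t, g, j)\<in>(SIGMA t:dyadic_grid n. {1..min t \<Delta>} \<times> {1..p}).
        (let G = min t \<Delta> in
          \<integral>E. (real G / real t *
             (\<Sum>i = (g - 1) * (t div G) + 1..g * (t div G).
                (E (j, i) - E (j, n + 1 - i)) / sqrt 2))\<^sup>2 \<partial>P))"

definition is_test_family ::
    "nat \<Rightarrow> nat \<Rightarrow> ((nat \<times> nat \<times> nat \<Rightarrow> real) \<Rightarrow> (nat \<times> nat \<Rightarrow> real) \<Rightarrow> real) \<Rightarrow> bool" where
  "is_test_family p n \<phi> \<longleftrightarrow> (\<forall>v. \<phi> v \<in> mat_space p n \<rightarrow>\<^sub>M count_space {0, 1})"

text \<open>The suprema are taken in \<open>ennreal\<close> so that a supremum over an empty noise class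
  (which occurs for \<open>K < 1\<close>) is \<open>0\<close>.\<close>

definition testing_error ::
    "real \<Rightarrow> real \<Rightarrow> real \<Rightarrow> real \<Rightarrow> nat \<Rightarrow> nat \<Rightarrow> nat \<Rightarrow> real \<Rightarrow>
     ((nat \<times> nat \<times> nat \<Rightarrow> real) \<Rightarrow> (nat \<times> nat \<Rightarrow> real) \<Rightarrow> real) \<Rightarrow> ennreal" where
  "testing_error \<alpha> K c\<^sub>1 c\<^sub>2 p n \<Delta> \<rho> \<phi> =
     (SUP P\<in>P_Temp \<alpha> K c\<^sub>1 c\<^sub>2 p n. SUP \<theta>\<in>Theta_null p n.
        ennreal (\<integral>X. \<phi> (second_moments p n \<Delta> P) X \<partial>law_data p n \<theta> P)) +
     (SUP P\<in>P_Temp \<alpha> K c\<^sub>1 c\<^sub>2 p n. SUP \<theta>\<in>Theta_alt p n \<rho>.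
        ennreal (\<integral>X. 1 - \<phi> (second_moments p n \<Delta> P) X \<partial>law_data p n \<theta> P))"

end

theory Submission
  imports Defs
begin

text \<open>At each dyadic scale \<open>t\<close> the first and the last \<open>t\<close> columns are compared on \<open>\<Delta>\<close> blocks, and a block
  votes for a change point if its centred energy \<open>\<Sum>\<^sub>j (Y\<^sub>j\<^sup>2 - v\<^sub>j)\<close> exceeds a multiple of \<open>\<surd>p \<Delta> / t\<close>.
  Rows are independent and block means have fourth moments \<open>O((\<Delta> / t)\<^sup>2)\<close>, by a covariance inequality
  for \<open>\<alpha>\<close>-mixing variables, so that by Chebyshev every single vote is wrong with small probability.
  Only the blocks in a Cantor-like subset of \<open>{1..\<Delta>}\<close> with \<open>N \<approx> log log n\<close> elements may vote: there the
  mixing errors are dominated by the product bounds, and the majority is wrong with probability at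
  most \<open>exp (- N)\<close>, which survives the union bound over the \<open>O(log n)\<close> scales. This costs
  \<open>\<Delta> = O(N log N)\<close>. Change points closer than \<open>\<Delta>\<close> to the boundary have so large a jump that
  comparing the first with the last column suffices.\<close>

section \<open>Covariances under mixing\<close>

text \<open>With N = 2^k voting blocks, a wrong majority contains one of at most 2^N sets of at
  least N/2 wrong votes, and mixing costs another factor 2^N. Votes of level u^2 thus give (4u)^N,
  and u = exp(-1)/4 turns this into exp(-N). Why contrasts of columns i and n+1-i: as long as i does
  not exceed the distance of the change to the nearer end, the difference has the full jump as mean,
  wherever the change is. The price is that every block occupies both ends of the sample, so that
  the columns of two groups of blocks interlace; this is where the interlaced mixing coefficient
  enters. Why the second moments must be known: under dependence the variance of a block mean of
  length b is of order 1/b with a constant that the noise class does not fix. Over p rows an error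
  in it would add up to order p/b, whereas the fluctuations to be detected are of order sqrt p / b.
  Why \<Delta> enters the separation: blocks of length t/\<Delta> raise the threshold from sqrt p /
  t to sqrt p \<Delta> / t.\<close>

definition weak_dep :: "'a measure \<Rightarrow> real \<Rightarrow> ('a \<Rightarrow> real) \<Rightarrow> ('a \<Rightarrow> real) \<Rightarrow> bool" where
  "weak_dep M \<delta> X Y \<longleftrightarrow> (\<forall>A\<in>sets borel. \<forall>B\<in>sets borel.
     \<bar>measure M {\<omega>\<in>space M. X \<omega> \<in> A \<and> Y \<omega> \<in> B}
       - measure M {\<omega>\<in>space M. X \<omega> \<in> A} * measure M {\<omega>\<in>space M. Y \<omega> \<in> B}\<bar> \<le> \<delta>)"

text \<open>\<open>weak_dep\<close> bounds the mixing coefficient of the sigma-algebras generated by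
  \<open>X\<close> and \<open>Y\<close>, and composition only shrinks these.\<close>

lemma weak_dep_compose:
  assumes "weak_dep M \<delta> X Y" and f: "f \<in> borel_measurable borel" and g: "g \<in> borel_measurable borel"
  shows "weak_dep M \<delta> (\<lambda>\<omega>. f (X \<omega>)) (\<lambda>\<omega>. g (Y \<omega>))"
  unfolding weak_dep_def
proof (intro ballI)
  fix A B :: "real set" assume "A \<in> sets borel" "B \<in> sets borel"
  then have "f -` A \<in> sets borel" "g -` B \<in> sets borel"
    using measurable_sets[OF f] measurable_sets[OF g] by auto
  with assms(1) show "\<bar>measure M {\<omega>\<in>space M. f (X \<omega>) \<in> A \<and> g (Y \<omega>) \<in> B}
       - measure M {\<omega>\<in>space M. f (X \<omega>) \<in> A} * measure M {\<omega>\<in>space M. g (Y \<omega>) \<in> B}\<bar> \<le> \<delta>"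
    unfolding weak_dep_def by (force dest: bspec[of _ _ "f -` A"] bspec[of _ _ "g -` B"])
qed

text \<open>A discrete layer-cake formula: it writes rounding down as a sum of indicators of events,
  to which \<open>weak_dep\<close> applies.\<close>

lemma sum_of_bool_le_eq_floor:
  fixes y :: real
  assumes "0 \<le> y" "y \<le> real m"
  shows "(\<Sum>k=1..m. of_bool (real k \<le> y)) = real_of_int \<lfloor>y\<rfloor>"
proof -
  have "{k\<in>{1..m}. real k \<le> y} = {1..nat \<lfloor>y\<rfloor>}"
  proof (intro set_eqI iffI)
    fix k assume "k \<in> {k\<in>{1..m}. real k \<le> y}"
    then show "k \<in> {1..nat \<lfloor>y\<rfloor>}" by (auto simp: le_nat_iff le_floor_iff)
  next
    fix k assume k: "k \<in> {1..nat \<lfloor>y\<rfloor>}"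
    then have "real k \<le> y"
      by (metis assms(1) atLeastAtMost_iff le_nat_floor le_nat_iff le_floor_iff of_int_of_nat_eq floor_of_nat floor_mono zero_le_floor le_floor_iff)
    moreover from this assms have "real k \<le> real m" by linarith
    ultimately show "k \<in> {k\<in>{1..m}. real k \<le> y}" using k by auto
  qed
  moreover have "(\<Sum>k=1..m. of_bool (real k \<le> y)) = real (card {k\<in>{1..m}. real k \<le> y})"
    by (simp add: sum_of_bool_eq Int_def conj_commute)
  ultimately show ?thesis using assms by simp
qed

context prob_space
begin

text \<open>A discrete form of Hoeffding's formula, by which the covariance is the integral of P(X
  >= s, Y >= t) - P(X >= s) P(Y >= t). Rounded to multiples of 1/m, both variables are averages of m
  indicators, so their covariance is an average of m^2 terms of size at most \<delta>; then m tends
  to infinity.\<close>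

lemma weak_dep_cov_unit:
  assumes [measurable]: "X \<in> borel_measurable M" "Y \<in> borel_measurable M"
    and X01: "\<And>\<omega>. 0 \<le> X \<omega> \<and> X \<omega> \<le> 1" and Y01: "\<And>\<omega>. 0 \<le> Y \<omega> \<and> Y \<omega> \<le> 1"
    and wd: "weak_dep M \<delta> X Y"
  shows "\<bar>expectation (\<lambda>\<omega>. X \<omega> * Y \<omega>) - expectation X * expectation Y\<bar> \<le> \<delta>"
proof -
  \<comment> \<open>The error 4/m is 2/m for the mean of the product and 2/m for the product of the
    means.\<close>
  have bound: "\<bar>expectation (\<lambda>\<omega>. X \<omega> * Y \<omega>) - expectation X * expectation Y\<bar> \<le> \<delta> + 4 / real m"
    if m: "m > 0" for m :: nat
  proof -
    define D :: "real \<Rightarrow> real" where "D x = (\<Sum>k=1..m. of_bool (real k \<le> real m * x)) / real m" for x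
    have D_meas[measurable]: "D \<in> borel_measurable borel" unfolding D_def by measurable
    have D_close: "\<bar>x - D x\<bar> \<le> 1 / real m \<and> 0 \<le> D x \<and> D x \<le> 1" if "0 \<le> x \<and> x \<le> 1" for x
    proof -
      have le: "0 \<le> real m * x" "real m * x \<le> real m" using that m by (auto simp: mult_left_le)
      have D: "D x = \<lfloor>real m * x\<rfloor> / real m" unfolding D_def using sum_of_bool_le_eq_floor[OF le] by simp
      have "\<bar>x - D x\<bar> = \<bar>real m * x - \<lfloor>real m * x\<rfloor>\<bar> / real m"
        unfolding D using m by (simp add: field_simps abs_mult)
      also have "\<dots> \<le> 1 / real m"
        by (intro divide_right_mono) linarith+
      finally have "\<bar>x - D x\<bar> \<le> 1 / real m" .
      moreover have "0 \<le> \<lfloor>real m * x\<rfloor>" "real_of_int \<lfloor>real m * x\<rfloor> \<le> real m" using le by linarith+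
      ultimately show ?thesis unfolding D using m by (simp add: divide_le_eq)
    qed
    define X' Y' where "X' = (\<lambda>\<omega>. D (X \<omega>))" and "Y' = (\<lambda>\<omega>. D (Y \<omega>))"
    have [measurable]: "X' \<in> borel_measurable M" "Y' \<in> borel_measurable M" unfolding X'_def Y'_def by measurable
    have X': "\<bar>X \<omega> - X' \<omega>\<bar> \<le> 1 / real m \<and> 0 \<le> X' \<omega> \<and> X' \<omega> \<le> 1"
      and Y': "\<bar>Y \<omega> - Y' \<omega>\<bar> \<le> 1 / real m \<and> 0 \<le> Y' \<omega> \<and> Y' \<omega> \<le> 1" for \<omega>
      unfolding X'_def Y'_def using D_close X01 Y01 by auto
    have int: "integrable M X" "integrable M Y" "integrable M X'" "integrable M Y'"
      "integrable M (\<lambda>\<omega>. X \<omega> * Y \<omega>)" "integrable M (\<lambda>\<omega>. X' \<omega> * Y' \<omega>)"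
      using X01 Y01 X' Y' by (auto intro!: integrable_const_bound[where B=1] simp: abs_mult mult_le_one)
    define c where "c = (\<lambda>k Z. {\<omega>\<in>space M. real k \<le> real m * Z \<omega>})"
    have eX: "expectation X' = (\<Sum>k=1..m. prob (c k X)) / real m"
      and eY: "expectation Y' = (\<Sum>k=1..m. prob (c k Y)) / real m"
    proof -
      have *: "expectation (\<lambda>\<omega>. D (Z \<omega>)) = (\<Sum>k=1..m. prob (c k Z)) / real m" if [measurable]: "Z \<in> borel_measurable M" for Z
      proof -
        have "expectation (\<lambda>\<omega>. D (Z \<omega>)) = expectation (\<lambda>\<omega>. (\<Sum>k=1..m. indicator (c k Z) \<omega>) / real m)"
          unfolding D_def c_def by (intro Bochner_Integration.integral_cong) (auto simp: indicator_def of_bool_def intro!: sum.cong)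
        also have "\<dots> = (\<Sum>k=1..m. expectation (indicator (c k Z))) / real m"
          unfolding c_def by (subst integral_divide_zero, subst Bochner_Integration.integral_sum) (auto simp: emeasure_eq_measure)
        finally show ?thesis by (simp add: c_def Collect_conj_eq)
      qed
      show "expectation X' = (\<Sum>k=1..m. prob (c k X)) / real m" "expectation Y' = (\<Sum>k=1..m. prob (c k Y)) / real m"
        unfolding X'_def Y'_def by (rule *; measurable)+
    qed
    have eXY: "expectation (\<lambda>\<omega>. X' \<omega> * Y' \<omega>) = (\<Sum>k=1..m. \<Sum>l=1..m. prob (c k X \<inter> c l Y)) / (real m)\<^sup>2"
    proof -
      have "expectation (\<lambda>\<omega>. X' \<omega> * Y' \<omega>) =
          expectation (\<lambda>\<omega>. (\<Sum>k=1..m. \<Sum>l=1..m. indicator (c k X \<inter> c l Y) \<omega>) / (real m)\<^sup>2)"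
        unfolding X'_def Y'_def D_def c_def
        by (intro Bochner_Integration.integral_cong)
          (auto simp: sum_product power2_eq_square indicator_def of_bool_def intro!: sum.cong)
      also have "\<dots> = (\<Sum>k=1..m. \<Sum>l=1..m. expectation (indicator (c k X \<inter> c l Y))) / (real m)\<^sup>2"
        unfolding c_def by (subst integral_divide_zero, subst Bochner_Integration.integral_sum)
          (auto simp: emeasure_eq_measure intro!: sum.cong Bochner_Integration.integral_sum Bochner_Integration.integrable_sum)
      finally show ?thesis by (simp add: c_def Collect_conj_eq Int_ac)
    qed
    have pr: "\<bar>prob (c k X \<inter> c l Y) - prob (c k X) * prob (c l Y)\<bar> \<le> \<delta>" for k l
    proof -
      have "{x. real j \<le> real m * x} \<in> sets borel" for j :: nat by measurable
      from wd[unfolded weak_dep_def, rule_format, OF this this, of k l] show ?thesis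
        by (simp add: c_def Collect_conj_eq Int_ac) 
    qed
    have "\<bar>expectation (\<lambda>\<omega>. X' \<omega> * Y' \<omega>) - expectation X' * expectation Y'\<bar>
        = \<bar>(\<Sum>k=1..m. \<Sum>l=1..m. prob (c k X \<inter> c l Y) - prob (c k X) * prob (c l Y))\<bar> / (real m)\<^sup>2"
      unfolding eX eY eXY using m
      by (simp add: sum_subtractf sum_product power2_eq_square diff_divide_distrib[symmetric])
    also have "\<dots> \<le> (\<Sum>k=1..m. \<Sum>l=1..m. \<delta>) / (real m)\<^sup>2"
      by (intro divide_right_mono order_trans[OF sum_abs] sum_mono) (auto intro!: order_trans[OF sum_abs] sum_mono pr)
    also have "\<dots> = \<delta>" using m by (simp add: power2_eq_square)
    finally have cov': "\<bar>expectation (\<lambda>\<omega>. X' \<omega> * Y' \<omega>) - expectation X' * expectation Y'\<bar> \<le> \<delta>" .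
    have dX: "\<bar>expectation X - expectation X'\<bar> \<le> 1 / real m" and dY: "\<bar>expectation Y - expectation Y'\<bar> \<le> 1 / real m"
      and dXY: "\<bar>expectation (\<lambda>\<omega>. X \<omega> * Y \<omega>) - expectation (\<lambda>\<omega>. X' \<omega> * Y' \<omega>)\<bar> \<le> 2 / real m"
    proof -
      have *: "\<bar>expectation U - expectation V\<bar> \<le> e" if "integrable M U" "integrable M V" "\<And>\<omega>. \<bar>U \<omega> - V \<omega>\<bar> \<le> e" for U V :: "'a \<Rightarrow> real" and e
      proof -
        have "\<bar>expectation U - expectation V\<bar> = \<bar>expectation (\<lambda>\<omega>. U \<omega> - V \<omega>)\<bar>" using that by simp
        also have "\<dots> \<le> expectation (\<lambda>\<omega>. \<bar>U \<omega> - V \<omega>\<bar>)" by (rule integral_abs_bound)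
        also have "\<dots> \<le> expectation (\<lambda>\<omega>. e)" using that by (intro integral_mono) auto
        finally show ?thesis by (simp add: prob_space)
      qed
      show "\<bar>expectation X - expectation X'\<bar> \<le> 1 / real m" "\<bar>expectation Y - expectation Y'\<bar> \<le> 1 / real m"
        using * int X' Y' by blast+
      have "\<bar>X \<omega> * Y \<omega> - X' \<omega> * Y' \<omega>\<bar> \<le> 2 / real m" for \<omega>
      proof -
        have "\<bar>X \<omega> * Y \<omega> - X' \<omega> * Y' \<omega>\<bar> = \<bar>(X \<omega> - X' \<omega>) * Y \<omega> + X' \<omega> * (Y \<omega> - Y' \<omega>)\<bar>" by (simp add: algebra_simps)
        also have "\<dots> \<le> \<bar>X \<omega> - X' \<omega>\<bar> * \<bar>Y \<omega>\<bar> + \<bar>X' \<omega>\<bar> * \<bar>Y \<omega> - Y' \<omega>\<bar>"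
          by (metis abs_mult abs_triangle_ineq)
        also have "\<dots> \<le> 1 / real m * 1 + 1 * (1 / real m)"
          using X'[of \<omega>] Y'[of \<omega>] X01[of \<omega>] Y01[of \<omega>] by (intro add_mono mult_mono) auto
        finally show ?thesis by simp
      qed
      then show "\<bar>expectation (\<lambda>\<omega>. X \<omega> * Y \<omega>) - expectation (\<lambda>\<omega>. X' \<omega> * Y' \<omega>)\<bar> \<le> 2 / real m"
        using * int by blast
    qed
    have e01: "\<bar>expectation Y\<bar> \<le> 1" "\<bar>expectation X'\<bar> \<le> 1"
    proof -
      have "\<bar>expectation Z\<bar> \<le> 1" if "integrable M Z" "\<And>\<omega>. 0 \<le> Z \<omega> \<and> Z \<omega> \<le> 1" for Z :: "'a \<Rightarrow> real"
        using integral_mono[OF that(1), of "\<lambda>_. 1"] integral_nonneg_AE[of Z M] that by (auto simp: prob_space)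
      then show "\<bar>expectation Y\<bar> \<le> 1" "\<bar>expectation X'\<bar> \<le> 1" using int Y01 X' by auto
    qed
    have "\<bar>expectation X * expectation Y - expectation X' * expectation Y'\<bar>
      = \<bar>(expectation X - expectation X') * expectation Y + expectation X' * (expectation Y - expectation Y')\<bar>"
      by (simp add: algebra_simps)
    also have "\<dots> \<le> \<bar>expectation X - expectation X'\<bar> * \<bar>expectation Y\<bar> + \<bar>expectation X'\<bar> * \<bar>expectation Y - expectation Y'\<bar>"
      by (metis abs_mult abs_triangle_ineq)
    also have "\<dots> \<le> 1 / real m * 1 + 1 * (1 / real m)"
      using dX dY e01 by (intro add_mono mult_mono) auto
    finally have "\<bar>expectation X * expectation Y - expectation X' * expectation Y'\<bar> \<le> 2 / real m" by simp
    with cov' dXY show ?thesis by (simp add: field_simps abs_le_iff)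
  qed
  have lim: "(\<lambda>m. \<delta> + 4 / real m) \<longlonglongrightarrow> \<delta> + 0"
    by (intro tendsto_intros lim_const_over_n)
  have ev: "\<forall>\<^sub>F m in sequentially. \<bar>expectation (\<lambda>\<omega>. X \<omega> * Y \<omega>) - expectation X * expectation Y\<bar> \<le> \<delta> + 4 / real m"
    using eventually_gt_at_top[of 0] by eventually_elim (rule bound)
  show ?thesis using tendsto_lowerbound[OF lim ev] by simp
qed

text \<open>An affine map to the unit interval reduces this to \<open>weak_dep_cov_unit\<close>:
  shifts do not change a covariance, and the scalings 2A and 2B give the factor 4AB.\<close>

lemma weak_dep_cov_bounded:
  assumes [measurable]: "X \<in> borel_measurable M" "Y \<in> borel_measurable M"
    and XA: "\<And>\<omega>. \<bar>X \<omega>\<bar> \<le> A" and YB: "\<And>\<omega>. \<bar>Y \<omega>\<bar> \<le> B" and pos: "A > 0" "B > 0"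
    and wd: "weak_dep M \<delta> X Y"
  shows "\<bar>expectation (\<lambda>\<omega>. X \<omega> * Y \<omega>) - expectation X * expectation Y\<bar> \<le> 4 * \<delta> * (A * B)"
proof -
  define X' Y' where "X' = (\<lambda>\<omega>. (X \<omega> + A) / (2 * A))" and "Y' = (\<lambda>\<omega>. (Y \<omega> + B) / (2 * B))"
  have [measurable]: "X' \<in> borel_measurable M" "Y' \<in> borel_measurable M" unfolding X'_def Y'_def by measurable
  have "weak_dep M \<delta> X' Y'" unfolding X'_def Y'_def by (rule weak_dep_compose[OF wd]) measurable
  moreover have X01: "0 \<le> X' \<omega> \<and> X' \<omega> \<le> 1" for \<omega> unfolding X'_def using XA[of \<omega>] pos by (auto simp: field_simps)
  moreover have Y01: "0 \<le> Y' \<omega> \<and> Y' \<omega> \<le> 1" for \<omega> unfolding Y'_def using YB[of \<omega>] pos by (auto simp: field_simps)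
  ultimately have *: "\<bar>expectation (\<lambda>\<omega>. X' \<omega> * Y' \<omega>) - expectation X' * expectation Y'\<bar> \<le> \<delta>"
    by (intro weak_dep_cov_unit) auto
  have int: "integrable M X'" "integrable M Y'" "integrable M (\<lambda>\<omega>. X' \<omega> * Y' \<omega>)"
    using X01 Y01 by (auto intro!: integrable_const_bound[where B=1] simp: abs_mult mult_le_one)
  have X: "X = (\<lambda>\<omega>. 2 * A * X' \<omega> - A)" and Y: "Y = (\<lambda>\<omega>. 2 * B * Y' \<omega> - B)"
    unfolding X'_def Y'_def using pos by auto
  have XY: "(\<lambda>\<omega>. X \<omega> * Y \<omega>) = (\<lambda>\<omega>. 4 * A * B * (X' \<omega> * Y' \<omega>) - 2 * A * B * X' \<omega> - 2 * A * B * Y' \<omega> + A * B)"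
    unfolding X Y by (auto simp: algebra_simps)
  have "expectation (\<lambda>\<omega>. X \<omega> * Y \<omega>) - expectation X * expectation Y
      = 4 * A * B * (expectation (\<lambda>\<omega>. X' \<omega> * Y' \<omega>) - expectation X' * expectation Y')"
  proof -
    have eX: "expectation X = 2 * A * expectation X' - A" and eY: "expectation Y = 2 * B * expectation Y' - B"
      by (subst X, use int in \<open>simp add: prob_space\<close>) (subst Y, use int in \<open>simp add: prob_space\<close>)
    have eXY: "expectation (\<lambda>\<omega>. X \<omega> * Y \<omega>) = 4 * A * B * expectation (\<lambda>\<omega>. X' \<omega> * Y' \<omega>)
        - 2 * A * B * expectation X' - 2 * A * B * expectation Y' + A * B"
      unfolding XY using int by (simp add: prob_space)
    show ?thesis unfolding eXY unfolding eX eY by (simp add: algebra_simps)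
  qed
  then have "\<bar>expectation (\<lambda>\<omega>. X \<omega> * Y \<omega>) - expectation X * expectation Y\<bar>
      = 4 * A * B * \<bar>expectation (\<lambda>\<omega>. X' \<omega> * Y' \<omega>) - expectation X' * expectation Y'\<bar>"
    using pos by (simp add: abs_mult)
  also have "\<dots> \<le> 4 * A * B * \<delta>" using * pos by (intro mult_left_mono) auto
  finally show ?thesis by (simp add: algebra_simps)
qed

end

section \<open>Truncation and covariances of variables with moments\<close>

definition trunc :: "real \<Rightarrow> real \<Rightarrow> real" where
  "trunc b u = (if \<bar>u\<bar> \<le> b then u else 0)"

lemma trunc_measurable [measurable]: "trunc b \<in> borel_measurable borel"
  unfolding trunc_def by measurable

lemma abs_trunc_le: "0 \<le> b \<Longrightarrow> \<bar>trunc b u\<bar> \<le> b" "\<bar>trunc b u\<bar> \<le> \<bar>u\<bar>"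
  unfolding trunc_def by auto

text \<open>The parameter \<open>x\<close> counts factors: a product of x variables with a-th
  moments has moments of order a/x. Beyond the level, |u| is |u|^(1 - a/x) times |u|^(a/x), and the
  first exponent is negative because x <= 4 < a.\<close>

lemma trunc_error:
  assumes "x \<ge> 1" "x \<le> 4" "a > 4" "T \<ge> 1"
  shows "\<bar>u - trunc (T powr x) u\<bar> \<le> T powr (4 - a) * \<bar>u\<bar> powr (a / x)"
proof (cases "\<bar>u\<bar> \<le> T powr x")
  case False
  then have big: "T powr x < \<bar>u\<bar>" by simp
  have "\<bar>u\<bar> = \<bar>u\<bar> powr (1 - a / x) * \<bar>u\<bar> powr (a / x)"
    using big by (simp flip: powr_add) 
  also have "\<bar>u\<bar> powr (1 - a / x) \<le> (T powr x) powr (1 - a / x)"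
    using big assms by (intro powr_mono2') (auto simp: field_simps)
  also have "(T powr x) powr (1 - a / x) = T powr (x - a)"
  proof -
    have "x * (1 - a / x) = x - a" using assms by (simp add: right_diff_distrib)
    then show ?thesis by (simp add: powr_powr)
  qed
  also have "\<dots> \<le> T powr (4 - a)" using assms by (intro powr_mono) auto
  finally show ?thesis using False by (simp add: trunc_def mult_right_mono)
qed (simp add: trunc_def)

text \<open>\<open>U\<close> is the common scale on which u has size at most U^x and v at most U^y.
  If a truncation acts then U > T, and |uv| <= U^4 = U^(4-a) U^a. Since \<open>trunc\<close> sends
  large values to 0 instead of clipping them, the truncated product then vanishes and the error is
  exactly |uv|.\<close>

lemma trunc_mult_error:
  assumes "x \<ge> 1" "y \<ge> 1" "x + y = 4" "a > 4" "T \<ge> 1"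
  shows "\<bar>u * v - trunc (T powr x) u * trunc (T powr y) v\<bar>
    \<le> T powr (4 - a) * (\<bar>u\<bar> powr (a / x) + \<bar>v\<bar> powr (a / y))"
proof (cases "\<bar>u\<bar> \<le> T powr x \<and> \<bar>v\<bar> \<le> T powr y")
  case False
  define U where "U = max (\<bar>u\<bar> powr (1 / x)) (\<bar>v\<bar> powr (1 / y))"
  have root_less: "T < \<bar>w\<bar> powr (1 / z)" if "\<not> \<bar>w\<bar> \<le> T powr z" "z \<ge> 1" for w z :: real
  proof -
    have "T = (T powr z) powr (1 / z)" using that assms by (simp add: powr_powr)
    also have "\<dots> < \<bar>w\<bar> powr (1 / z)" using that by (intro powr_less_mono2) auto
    finally show ?thesis .
  qed
  then have U: "T < U" using False assms unfolding U_def by (auto simp: less_max_iff_disj)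
  have le: "\<bar>u\<bar> \<le> U powr x" "\<bar>v\<bar> \<le> U powr y"
  proof -
    have "\<bar>w\<bar> \<le> U powr z" if "\<bar>w\<bar> powr (1 / z) \<le> U" "z \<ge> 1" for w z :: real
    proof -
      have "\<bar>w\<bar> = (\<bar>w\<bar> powr (1 / z)) powr z" using that by (simp add: powr_powr)
      also have "\<dots> \<le> U powr z" using that by (intro powr_mono2) auto
      finally show ?thesis .
    qed
    then show "\<bar>u\<bar> \<le> U powr x" "\<bar>v\<bar> \<le> U powr y" using assms unfolding U_def by auto
  qed
  have "trunc (T powr x) u * trunc (T powr y) v = 0"
    using False by (auto simp: trunc_def)
  then have "\<bar>u * v - trunc (T powr x) u * trunc (T powr y) v\<bar> = \<bar>u\<bar> * \<bar>v\<bar>"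
    by (simp only: abs_mult diff_0_right)
  also have "\<dots> \<le> U powr x * U powr y" using le by (intro mult_mono) auto
  also have "\<dots> = U powr (4 - a) * U powr a" using assms by (simp flip: powr_add)
  also have "\<dots> \<le> T powr (4 - a) * U powr a"
    using U assms by (intro mult_right_mono powr_mono2') auto
  also have "U powr a \<le> \<bar>u\<bar> powr (a / x) + \<bar>v\<bar> powr (a / y)"
    unfolding U_def max_def by (auto simp: powr_powr)
  finally show ?thesis by (simp add: mult_left_mono)
qed (auto simp: trunc_def)

context prob_space
begin

text \<open>A covariance inequality of Davydov type: both variables are truncated, at levels which make the
  truncation errors comparable.\<close>

lemma weak_dep_cov_powr:
  fixes x y a T \<kappa> :: real
  assumes [measurable]: "X \<in> borel_measurable M" "Y \<in> borel_measurable M"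
    and wd: "weak_dep M \<delta> X Y" and "\<delta> \<ge> 0"
    and xy: "x \<ge> 1" "y \<ge> 1" "x + y = 4" and a: "a > 4" and T: "T \<ge> 1"
    and iX: "integrable M (\<lambda>\<omega>. \<bar>X \<omega>\<bar> powr (a / x))" "expectation (\<lambda>\<omega>. \<bar>X \<omega>\<bar> powr (a / x)) \<le> \<kappa>"
    and iY: "integrable M (\<lambda>\<omega>. \<bar>Y \<omega>\<bar> powr (a / y))" "expectation (\<lambda>\<omega>. \<bar>Y \<omega>\<bar> powr (a / y)) \<le> \<kappa>"
  shows "\<bar>expectation (\<lambda>\<omega>. X \<omega> * Y \<omega>) - expectation X * expectation Y\<bar>
      \<le> 2 * \<kappa> * (2 + \<kappa>) * T powr (4 - a) + 4 * \<delta> * T powr 4"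
proof -
  define X' Y' where "X' = (\<lambda>\<omega>. trunc (T powr x) (X \<omega>))" and "Y' = (\<lambda>\<omega>. trunc (T powr y) (Y \<omega>))"
  define \<tau> where "\<tau> = T powr (4 - a)"
  have \<tau>: "\<tau> \<ge> 0" unfolding \<tau>_def by simp
  have \<kappa>: "\<kappa> \<ge> 0" using order_trans[OF _ iX(2), of 0] by simp
  have [measurable]: "X' \<in> borel_measurable M" "Y' \<in> borel_measurable M" unfolding X'_def Y'_def by measurable
  have bd: "\<bar>X' \<omega>\<bar> \<le> T powr x" "\<bar>Y' \<omega>\<bar> \<le> T powr y" "\<bar>X' \<omega>\<bar> \<le> \<bar>X \<omega>\<bar>" for \<omega>
    unfolding X'_def Y'_def by (auto intro: abs_trunc_le)
  have eX: "\<bar>X \<omega> - X' \<omega>\<bar> \<le> \<tau> * \<bar>X \<omega>\<bar> powr (a / x)" and eY: "\<bar>Y \<omega> - Y' \<omega>\<bar> \<le> \<tau> * \<bar>Y \<omega>\<bar> powr (a / y)" for \<omega>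
    unfolding X'_def Y'_def \<tau>_def using xy a T by (auto intro: trunc_error)
  have eXY: "\<bar>X \<omega> * Y \<omega> - X' \<omega> * Y' \<omega>\<bar> \<le> \<tau> * (\<bar>X \<omega>\<bar> powr (a / x) + \<bar>Y \<omega>\<bar> powr (a / y))" for \<omega>
    unfolding X'_def Y'_def \<tau>_def using xy a T by (auto intro: trunc_mult_error)
  have int': "integrable M X'" "integrable M Y'" "integrable M (\<lambda>\<omega>. X' \<omega> * Y' \<omega>)"
  proof -
    show "integrable M X'" by (rule integrable_const_bound[where B="T powr x"]) (simp_all add: bd)
    show "integrable M Y'" by (rule integrable_const_bound[where B="T powr y"]) (simp_all add: bd)
    have "\<bar>X' \<omega> * Y' \<omega>\<bar> \<le> T powr x * T powr y" for \<omega>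
      unfolding abs_mult using bd[of \<omega>] by (intro mult_mono) auto
    then show "integrable M (\<lambda>\<omega>. X' \<omega> * Y' \<omega>)"
      by (intro integrable_const_bound[where B="T powr x * T powr y"]) simp_all
  qed
  have intd: "integrable M (\<lambda>\<omega>. X \<omega> - X' \<omega>)" "integrable M (\<lambda>\<omega>. Y \<omega> - Y' \<omega>)"
    "integrable M (\<lambda>\<omega>. X \<omega> * Y \<omega> - X' \<omega> * Y' \<omega>)"
  proof -
    show "integrable M (\<lambda>\<omega>. X \<omega> - X' \<omega>)"
      by (rule Bochner_Integration.integrable_bound[where f="\<lambda>\<omega>. \<tau> * \<bar>X \<omega>\<bar> powr (a / x)"])
        (use iX eX \<tau> in \<open>simp_all add: abs_mult\<close>)
    show "integrable M (\<lambda>\<omega>. Y \<omega> - Y' \<omega>)"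
      by (rule Bochner_Integration.integrable_bound[where f="\<lambda>\<omega>. \<tau> * \<bar>Y \<omega>\<bar> powr (a / y)"])
        (use iY eY \<tau> in \<open>simp_all add: abs_mult\<close>)
    show "integrable M (\<lambda>\<omega>. X \<omega> * Y \<omega> - X' \<omega> * Y' \<omega>)"
      by (rule Bochner_Integration.integrable_bound[where f="\<lambda>\<omega>. \<tau> * (\<bar>X \<omega>\<bar> powr (a / x) + \<bar>Y \<omega>\<bar> powr (a / y))"])
        (use iX iY eXY \<tau> in \<open>simp_all add: abs_mult\<close>)
  qed
  have int: "integrable M X" "integrable M Y" "integrable M (\<lambda>\<omega>. X \<omega> * Y \<omega>)"
    using Bochner_Integration.integrable_add[OF intd(1) int'(1)]
      Bochner_Integration.integrable_add[OF intd(2) int'(2)]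
      Bochner_Integration.integrable_add[OF intd(3) int'(3)] by auto
  have diff: "\<bar>expectation U - expectation V\<bar> \<le> expectation W"
    if "integrable M U" "integrable M V" "integrable M W" "\<And>\<omega>. \<bar>U \<omega> - V \<omega>\<bar> \<le> W \<omega>" for U V W :: "'a \<Rightarrow> real"
  proof -
    have "\<bar>expectation U - expectation V\<bar> = \<bar>expectation (\<lambda>\<omega>. U \<omega> - V \<omega>)\<bar>" using that by simp
    also have "\<dots> \<le> expectation (\<lambda>\<omega>. \<bar>U \<omega> - V \<omega>\<bar>)" by (rule integral_abs_bound)
    also have "\<dots> \<le> expectation W" using that by (intro integral_mono) auto
    finally show ?thesis .
  qed
  have dX: "\<bar>expectation X - expectation X'\<bar> \<le> \<tau> * \<kappa>"
    using diff[OF int(1) int'(1) integrable_mult_right[OF iX(1)] eX] mult_left_mono[OF iX(2) \<tau>] by simp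
  have dY: "\<bar>expectation Y - expectation Y'\<bar> \<le> \<tau> * \<kappa>"
    using diff[OF int(2) int'(2) integrable_mult_right[OF iY(1)] eY] mult_left_mono[OF iY(2) \<tau>] by simp
  have dXY: "\<bar>expectation (\<lambda>\<omega>. X \<omega> * Y \<omega>) - expectation (\<lambda>\<omega>. X' \<omega> * Y' \<omega>)\<bar> \<le> \<tau> * (2 * \<kappa>)"
  proof -
    have "\<bar>expectation (\<lambda>\<omega>. X \<omega> * Y \<omega>) - expectation (\<lambda>\<omega>. X' \<omega> * Y' \<omega>)\<bar>
      \<le> \<tau> * (expectation (\<lambda>\<omega>. \<bar>X \<omega>\<bar> powr (a / x)) + expectation (\<lambda>\<omega>. \<bar>Y \<omega>\<bar> powr (a / y)))"
      using diff[OF int(3) int'(3) integrable_mult_right[OF Bochner_Integration.integrable_add[OF iX(1) iY(1)]] eXY] iX(1) iY(1) by simp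
    also have "\<dots> \<le> \<tau> * (2 * \<kappa>)" using iX iY \<tau> by (intro mult_left_mono) auto
    finally show ?thesis .
  qed
  \<comment> \<open>Truncation at level 1: a crude bound of first moments by moments of order
    a/w.\<close>
  have small: "\<bar>z\<bar> \<le> 1 + \<bar>z\<bar> powr (a / w)" if "w \<ge> 1" "w \<le> 4" for z w :: real
    using trunc_error[OF that a, of 1 z] abs_trunc_le(1)[of 1 z] by simp
  have e1: "\<bar>expectation Y\<bar> \<le> 1 + \<kappa>" "\<bar>expectation X'\<bar> \<le> 1 + \<kappa>"
  proof -
    have "\<bar>expectation Y - expectation (\<lambda>_. 0)\<bar> \<le> expectation (\<lambda>\<omega>. 1 + \<bar>Y \<omega>\<bar> powr (a / y))"
    proof (intro diff)
      show "\<bar>Y \<omega> - 0\<bar> \<le> 1 + \<bar>Y \<omega>\<bar> powr (a / y)" for \<omega>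
        using small[of y "Y \<omega>"] xy by simp
    qed (use int iY in simp_all)
    then show "\<bar>expectation Y\<bar> \<le> 1 + \<kappa>" using iY by (simp add: prob_space)
    have "\<bar>expectation X' - expectation (\<lambda>_. 0)\<bar> \<le> expectation (\<lambda>\<omega>. 1 + \<bar>X \<omega>\<bar> powr (a / x))"
    proof (intro diff)
      show "\<bar>X' \<omega> - 0\<bar> \<le> 1 + \<bar>X \<omega>\<bar> powr (a / x)" for \<omega>
        using order_trans[OF bd(3)[of \<omega>] small[of x "X \<omega>"]] xy by simp
    qed (use int' iX in simp_all)
    then show "\<bar>expectation X'\<bar> \<le> 1 + \<kappa>" using iX by (simp add: prob_space)
  qed
  have "\<bar>expectation X * expectation Y - expectation X' * expectation Y'\<bar>
    = \<bar>(expectation X - expectation X') * expectation Y + expectation X' * (expectation Y - expectation Y')\<bar>"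
    by (simp add: algebra_simps)
  also have "\<dots> \<le> \<bar>expectation X - expectation X'\<bar> * \<bar>expectation Y\<bar> + \<bar>expectation X'\<bar> * \<bar>expectation Y - expectation Y'\<bar>"
    by (metis abs_mult abs_triangle_ineq)
  also have "\<dots> \<le> \<tau> * \<kappa> * (1 + \<kappa>) + (1 + \<kappa>) * (\<tau> * \<kappa>)"
    using dX dY e1 \<kappa> \<tau> by (intro add_mono mult_mono) auto
  finally have dd: "\<bar>expectation X * expectation Y - expectation X' * expectation Y'\<bar> \<le> 2 * \<tau> * \<kappa> * (1 + \<kappa>)"
    by (simp add: algebra_simps)
  have "weak_dep M \<delta> X' Y'" unfolding X'_def Y'_def by (rule weak_dep_compose[OF wd]) measurable
  then have "\<bar>expectation (\<lambda>\<omega>. X' \<omega> * Y' \<omega>) - expectation X' * expectation Y'\<bar> \<le> 4 * \<delta> * (T powr x * T powr y)"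
    using T bd by (intro weak_dep_cov_bounded) simp_all
  also have "T powr x * T powr y = T powr 4" using xy by (simp flip: powr_add)
  finally have "\<bar>expectation (\<lambda>\<omega>. X' \<omega> * Y' \<omega>) - expectation X' * expectation Y'\<bar> \<le> 4 * \<delta> * T powr 4" .
  with dXY dd have "\<bar>expectation (\<lambda>\<omega>. X \<omega> * Y \<omega>) - expectation X * expectation Y\<bar>
      \<le> \<tau> * (2 * \<kappa>) + 2 * \<tau> * \<kappa> * (1 + \<kappa>) + 4 * \<delta> * T powr 4"
    by linarith
  also have "\<dots> = 2 * \<kappa> * (2 + \<kappa>) * \<tau> + 4 * \<delta> * T powr 4" by (simp add: algebra_simps)
  finally show ?thesis unfolding \<tau>_def .
qed

text \<open>The level T = exp(\<open>c\<^sub>2\<close> r / 8) balances the two errors: T^4 consumes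
  half of the decay exp(-\<open>c\<^sub>2\<close> r), and the tail factor T^(4-a) decays like
  exp(-(a-4) \<open>c\<^sub>2\<close> r / 8). The slower of the two rates survives.\<close>

lemma weak_dep_cov_exp:
  fixes x y a \<kappa> c\<^sub>2 r B :: real
  assumes meas: "X \<in> borel_measurable M" "Y \<in> borel_measurable M"
    and wd: "weak_dep M (B * exp (- c\<^sub>2 * r)) X Y" and B: "B \<ge> 0" and c: "c\<^sub>2 > 0" "r \<ge> 0"
    and xy: "x \<ge> 1" "y \<ge> 1" "x + y = 4" and a: "a > 4"
    and iX: "integrable M (\<lambda>\<omega>. \<bar>X \<omega>\<bar> powr (a / x))" "expectation (\<lambda>\<omega>. \<bar>X \<omega>\<bar> powr (a / x)) \<le> \<kappa>"
    and iY: "integrable M (\<lambda>\<omega>. \<bar>Y \<omega>\<bar> powr (a / y))" "expectation (\<lambda>\<omega>. \<bar>Y \<omega>\<bar> powr (a / y)) \<le> \<kappa>"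
  shows "\<bar>expectation (\<lambda>\<omega>. X \<omega> * Y \<omega>) - expectation X * expectation Y\<bar>
      \<le> (2 * \<kappa> * (2 + \<kappa>) + 4 * B) * exp (- min ((a - 4) * c\<^sub>2 / 8) (c\<^sub>2 / 2) * r)"
proof -
  define \<eta> where "\<eta> = min ((a - 4) * c\<^sub>2 / 8) (c\<^sub>2 / 2)"
  have \<kappa>: "\<kappa> \<ge> 0" using order_trans[OF _ iX(2), of 0] by simp
  define T where "T = exp (c\<^sub>2 * r / 8)"
  have T1: "T \<ge> 1" unfolding T_def using c by simp
  have le: "\<eta> * r \<le> (a - 4) * c\<^sub>2 / 8 * r" "\<eta> * r \<le> c\<^sub>2 / 2 * r"
    unfolding \<eta>_def using c by (intro mult_right_mono; simp)+
  have "T powr (4 - a) \<le> exp (- \<eta> * r)"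
    using le(1) by (simp add: T_def powr_def field_simps)
  then have 1: "2 * \<kappa> * (2 + \<kappa>) * T powr (4 - a) \<le> 2 * \<kappa> * (2 + \<kappa>) * exp (- \<eta> * r)"
    using \<kappa> by (intro mult_left_mono) auto
  have "4 * (B * exp (- c\<^sub>2 * r)) * T powr 4 = 4 * B * exp (- (c\<^sub>2 / 2 * r))"
    by (simp add: T_def powr_def field_simps flip: exp_add)
  also have "\<dots> \<le> 4 * B * exp (- \<eta> * r)"
    using le(2) B by (intro mult_left_mono) auto
  finally have 2: "4 * (B * exp (- c\<^sub>2 * r)) * T powr 4 \<le> 4 * B * exp (- \<eta> * r)" .
  have "\<bar>expectation (\<lambda>\<omega>. X \<omega> * Y \<omega>) - expectation X * expectation Y\<bar>
      \<le> 2 * \<kappa> * (2 + \<kappa>) * T powr (4 - a) + 4 * (B * exp (- c\<^sub>2 * r)) * T powr 4"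
    using B by (intro weak_dep_cov_powr[OF meas wd _ xy a T1 iX iY]) auto
  with 1 2 show ?thesis unfolding \<eta>_def[symmetric] distrib_right[of _ _ "exp (- \<eta> * r)"] by linarith
qed

end

section \<open>Fourth moments of sums\<close>

text \<open>Insertion sort with the three adjacent transpositions: \<open>h1\<close> inserts the
  fourth index into a sorted triple, \<open>h2\<close> the third into a sorted pair.\<close>

lemma wlog_sorted4:
  fixes Q :: "nat \<Rightarrow> nat \<Rightarrow> nat \<Rightarrow> nat \<Rightarrow> bool"
  assumes s1: "\<And>i j k l. Q i j k l \<Longrightarrow> Q j i k l" and s2: "\<And>i j k l. Q i j k l \<Longrightarrow> Q i k j l"
    and s3: "\<And>i j k l. Q i j k l \<Longrightarrow> Q i j l k"
    and sorted: "\<And>i j k l. i \<le> j \<Longrightarrow> j \<le> k \<Longrightarrow> k \<le> l \<Longrightarrow> Q i j k l"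
  shows "Q i j k l"
proof -
  have h1: "Q i j k l" if "i \<le> j" "j \<le> k" for i j k l
  proof -
    consider "k \<le> l" | "j \<le> l" "l \<le> k" | "i \<le> l" "l \<le> j" | "l \<le> i" by linarith
    then show ?thesis
    proof cases
      case 1 then show ?thesis using that sorted by blast
    next
      case 2 then have "Q i j l k" using that sorted by blast
      then show ?thesis by (rule s3)
    next
      case 3 then have "Q i l j k" using that sorted by blast
      then show ?thesis by (rule s3[OF s2])
    next
      case 4 then have "Q l i j k" using that sorted by blast
      then show ?thesis by (rule s3[OF s2[OF s1]])
    qed
  qed
  have h2: "Q i j k l" if "i \<le> j" for i j k l
  proof -
    consider "j \<le> k" | "i \<le> k" "k \<le> j" | "k \<le> i" by linarith
    then show ?thesis
    proof cases
      case 1 then show ?thesis using that h1 by blast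
    next
      case 2 then have "Q i k j l" using that h1 by blast
      then show ?thesis by (rule s2)
    next
      case 3 then have "Q k i j l" using that h1 by blast
      then show ?thesis by (rule s2[OF s1])
    qed
  qed
  show ?thesis using h2[of i j k l] s1[OF h2[of j i k l]] by (cases "i \<le> j") auto
qed

lemma powr_mult_le_add2:
  fixes u v a :: real
  assumes "a > 0"
  shows "\<bar>u * v\<bar> powr (a / 2) \<le> \<bar>u\<bar> powr a + \<bar>v\<bar> powr a"
proof -
  define m where "m = max \<bar>u\<bar> \<bar>v\<bar>"
  have m: "0 \<le> m" "\<bar>u\<bar> \<le> m" "\<bar>v\<bar> \<le> m" unfolding m_def by auto
  then have "\<bar>u * v\<bar> \<le> m ^ 2"
    unfolding abs_mult power2_eq_square by (intro mult_mono) auto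
  then have "\<bar>u * v\<bar> powr (a / 2) \<le> (m ^ 2) powr (a / 2)" using assms by (intro powr_mono2) auto
  also have "m ^ 2 = m powr 2" using m by simp
  also have "(m powr 2) powr (a / 2) = m powr a" by (simp only: powr_powr) simp
  also have "\<dots> \<le> \<bar>u\<bar> powr a + \<bar>v\<bar> powr a" unfolding m_def max_def by auto
  finally show ?thesis .
qed

lemma powr_mult_le_add3:
  fixes u v w a :: real
  assumes "a > 0"
  shows "\<bar>u * v * w\<bar> powr (a / 3) \<le> \<bar>u\<bar> powr a + \<bar>v\<bar> powr a + \<bar>w\<bar> powr a"
proof -
  define m where "m = max \<bar>u\<bar> (max \<bar>v\<bar> \<bar>w\<bar>)"
  have m: "0 \<le> m" "\<bar>u\<bar> \<le> m" "\<bar>v\<bar> \<le> m" "\<bar>w\<bar> \<le> m" unfolding m_def by auto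
  then have "\<bar>u * v * w\<bar> \<le> m ^ 3"
    unfolding abs_mult power3_eq_cube by (intro mult_mono) auto
  then have "\<bar>u * v * w\<bar> powr (a / 3) \<le> (m ^ 3) powr (a / 3)" using assms by (intro powr_mono2) auto
  also have "m ^ 3 = m powr 3" using m by simp
  also have "(m powr 3) powr (a / 3) = m powr a" by (simp only: powr_powr) simp
  also have "\<dots> \<le> \<bar>u\<bar> powr a + \<bar>v\<bar> powr a + \<bar>w\<bar> powr a"
    unfolding m_def max_def by (auto intro: add_nonneg_nonneg)
  finally show ?thesis .
qed

lemma power4_le_powr:
  fixes z a :: real
  assumes "a > 4"
  shows "z ^ 4 \<le> 1 + \<bar>z\<bar> powr a"
proof (cases "\<bar>z\<bar> \<le> 1")
  case True
  have "\<bar>z\<bar> ^ 4 \<le> 1" by (rule power_le_one) (use True in auto)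
  moreover have "\<bar>z\<bar> ^ 4 = z ^ 4" by (rule power_even_abs) simp
  ultimately show ?thesis by (simp add: add_increasing2)
next
  case False
  then have "\<bar>z\<bar> powr 4 \<le> \<bar>z\<bar> powr a" using assms by (intro powr_mono) auto
  moreover have "\<bar>z\<bar> powr 4 = \<bar>z\<bar> ^ 4" using False powr_realpow[of "\<bar>z\<bar>" 4] by simp
  moreover have "\<bar>z\<bar> ^ 4 = z ^ 4" by (rule power_even_abs) simp
  ultimately show ?thesis by linarith
qed

lemma abs_mult4_le:
  fixes u v w z :: real
  shows "\<bar>u * v * w * z\<bar> \<le> u ^ 4 + v ^ 4 + w ^ 4 + z ^ 4"
proof -
  have *: "\<bar>x * y\<bar> \<le> x\<^sup>2 + y\<^sup>2" for x y :: real
  proof -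
    have "2 * (\<bar>x\<bar> * \<bar>y\<bar>) \<le> x\<^sup>2 + y\<^sup>2" using sum_squares_bound[of "\<bar>x\<bar>" "\<bar>y\<bar>"] by simp
    moreover have "0 \<le> \<bar>x\<bar> * \<bar>y\<bar>" by simp
    ultimately show ?thesis unfolding abs_mult by linarith
  qed
  have "\<bar>u * v * w * z\<bar> = \<bar>(u * v) * (w * z)\<bar>" by (simp add: mult.assoc)
  also have "\<dots> \<le> \<bar>u * v\<bar>\<^sup>2 + \<bar>w * z\<bar>\<^sup>2" using *[of "u * v" "w * z"] by simp
  also have "\<dots> = \<bar>u\<^sup>2 * v\<^sup>2\<bar> + \<bar>w\<^sup>2 * z\<^sup>2\<bar>" by (simp add: power_mult_distrib)
  also have "\<dots> \<le> ((u\<^sup>2)\<^sup>2 + (v\<^sup>2)\<^sup>2) + ((w\<^sup>2)\<^sup>2 + (z\<^sup>2)\<^sup>2)" by (intro add_mono *)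
  finally show ?thesis by (simp flip: power_mult)
qed

text \<open>With truncated subtraction \<open>(i - j) + (j - i)\<close> is the distance of i and j.
  The indices on each side of i contribute at most one geometric series.\<close>

lemma sum_geometric_dist_le:
  fixes \<theta> :: real
  assumes \<theta>: "0 \<le> \<theta>" "\<theta> < 1" and fin: "finite J"
  shows "(\<Sum>j\<in>J. \<theta> ^ ((i - j) + (j - i))) \<le> 2 / (1 - \<theta>)"
proof -
  have geo: "(\<Sum>j\<in>K. \<theta> ^ f j) \<le> 1 / (1 - \<theta>)" if "finite K" "inj_on f K" for K and f :: "nat \<Rightarrow> nat"
  proof -
    have "(\<Sum>j\<in>K. \<theta> ^ f j) = (\<Sum>d\<in>f ` K. \<theta> ^ d)" using that by (simp add: sum.reindex)
    also have "\<dots> \<le> (\<Sum>d. \<theta> ^ d)" using that \<theta> by (intro sum_le_suminf summable_geometric) auto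
    also have "\<dots> = 1 / (1 - \<theta>)" using \<theta> by (intro suminf_geometric) auto
    finally show ?thesis .
  qed
  have "(\<Sum>j\<in>J. \<theta> ^ ((i - j) + (j - i)))
      = (\<Sum>j\<in>J \<inter> {..i}. \<theta> ^ ((i - j) + (j - i))) + (\<Sum>j\<in>J - {..i}. \<theta> ^ ((i - j) + (j - i)))"
    using fin by (rule sum.Int_Diff)
  also have "\<dots> = (\<Sum>j\<in>J \<inter> {..i}. \<theta> ^ (i - j)) + (\<Sum>j\<in>J - {..i}. \<theta> ^ (j - i))"
    by (intro arg_cong2[where f="(+)"] sum.cong) auto
  also have "\<dots> \<le> 1 / (1 - \<theta>) + 1 / (1 - \<theta>)"
    using fin by (intro add_mono geo) (auto intro!: inj_onI)
  finally show ?thesis by simp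
qed

text \<open>The square root of the decay factor in \<open>weak_dep_cov_exp\<close>. Separation by r
  gives \<open>mix_rate ^ (2 * r)\<close>, and the two factors per step are shared between two pairs
  of indices in \<open>expectation_four_sorted_le\<close>.\<close>

definition mix_rate :: "real \<Rightarrow> real \<Rightarrow> real" where
  "mix_rate a c = exp (- min ((a - 4) * c / 8) (c / 2) / 2)"

text \<open>The constant of \<open>weak_dep_cov_exp\<close> at the moment bound 1 + 3\<kappa>, which
  serves single variables and products of two or three of them alike.\<close>

definition mix_const :: "real \<Rightarrow> real \<Rightarrow> real" where
  "mix_const \<kappa> B = 2 * (1 + 3 * \<kappa>) * (2 + (1 + 3 * \<kappa>)) + 4 * B"

text \<open>The 12 is 3 * 2^2: there are three pairings of four indices, and each of the two
  distances in a pairing sums to at most 2 / (1 - rate) per index.\<close>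

definition fourth_const :: "real \<Rightarrow> real \<Rightarrow> real \<Rightarrow> real \<Rightarrow> real" where
  "fourth_const a \<kappa> B c = 12 * mix_const \<kappa> B * (1 + mix_const \<kappa> B) / (1 - mix_rate a c)\<^sup>2"

text \<open>\<open>F S\<close> stands for the information in the indices \<open>S\<close>. It may
  exceed what the \<open>e i\<close> generate: in the application it comes from whole columns, while
  \<open>e\<close> is a single row. The distance in \<open>mixing\<close> may be 0.\<close>

locale geom_mixing = prob_space M for M :: "'a measure" +
  fixes e :: "nat \<Rightarrow> 'a \<Rightarrow> real" and I :: "nat set" and F :: "nat set \<Rightarrow> 'a measure"
    and a \<kappa> B c\<^sub>2 :: real
  assumes e_meas: "i \<in> I \<Longrightarrow> e i \<in> borel_measurable M"
    and e_F: "i \<in> S \<Longrightarrow> S \<subseteq> I \<Longrightarrow> e i \<in> borel_measurable (F S)"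
    and e_mean: "i \<in> I \<Longrightarrow> expectation (e i) = 0"
    and e_int: "i \<in> I \<Longrightarrow> integrable M (\<lambda>\<omega>. \<bar>e i \<omega>\<bar> powr a)"
    and e_mom: "i \<in> I \<Longrightarrow> expectation (\<lambda>\<omega>. \<bar>e i \<omega>\<bar> powr a) \<le> \<kappa>"
    and a: "a > 4" and \<kappa>: "\<kappa> \<ge> 0" and B: "B \<ge> 0" and c2: "c\<^sub>2 > 0"
    and mixing: "\<And>S T X Y (r::nat). S \<subseteq> I \<Longrightarrow> T \<subseteq> I \<Longrightarrow> S \<noteq> {} \<Longrightarrow> T \<noteq> {} \<Longrightarrow>
        (\<And>s t. s \<in> S \<Longrightarrow> t \<in> T \<Longrightarrow> r \<le> (s - t) + (t - s)) \<Longrightarrow>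
        X \<in> borel_measurable (F S) \<Longrightarrow> Y \<in> borel_measurable (F T) \<Longrightarrow> weak_dep M (B * exp (- c\<^sub>2 * real r)) X Y"
begin

abbreviation "rate \<equiv> mix_rate a c\<^sub>2"
abbreviation "cst \<equiv> mix_const \<kappa> B"
definition "prox i j = rate ^ ((i - j) + (j - i))" for i j :: nat

lemma rate: "0 < rate" "rate < 1"
  unfolding mix_rate_def using a c2 by auto

lemma cst: "cst \<ge> 0" unfolding mix_const_def using \<kappa> B by simp

lemma prox_commute: "prox i j = prox j i" unfolding prox_def by (simp add: add.commute)

lemma cov_le:
  fixes r :: nat
  assumes "X \<in> borel_measurable M" "Y \<in> borel_measurable M"
    and "S \<subseteq> I" "T \<subseteq> I" "S \<noteq> {}" "T \<noteq> {}" "\<And>s t. s \<in> S \<Longrightarrow> t \<in> T \<Longrightarrow> r \<le> (s - t) + (t - s)"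
    and "X \<in> borel_measurable (F S)" "Y \<in> borel_measurable (F T)"
    and "x \<ge> 1" "y \<ge> 1" "x + y = 4"
    and "integrable M (\<lambda>\<omega>. \<bar>X \<omega>\<bar> powr (a / x))" "expectation (\<lambda>\<omega>. \<bar>X \<omega>\<bar> powr (a / x)) \<le> 1 + 3 * \<kappa>"
    and "integrable M (\<lambda>\<omega>. \<bar>Y \<omega>\<bar> powr (a / y))" "expectation (\<lambda>\<omega>. \<bar>Y \<omega>\<bar> powr (a / y)) \<le> 1 + 3 * \<kappa>"
  shows "\<bar>expectation (\<lambda>\<omega>. X \<omega> * Y \<omega>) - expectation X * expectation Y\<bar> \<le> cst * rate ^ (2 * r)"
proof -
  have "weak_dep M (B * exp (- c\<^sub>2 * real r)) X Y" using assms by (intro mixing[of S T])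
  then have "\<bar>expectation (\<lambda>\<omega>. X \<omega> * Y \<omega>) - expectation X * expectation Y\<bar>
    \<le> cst * exp (- min ((a - 4) * c\<^sub>2 / 8) (c\<^sub>2 / 2) * real r)"
    unfolding mix_const_def using assms a c2 B by (intro weak_dep_cov_exp) auto
  also have "exp (- min ((a - 4) * c\<^sub>2 / 8) (c\<^sub>2 / 2) * real r) = rate ^ (2 * r)"
    unfolding mix_rate_def by (subst exp_of_nat_mult[symmetric]) (simp add: field_simps)
  finally show ?thesis .
qed

lemma moment_half:
  assumes "i \<in> I"
  shows "integrable M (\<lambda>\<omega>. \<bar>e i \<omega>\<bar> powr (a / 2))" "expectation (\<lambda>\<omega>. \<bar>e i \<omega>\<bar> powr (a / 2)) \<le> 1 + 3 * \<kappa>"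
proof -
  have le: "\<bar>z\<bar> powr (a / 2) \<le> 1 + \<bar>z\<bar> powr a" for z :: real
    using powr_mult_le_add2[of a z 1] a by simp
  show i: "integrable M (\<lambda>\<omega>. \<bar>e i \<omega>\<bar> powr (a / 2))"
    by (rule Bochner_Integration.integrable_bound[where f="\<lambda>\<omega>. 1 + \<bar>e i \<omega>\<bar> powr a"])
      (use e_int e_meas assms le in auto)
  have "expectation (\<lambda>\<omega>. \<bar>e i \<omega>\<bar> powr (a / 2)) \<le> expectation (\<lambda>\<omega>. 1 + \<bar>e i \<omega>\<bar> powr a)"
    using i e_int assms le by (intro integral_mono) auto
  also have "\<dots> \<le> 1 + \<kappa>" using e_int e_mom assms by (simp add: prob_space)
  finally show "expectation (\<lambda>\<omega>. \<bar>e i \<omega>\<bar> powr (a / 2)) \<le> 1 + 3 * \<kappa>" using \<kappa> by simp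
qed

lemma moment_pair:
  assumes "i \<in> I" "j \<in> I"
  shows "integrable M (\<lambda>\<omega>. \<bar>e i \<omega> * e j \<omega>\<bar> powr (a / 2))"
    "expectation (\<lambda>\<omega>. \<bar>e i \<omega> * e j \<omega>\<bar> powr (a / 2)) \<le> 1 + 3 * \<kappa>"
proof -
  note [measurable] = e_meas[OF assms(1)] e_meas[OF assms(2)]
  show i: "integrable M (\<lambda>\<omega>. \<bar>e i \<omega> * e j \<omega>\<bar> powr (a / 2))"
    by (rule Bochner_Integration.integrable_bound[where f="\<lambda>\<omega>. \<bar>e i \<omega>\<bar> powr a + \<bar>e j \<omega>\<bar> powr a"])
      (use e_int assms powr_mult_le_add2[of a] a in auto)
  have "expectation (\<lambda>\<omega>. \<bar>e i \<omega> * e j \<omega>\<bar> powr (a / 2)) \<le> expectation (\<lambda>\<omega>. \<bar>e i \<omega>\<bar> powr a + \<bar>e j \<omega>\<bar> powr a)"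
    using i e_int assms a by (intro integral_mono powr_mult_le_add2) auto
  also have "\<dots> \<le> \<kappa> + \<kappa>" using e_int e_mom[OF assms(1)] e_mom[OF assms(2)] assms by simp
  finally show "expectation (\<lambda>\<omega>. \<bar>e i \<omega> * e j \<omega>\<bar> powr (a / 2)) \<le> 1 + 3 * \<kappa>" using \<kappa> by simp
qed

lemma moment_triple:
  assumes "i \<in> I" "j \<in> I" "k \<in> I"
  shows "integrable M (\<lambda>\<omega>. \<bar>e i \<omega> * e j \<omega> * e k \<omega>\<bar> powr (a / 3))"
    "expectation (\<lambda>\<omega>. \<bar>e i \<omega> * e j \<omega> * e k \<omega>\<bar> powr (a / 3)) \<le> 1 + 3 * \<kappa>"
proof -
  note [measurable] = e_meas[OF assms(1)] e_meas[OF assms(2)] e_meas[OF assms(3)]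
  show i: "integrable M (\<lambda>\<omega>. \<bar>e i \<omega> * e j \<omega> * e k \<omega>\<bar> powr (a / 3))"
    by (rule Bochner_Integration.integrable_bound[where f="\<lambda>\<omega>. \<bar>e i \<omega>\<bar> powr a + \<bar>e j \<omega>\<bar> powr a + \<bar>e k \<omega>\<bar> powr a"])
      (use e_int assms powr_mult_le_add3[of a] a in auto)
  have "expectation (\<lambda>\<omega>. \<bar>e i \<omega> * e j \<omega> * e k \<omega>\<bar> powr (a / 3))
      \<le> expectation (\<lambda>\<omega>. \<bar>e i \<omega>\<bar> powr a + \<bar>e j \<omega>\<bar> powr a + \<bar>e k \<omega>\<bar> powr a)"
    using i e_int assms a by (intro integral_mono powr_mult_le_add3) auto
  also have "\<dots> \<le> \<kappa> + \<kappa> + \<kappa>" using e_int e_mom[OF assms(1)] e_mom[OF assms(2)] e_mom[OF assms(3)] assms by simp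
  finally show "expectation (\<lambda>\<omega>. \<bar>e i \<omega> * e j \<omega> * e k \<omega>\<bar> powr (a / 3)) \<le> 1 + 3 * \<kappa>" by simp
qed

lemma moment_single:
  assumes "i \<in> I"
  shows "integrable M (\<lambda>\<omega>. \<bar>e i \<omega>\<bar> powr (a / 1))"
    "expectation (\<lambda>\<omega>. \<bar>e i \<omega>\<bar> powr (a / 1)) \<le> 1 + 3 * \<kappa>"
  using e_int[OF assms] e_mom[OF assms] \<kappa> by auto

lemma expectation_pair_le:
  assumes "i \<in> I" "j \<in> I" "i \<le> j"
  shows "\<bar>expectation (\<lambda>\<omega>. e i \<omega> * e j \<omega>)\<bar> \<le> cst * rate ^ (2 * (j - i))"
  using cov_le[of "e i" "e j" "{i}" "{j}" "j - i" 2 2] assms e_meas e_F e_mean moment_half by simp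

text \<open>Split at the largest of the three gaps, of length r. If it isolates the first or the
  last variable, that variable has mean zero and the expectation is a covariance. If it is the
  middle gap, the expectation is close to a product of two pair expectations, each small by its own
  gap. Since r is largest, (j - i) + (l - k) <= 2r, so rate^(2r) is at most the product of the two
  proximities.\<close>

lemma expectation_four_sorted_le:
  assumes I: "i \<in> I" "j \<in> I" "k \<in> I" "l \<in> I" and s: "i \<le> j" "j \<le> k" "k \<le> l"
  shows "\<bar>expectation (\<lambda>\<omega>. e i \<omega> * e j \<omega> * e k \<omega> * e l \<omega>)\<bar> \<le> cst * (1 + cst) * (prox i j * prox k l)"
proof -
  let ?E = "expectation (\<lambda>\<omega>. e i \<omega> * e j \<omega> * e k \<omega> * e l \<omega>)"
  note [measurable] = e_meas[OF I(1)] e_meas[OF I(2)] e_meas[OF I(3)] e_meas[OF I(4)]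
  have le: "rate ^ (2 * r) \<le> prox i j * prox k l" if "(j - i) + (l - k) \<le> 2 * r" for r
    unfolding prox_def power_add[symmetric] using that s rate by (intro power_decreasing) auto
  have grow: "cst * rate ^ (2 * r) \<le> cst * (1 + cst) * (prox i j * prox k l)" if "(j - i) + (l - k) \<le> 2 * r" for r
  proof -
    have "cst * rate ^ (2 * r) \<le> cst * (prox i j * prox k l)" using le[OF that] cst by (rule mult_left_mono)
    also have "\<dots> \<le> cst * (1 + cst) * (prox i j * prox k l)"
      using cst rate by (intro mult_right_mono) (auto simp: prox_def algebra_simps)
    finally show ?thesis .
  qed
  consider "l - k \<le> j - i" | "j - i \<le> l - k" "k - j \<le> l - k" | "l - k \<le> k - j" "j - i \<le> k - j" by linarith
  then show ?thesis
  proof cases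
    case 1
    note [measurable] = e_F[of j "{j,k,l}"] e_F[of k "{j,k,l}"] e_F[of l "{j,k,l}"]
    have "\<bar>expectation (\<lambda>\<omega>. e i \<omega> * (e j \<omega> * e k \<omega> * e l \<omega>)) - expectation (e i) * expectation (\<lambda>\<omega>. e j \<omega> * e k \<omega> * e l \<omega>)\<bar>
        \<le> cst * rate ^ (2 * (j - i))"
      by (rule cov_le[of _ _ "{i}" "{j,k,l}" _ 1 3]) (use I s e_F moment_single moment_triple in \<open>auto\<close>)
    then have "\<bar>?E\<bar> \<le> cst * rate ^ (2 * (j - i))" using I e_mean by (simp add: mult.assoc)
    also have "\<dots> \<le> cst * (1 + cst) * (prox i j * prox k l)" using 1 by (intro grow) auto
    finally show ?thesis .
  next
    case 2
    note [measurable] = e_F[of i "{i,j,k}"] e_F[of j "{i,j,k}"] e_F[of k "{i,j,k}"]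
    have "\<bar>expectation (\<lambda>\<omega>. (e i \<omega> * e j \<omega> * e k \<omega>) * e l \<omega>) - expectation (\<lambda>\<omega>. e i \<omega> * e j \<omega> * e k \<omega>) * expectation (e l)\<bar>
        \<le> cst * rate ^ (2 * (l - k))"
      by (rule cov_le[of _ _ "{i,j,k}" "{l}" _ 3 1]) (use I s e_F moment_single moment_triple in \<open>auto\<close>)
    then have "\<bar>?E\<bar> \<le> cst * rate ^ (2 * (l - k))" using I e_mean by (simp add: mult.assoc)
    also have "\<dots> \<le> cst * (1 + cst) * (prox i j * prox k l)" using 2 by (intro grow) auto
    finally show ?thesis .
  next
    case 3
    note [measurable] = e_F[of i "{i,j}"] e_F[of j "{i,j}"] e_F[of k "{k,l}"] e_F[of l "{k,l}"]
    let ?E1 = "expectation (\<lambda>\<omega>. e i \<omega> * e j \<omega>)" and ?E2 = "expectation (\<lambda>\<omega>. e k \<omega> * e l \<omega>)"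
    have "\<bar>expectation (\<lambda>\<omega>. (e i \<omega> * e j \<omega>) * (e k \<omega> * e l \<omega>)) - ?E1 * ?E2\<bar> \<le> cst * rate ^ (2 * (k - j))"
      by (rule cov_le[of _ _ "{i,j}" "{k,l}" _ 2 2]) (use I s moment_pair in \<open>auto\<close>)
    then have 1: "\<bar>?E - ?E1 * ?E2\<bar> \<le> cst * rate ^ (2 * (k - j))" by (simp add: mult.assoc)
    have "cst * rate ^ (2 * (k - j)) \<le> cst * (prox i j * prox k l)"
      using 3 cst by (intro mult_left_mono le) auto
    with 1 have 1: "\<bar>?E - ?E1 * ?E2\<bar> \<le> cst * (prox i j * prox k l)" by linarith
    have "\<bar>?E1 * ?E2\<bar> \<le> (cst * rate ^ (2 * (j - i))) * (cst * rate ^ (2 * (l - k)))"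
      unfolding abs_mult using I s cst rate by (intro mult_mono expectation_pair_le) auto
    also have "\<dots> = cst * cst * rate ^ (2 * ((j - i) + (l - k)))"
      by (simp add: power_add algebra_simps)
    also have "\<dots> \<le> cst * cst * (prox i j * prox k l)"
      using cst by (intro mult_left_mono le) auto
    finally have "\<bar>?E1 * ?E2\<bar> \<le> cst * cst * (prox i j * prox k l)" .
    with 1 show ?thesis unfolding distrib_left distrib_right by linarith
  qed
qed

text \<open>The sorted case produces one pairing only. Adding the other two makes the bound
  symmetric in the indices, as \<open>wlog_sorted4\<close> requires.\<close>

lemma expectation_four_le:
  assumes "i \<in> I" "j \<in> I" "k \<in> I" "l \<in> I"
  shows "\<bar>expectation (\<lambda>\<omega>. e i \<omega> * e j \<omega> * e k \<omega> * e l \<omega>)\<bar>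
    \<le> cst * (1 + cst) * (prox i j * prox k l + prox i k * prox j l + prox i l * prox j k)"
proof -
  define Q where "Q i j k l \<longleftrightarrow> (i \<in> I \<longrightarrow> j \<in> I \<longrightarrow> k \<in> I \<longrightarrow> l \<in> I \<longrightarrow>
    \<bar>expectation (\<lambda>\<omega>. e i \<omega> * e j \<omega> * e k \<omega> * e l \<omega>)\<bar>
    \<le> cst * (1 + cst) * (prox i j * prox k l + prox i k * prox j l + prox i l * prox j k))" for i j k l
  have "Q i j k l"
  proof (rule wlog_sorted4[of Q])
    fix i j k l
    show "Q j i k l" if "Q i j k l"
      using that prox_commute[of i j] unfolding Q_def by (auto simp: mult_ac add_ac)
    show "Q i k j l" if "Q i j k l"
      using that prox_commute[of k j] unfolding Q_def by (auto simp: mult_ac add_ac)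
    show "Q i j l k" if "Q i j k l"
      using that prox_commute[of k l] unfolding Q_def by (auto simp: mult_ac add_ac)
    assume s: "i \<le> j" "j \<le> k" "k \<le> l"
    have "cst * (1 + cst) * (prox i j * prox k l)
        \<le> cst * (1 + cst) * (prox i j * prox k l + prox i k * prox j l + prox i l * prox j k)"
      using cst rate by (intro mult_left_mono) (auto simp: prox_def)
    then show "Q i j k l"
      unfolding Q_def using expectation_four_sorted_le[of i j k l] s by force
  qed
  then show ?thesis using assms unfolding Q_def by blast
qed

lemma integrable_power4: "i \<in> I \<Longrightarrow> integrable M (\<lambda>\<omega>. (e i \<omega>) ^ 4)"
  by (rule Bochner_Integration.integrable_bound[where f="\<lambda>\<omega>. 1 + \<bar>e i \<omega>\<bar> powr a"])
    (use e_int e_meas power4_le_powr[OF a] in \<open>auto\<close>)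

lemma integrable_four:
  assumes "i \<in> I" "j \<in> I" "k \<in> I" "l \<in> I"
  shows "integrable M (\<lambda>\<omega>. e i \<omega> * e j \<omega> * e k \<omega> * e l \<omega>)"
  by (rule Bochner_Integration.integrable_bound[where f="\<lambda>\<omega>. (e i \<omega>)^4 + (e j \<omega>)^4 + (e k \<omega>)^4 + (e l \<omega>)^4"])
    (use assms integrable_power4 e_meas in \<open>auto intro!: AE_I2 order_trans[OF abs_mult4_le]\<close>)

lemma sum_power4:
  fixes f :: "nat \<Rightarrow> real"
  shows "(\<Sum>i\<in>J. f i) ^ 4 = (\<Sum>i\<in>J. \<Sum>j\<in>J. \<Sum>k\<in>J. \<Sum>l\<in>J. f i * f j * f k * f l)"
  by (simp add: power4_eq_xxxx sum_distrib_left sum_distrib_right mult_ac)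

text \<open>Summed over all quadruples, each pairing factorises into p^2, where p is the double sum
  of proximities and is linear in the number of summands. Hence the quadratic growth known from
  independent summands.\<close>

lemma fourth_moment_sum:
  assumes J: "finite J" "J \<subseteq> I"
  shows "integrable M (\<lambda>\<omega>. (\<Sum>i\<in>J. e i \<omega>) ^ 4)"
    "expectation (\<lambda>\<omega>. (\<Sum>i\<in>J. e i \<omega>) ^ 4) \<le> fourth_const a \<kappa> B c\<^sub>2 * (real (card J))\<^sup>2"
proof -
  have int: "integrable M (\<lambda>\<omega>. e i \<omega> * e j \<omega> * e k \<omega> * e l \<omega>)" if "i \<in> J" "j \<in> J" "k \<in> J" "l \<in> J" for i j k l
    using that J by (intro integrable_four) auto
  show "integrable M (\<lambda>\<omega>. (\<Sum>i\<in>J. e i \<omega>) ^ 4)"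
    unfolding sum_power4 using int by (intro Bochner_Integration.integrable_sum) auto
  define p where "p = (\<Sum>i\<in>J. \<Sum>j\<in>J. prox i j)"
  have "p \<le> (\<Sum>i\<in>J. 2 / (1 - rate))"
    unfolding p_def prox_def using rate J by (intro sum_mono sum_geometric_dist_le) auto
  then have p: "0 \<le> p" "p \<le> real (card J) * (2 / (1 - rate))"
    unfolding p_def prox_def using rate by (auto intro!: sum_nonneg)
  have "expectation (\<lambda>\<omega>. (\<Sum>i\<in>J. e i \<omega>) ^ 4) = (\<Sum>i\<in>J. \<Sum>j\<in>J. \<Sum>k\<in>J. \<Sum>l\<in>J. expectation (\<lambda>\<omega>. e i \<omega> * e j \<omega> * e k \<omega> * e l \<omega>))"
    unfolding sum_power4 using int by (simp add: Bochner_Integration.integral_sum Bochner_Integration.integrable_sum)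
  also have "\<dots> \<le> (\<Sum>i\<in>J. \<Sum>j\<in>J. \<Sum>k\<in>J. \<Sum>l\<in>J.
      cst * (1 + cst) * (prox i j * prox k l + prox i k * prox j l + prox i l * prox j k))"
    using J by (intro sum_mono order_trans[OF abs_ge_self expectation_four_le]) auto
  also have "\<dots> = cst * (1 + cst) * ((\<Sum>i\<in>J. \<Sum>j\<in>J. \<Sum>k\<in>J. \<Sum>l\<in>J. prox i j * prox k l)
      + (\<Sum>i\<in>J. \<Sum>j\<in>J. \<Sum>k\<in>J. \<Sum>l\<in>J. prox i k * prox j l)
      + (\<Sum>i\<in>J. \<Sum>j\<in>J. \<Sum>k\<in>J. \<Sum>l\<in>J. prox i l * prox j k))"
    by (simp only: sum_distrib_left[symmetric] sum.distrib)
  also have "(\<Sum>i\<in>J. \<Sum>j\<in>J. \<Sum>k\<in>J. \<Sum>l\<in>J. prox i j * prox k l) = p\<^sup>2"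
    unfolding p_def power2_eq_square sum_distrib_right by (simp only: sum_distrib_left)
  also have "(\<Sum>i\<in>J. \<Sum>j\<in>J. \<Sum>k\<in>J. \<Sum>l\<in>J. prox i k * prox j l) = (\<Sum>i\<in>J. \<Sum>k\<in>J. \<Sum>j\<in>J. \<Sum>l\<in>J. prox i k * prox j l)"
    by (intro sum.cong refl sum.swap)
  also have "\<dots> = p\<^sup>2"
    unfolding p_def power2_eq_square sum_distrib_right by (simp only: sum_distrib_left)
  also have "(\<Sum>i\<in>J. \<Sum>j\<in>J. \<Sum>k\<in>J. \<Sum>l\<in>J. prox i l * prox j k) = (\<Sum>i\<in>J. \<Sum>l\<in>J. \<Sum>j\<in>J. \<Sum>k\<in>J. prox i l * prox j k)"
  proof (rule sum.cong[OF refl])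
    fix i assume "i \<in> J"
    have "(\<Sum>j\<in>J. \<Sum>k\<in>J. \<Sum>l\<in>J. prox i l * prox j k) = (\<Sum>j\<in>J. \<Sum>l\<in>J. \<Sum>k\<in>J. prox i l * prox j k)"
      by (intro sum.cong refl sum.swap)
    also have "\<dots> = (\<Sum>l\<in>J. \<Sum>j\<in>J. \<Sum>k\<in>J. prox i l * prox j k)" by (rule sum.swap)
    finally show "(\<Sum>j\<in>J. \<Sum>k\<in>J. \<Sum>l\<in>J. prox i l * prox j k) = (\<Sum>l\<in>J. \<Sum>j\<in>J. \<Sum>k\<in>J. prox i l * prox j k)" .
  qed
  also have "\<dots> = p\<^sup>2"
    unfolding p_def power2_eq_square sum_distrib_right by (simp only: sum_distrib_left)
  also have "cst * (1 + cst) * (p\<^sup>2 + p\<^sup>2 + p\<^sup>2) \<le> cst * (1 + cst) * (3 * (real (card J) * (2 / (1 - rate)))\<^sup>2)"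
    using cst power_mono[OF p(2) p(1), of 2] by (intro mult_left_mono) auto
  also have "\<dots> = fourth_const a \<kappa> B c\<^sub>2 * (real (card J))\<^sup>2"
    by (simp add: fourth_const_def power_mult_distrib power_divide)
  finally show "expectation (\<lambda>\<omega>. (\<Sum>i\<in>J. e i \<omega>) ^ 4) \<le> fourth_const a \<kappa> B c\<^sub>2 * (real (card J))\<^sup>2" .
qed

end

section \<open>Majority votes over a Cantor-like set\<close>

fun cantor_len :: "nat \<Rightarrow> nat \<Rightarrow> nat" where
  "cantor_len d 0 = 1"
| "cantor_len d (Suc k) = 2 * cantor_len d k + d * 2 ^ k"

fun cantor :: "nat \<Rightarrow> nat \<Rightarrow> nat set" where
  "cantor d 0 = {1}"
| "cantor d (Suc k) = cantor d k \<union> (\<lambda>g. g + (cantor_len d k + d * 2 ^ k)) ` cantor d k"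

lemma cantor_subset: "cantor d k \<subseteq> {1..cantor_len d k}"
proof (induction k)
  case (Suc k)
  show ?case
  proof
    fix g assume "g \<in> cantor d (Suc k)"
    then consider "g \<in> cantor d k" | h where "h \<in> cantor d k" "g = h + (cantor_len d k + d * 2 ^ k)" by auto
    then show "g \<in> {1..cantor_len d (Suc k)}"
      by cases (use Suc.IH in auto)
  qed
qed simp

lemma cantor_bounds: "g \<in> cantor d k \<Longrightarrow> 1 \<le> g \<and> g \<le> cantor_len d k"
  using cantor_subset[of d k] by auto

lemma finite_cantor: "finite (cantor d k)"
  using cantor_subset finite_subset by blast

lemma card_cantor: "card (cantor d k) = 2 ^ k"
proof (induction k)
  case (Suc k)
  have "cantor d k \<inter> (\<lambda>g. g + (cantor_len d k + d * 2 ^ k)) ` cantor d k = {}"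
  proof (intro equals0I, elim IntE imageE)
    fix g h assume "g \<in> cantor d k" "h \<in> cantor d k" "g = h + (cantor_len d k + d * 2 ^ k)"
    then show False using cantor_bounds[of g d k] cantor_bounds[of h d k] by linarith
  qed
  then show ?case
    using Suc finite_cantor[of d k] by (simp add: card_Un_disjoint card_image inj_on_def)
qed simp

lemma cantor_len_pos: "0 < cantor_len d k"
  by (induction k) auto

text \<open>The exact value is 2^k + d k 2^(k-1): each of the k levels adds gaps of total length d
  2^(k-1). So N points spread over O(N log N) positions.\<close>

lemma cantor_len_le: "cantor_len d k \<le> 2 ^ k * (1 + d * k)"
  by (induction k) (auto simp: algebra_simps)

text \<open>Taken inside \<open>space M\<close>, so that the empty index set gives the whole
  space.\<close>

definition all_in :: "'a measure \<Rightarrow> (nat \<Rightarrow> 'a set) \<Rightarrow> nat set \<Rightarrow> 'a set" where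
  "all_in M A S = {\<omega>\<in>space M. \<forall>g\<in>S. \<omega> \<in> A g}"

lemma all_in_Un: "all_in M A (S \<union> T) = all_in M A S \<inter> all_in M A T"
  unfolding all_in_def by auto

lemma all_in_sets: "finite S \<Longrightarrow> (\<And>g. g \<in> S \<Longrightarrow> A g \<in> sets M) \<Longrightarrow> all_in M A S \<in> sets M"
  unfolding all_in_def by (intro sets.sets_Collect_finite_All) (auto simp: Int_def[symmetric] intro: sets.sets_Collect)

context prob_space
begin

text \<open>The additive error of \<open>\<alpha>\<close>-mixing would destroy the product bound if it were incurred between
  neighbouring blocks. In the Cantor-like set two halves of size \<open>2 ^ k\<close> are separated by \<open>d * 2 ^ k\<close>,
  so that the error is at most the product bound itself. The \<open>- 1\<close> in the induction hypothesis
  absorbs the accumulated errors.\<close>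

lemma prob_all_in_cantor_le:
  assumes mix: "\<And>S T k. S \<subseteq> {1..\<Delta>} \<Longrightarrow> T \<subseteq> {1..\<Delta>} \<Longrightarrow> d * 2 ^ k < \<Delta> \<Longrightarrow>
      (\<And>s t. s \<in> S \<Longrightarrow> t \<in> T \<Longrightarrow> s + d * 2 ^ k < t) \<Longrightarrow>
      \<bar>prob (all_in M A S \<inter> all_in M A T) - prob (all_in M A S) * prob (all_in M A T)\<bar> \<le> q ^ (2 ^ Suc k)"
    and prob: "\<And>g. g \<in> {1..\<Delta>} \<Longrightarrow> prob (A g) \<le> q"
    and ev: "\<And>g. g \<in> {1..\<Delta>} \<Longrightarrow> A g \<in> events"
    and q: "0 \<le> q" "q \<le> 1"
  shows "s + cantor_len d k \<le> \<Delta> \<Longrightarrow> S \<subseteq> (\<lambda>g. g + s) ` cantor d k \<Longrightarrow>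
    prob (all_in M A S) \<le> (2 ^ (2 ^ k) - 1) * q ^ card S"
proof (induction k arbitrary: s S)
  case 0
  then consider "S = {}" | "S = {1 + s}" by auto
  then show ?case
  proof cases
    case 2
    have "all_in M A S = A (1 + s)"
      using 2 ev[of "1 + s"] 0 sets.sets_into_space by (auto simp: all_in_def)
    then show ?thesis using 2 prob[of "1 + s"] 0 by simp
  qed simp
next
  case (Suc k)
  let ?h = "cantor_len d k + d * 2 ^ k"
  define S1 S2 where "S1 = S \<inter> (\<lambda>g. g + s) ` cantor d k" and "S2 = S - S1"
  have S: "S = S1 \<union> S2" "S1 \<inter> S2 = {}" unfolding S1_def S2_def by auto
  have S1: "S1 \<subseteq> (\<lambda>g. g + s) ` cantor d k" unfolding S1_def by auto
  have S2: "S2 \<subseteq> (\<lambda>g. g + (s + ?h)) ` cantor d k"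
    using Suc.prems(2) unfolding S1_def S2_def by (auto simp: image_Un image_image add_ac)
  have fin: "finite S1" "finite S2" using finite_subset[OF S1] finite_subset[OF S2] finite_cantor by auto
  have card: "card S = card S1 + card S2" unfolding S(1) using fin S(2) by (rule card_Un_disjoint)
  have r1: "S1 \<subseteq> {1 + s..cantor_len d k + s}" 
  proof
    fix t assume "t \<in> S1"
    with S1 obtain g where "g \<in> cantor d k" "t = g + s" by blast
    then show "t \<in> {1 + s..cantor_len d k + s}" using cantor_bounds[of g d k] by simp
  qed
  have r2: "S2 \<subseteq> {1 + (s + ?h)..cantor_len d k + (s + ?h)}" 
  proof
    fix t assume "t \<in> S2"
    with S2 obtain g where "g \<in> cantor d k" "t = g + (s + ?h)" by blast
    then show "t \<in> {1 + (s + ?h)..cantor_len d k + (s + ?h)}" using cantor_bounds[of g d k] by simp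
  qed
  have D: "s + ?h + cantor_len d k \<le> \<Delta>" using Suc.prems(1) by simp
  note len = cantor_len_pos[of d k]
  have le1: "prob (all_in M A S1) \<le> (2 ^ (2 ^ k) - 1) * q ^ card S1"
    using D S1 by (intro Suc.IH) auto
  have le2: "prob (all_in M A S2) \<le> (2 ^ (2 ^ k) - 1) * q ^ card S2"
    using D S2 by (intro Suc.IH) auto
  have "\<bar>prob (all_in M A S1 \<inter> all_in M A S2) - prob (all_in M A S1) * prob (all_in M A S2)\<bar> \<le> q ^ (2 ^ Suc k)"
  proof (rule mix)
    show "S1 \<subseteq> {1..\<Delta>}" using D by (intro order_trans[OF r1]) auto
    show "S2 \<subseteq> {1..\<Delta>}" using D by (intro order_trans[OF r2]) auto
    show "d * 2 ^ k < \<Delta>" using D len by linarith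
    show "s + d * 2 ^ k < t" if "s \<in> S1" "t \<in> S2" for s t
      using subsetD[OF r1 that(1)] subsetD[OF r2 that(2)] by simp
  qed
  \<comment> \<open>S has at most 2^(k+1) elements, so the mixing error is no larger than the
    product bound for S.\<close>
  moreover have "q ^ (2 ^ Suc k) \<le> q ^ card S"
  proof (rule power_decreasing[OF _ q])
    have "card S \<le> card ((\<lambda>g. g + s) ` cantor d (Suc k))"
      using Suc.prems(2) finite_cantor by (intro card_mono) auto
    also have "\<dots> \<le> 2 ^ Suc k" using card_image_le[OF finite_cantor] card_cantor by metis
    finally show "card S \<le> 2 ^ Suc k" .
  qed
  moreover have "prob (all_in M A S1) * prob (all_in M A S2)
      \<le> ((2 ^ (2 ^ k) - 1) * q ^ card S1) * ((2 ^ (2 ^ k) - 1) * q ^ card S2)"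
    using le1 le2 q by (intro mult_mono) auto
  ultimately have "prob (all_in M A S)
      \<le> ((2 ^ (2 ^ k) - 1) * q ^ card S1) * ((2 ^ (2 ^ k) - 1) * q ^ card S2) + q ^ card S"
    unfolding S(1) all_in_Un by linarith
  also have "\<dots> = ((2 ^ (2 ^ k) - 1) * (2 ^ (2 ^ k) - 1) + 1) * q ^ card S"
    unfolding card power_add by (simp add: algebra_simps)
  \<comment> \<open>With x = 2^(2^k) >= 2 this is (x - 1)^2 + 1 <= x^2 - 1.\<close>
  also have "\<dots> \<le> (2 ^ (2 ^ Suc k) - 1) * q ^ card S"
  proof (rule mult_right_mono)
    have "(2::real) ^ 1 \<le> 2 ^ (2 ^ k)" by (rule power_increasing) auto
    moreover have "(2::real) ^ (2 ^ Suc k) = 2 ^ (2 ^ k) * 2 ^ (2 ^ k)"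
      by (simp add: power_mult power2_eq_square mult.commute[of 2])
    ultimately show "((2::real) ^ (2 ^ k) - 1) * (2 ^ (2 ^ k) - 1) + 1 \<le> 2 ^ (2 ^ Suc k) - 1"
      by (simp add: algebra_simps)
  qed (use q in simp)
  finally show ?case .
qed

text \<open>A union bound over the sets S of at least half of the points. There are at most 2^N of
  them, N = 2^k, and each has probability at most 2^N (u^2)^(card S) <= 2^N u^N. The level is
  written as a square because only half of the votes need be wrong.\<close>

lemma prob_cantor_majority_le:
  assumes mix: "\<And>S T k. S \<subseteq> {1..\<Delta>} \<Longrightarrow> T \<subseteq> {1..\<Delta>} \<Longrightarrow> d * 2 ^ k < \<Delta> \<Longrightarrow>
      (\<And>s t. s \<in> S \<Longrightarrow> t \<in> T \<Longrightarrow> s + d * 2 ^ k < t) \<Longrightarrow>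
      \<bar>prob (all_in M A S \<inter> all_in M A T) - prob (all_in M A S) * prob (all_in M A T)\<bar> \<le> (u\<^sup>2) ^ (2 ^ Suc k)"
    and prob: "\<And>g. g \<in> {1..\<Delta>} \<Longrightarrow> prob (A g) \<le> u\<^sup>2"
    and ev: "\<And>g. g \<in> {1..\<Delta>} \<Longrightarrow> A g \<in> events"
    and u: "0 \<le> u" "u \<le> 1" and len: "cantor_len d k \<le> \<Delta>"
  shows "prob {\<omega>\<in>space M. 2 ^ k \<le> 2 * card {g\<in>cantor d k. \<omega> \<in> A g}} \<le> (4 * u) ^ (2 ^ k)"
proof -
  define \<S> where "\<S> = {S \<in> Pow (cantor d k). 2 ^ k \<le> 2 * card S}"
  have fin: "finite \<S>" unfolding \<S>_def using finite_cantor by auto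
  have sub: "cantor d k \<subseteq> {1..\<Delta>}" using cantor_subset[of d k] len by fastforce
  have sets: "all_in M A S \<in> events" if "S \<in> \<S>" for S
    using that sub ev finite_subset[OF _ finite_cantor] unfolding \<S>_def by (intro all_in_sets) auto
  have "{\<omega>\<in>space M. 2 ^ k \<le> 2 * card {g\<in>cantor d k. \<omega> \<in> A g}} \<subseteq> (\<Union>S\<in>\<S>. all_in M A S)"
    unfolding \<S>_def all_in_def by (auto intro!: exI[of _ "{g\<in>cantor d k. _ \<in> A g}"])
  then have "prob {\<omega>\<in>space M. 2 ^ k \<le> 2 * card {g\<in>cantor d k. \<omega> \<in> A g}} \<le> prob (\<Union>S\<in>\<S>. all_in M A S)"
    using fin sets by (intro finite_measure_mono sets.finite_UN) auto
  also have "\<dots> \<le> (\<Sum>S\<in>\<S>. prob (all_in M A S))"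
    using fin sets by (intro finite_measure_subadditive_finite) auto
  also have "\<dots> \<le> (\<Sum>S\<in>\<S>. (2 * u) ^ (2 ^ k))"
  proof (rule sum_mono)
    fix S assume S: "S \<in> \<S>"
    have "prob (all_in M A S) \<le> (2 ^ (2 ^ k) - 1) * (u\<^sup>2) ^ card S"
      using S len u unfolding \<S>_def
      by (intro prob_all_in_cantor_le[where \<Delta>=\<Delta> and s=0 and d=d] mix prob ev) (auto simp: power_le_one)
    also have "\<dots> \<le> 2 ^ (2 ^ k) * (u\<^sup>2) ^ card S" by (intro mult_right_mono) auto
    also have "(u\<^sup>2) ^ card S = u ^ (2 * card S)" by (simp add: power_mult)
    also have "2 ^ (2 ^ k) * \<dots> \<le> 2 ^ (2 ^ k) * u ^ (2 ^ k)"
      using S u unfolding \<S>_def by (intro mult_left_mono power_decreasing) auto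
    finally show "prob (all_in M A S) \<le> (2 * u) ^ (2 ^ k)" by (simp add: power_mult_distrib)
  qed
  also have "\<dots> = real (card \<S>) * (2 * u) ^ (2 ^ k)" by simp
  also have "\<dots> \<le> 2 ^ (2 ^ k) * (2 * u) ^ (2 ^ k)"
  proof (rule mult_right_mono)
    have "card \<S> \<le> card (Pow (cantor d k))" unfolding \<S>_def using finite_cantor by (intro card_mono) auto
    then have "card \<S> \<le> 2 ^ (2 ^ k)" by (simp add: card_Pow finite_cantor card_cantor)
    then show "real (card \<S>) \<le> 2 ^ (2 ^ k)" by (metis of_nat_le_iff of_nat_numeral of_nat_power)
  qed (use u in auto)
  also have "\<dots> = (2 * (2 * u)) ^ (2 ^ k)" by (rule power_mult_distrib[symmetric])
  also have "\<dots> = (4 * u) ^ (2 ^ k)" by simp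
  finally show ?thesis .
qed

lemma indep_sum_tail:
  fixes W :: "'i \<Rightarrow> 'a \<Rightarrow> real"
  assumes ind: "indep_vars (\<lambda>_. borel) W J" and fin: "finite J"
    and int: "\<And>j. j \<in> J \<Longrightarrow> integrable M (W j)" and sq: "\<And>j. j \<in> J \<Longrightarrow> integrable M (\<lambda>\<omega>. (W j \<omega>)\<^sup>2)"
    and mean: "\<And>j. j \<in> J \<Longrightarrow> expectation (W j) = 0"
    and x: "x > 0"
  shows "prob {\<omega>\<in>space M. x \<le> \<bar>\<Sum>j\<in>J. W j \<omega>\<bar>} \<le> (\<Sum>j\<in>J. expectation (\<lambda>\<omega>. (W j \<omega>)\<^sup>2)) / x\<^sup>2"
proof -
  have meas: "W j \<in> borel_measurable M" if "j \<in> J" for j using int that by blast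
  have prod: "integrable M (\<lambda>\<omega>. W i \<omega> * W j \<omega>) \<and> expectation (\<lambda>\<omega>. W i \<omega> * W j \<omega>) = (if i = j then expectation (\<lambda>\<omega>. (W i \<omega>)\<^sup>2) else 0)"
    if "i \<in> J" "j \<in> J" for i j
  proof (cases "i = j")
    case False
    have "indep_vars (\<lambda>_. borel) W {i, j}" using that by (intro indep_vars_subset[OF ind]) auto
    then have "integrable M (\<lambda>\<omega>. \<Prod>k\<in>{i, j}. W k \<omega>)"
      "expectation (\<lambda>\<omega>. \<Prod>k\<in>{i, j}. W k \<omega>) = (\<Prod>k\<in>{i, j}. expectation (W k))"
      using int that by (auto intro!: indep_vars_integrable indep_vars_lebesgue_integral simp del: prod.insert)
    then show ?thesis using False mean that by simp
  qed (use sq that in \<open>auto simp: power2_eq_square\<close>)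
  have S2: "(\<lambda>\<omega>. (\<Sum>j\<in>J. W j \<omega>)\<^sup>2) = (\<lambda>\<omega>. \<Sum>i\<in>J. \<Sum>j\<in>J. W i \<omega> * W j \<omega>)"
    by (auto simp: power2_eq_square sum_product)
  have i2: "integrable M (\<lambda>\<omega>. (\<Sum>j\<in>J. W j \<omega>)\<^sup>2)"
    unfolding S2 using prod by (intro Bochner_Integration.integrable_sum) auto
  have "expectation (\<lambda>\<omega>. (\<Sum>j\<in>J. W j \<omega>)\<^sup>2) = (\<Sum>i\<in>J. \<Sum>j\<in>J. expectation (\<lambda>\<omega>. W i \<omega> * W j \<omega>))"
    unfolding S2 using prod by (simp add: Bochner_Integration.integral_sum Bochner_Integration.integrable_sum)
  also have "\<dots> = (\<Sum>i\<in>J. \<Sum>j\<in>J. if i = j then expectation (\<lambda>\<omega>. (W i \<omega>)\<^sup>2) else 0)"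
    using prod by (intro sum.cong refl) auto
  also have "\<dots> = (\<Sum>j\<in>J. expectation (\<lambda>\<omega>. (W j \<omega>)\<^sup>2))"
    using fin by (simp add: sum.delta')
  finally have e2: "expectation (\<lambda>\<omega>. (\<Sum>j\<in>J. W j \<omega>)\<^sup>2) = (\<Sum>j\<in>J. expectation (\<lambda>\<omega>. (W j \<omega>)\<^sup>2))" .
  have sm: "(\<lambda>\<omega>. \<Sum>j\<in>J. W j \<omega>) \<in> borel_measurable M" using meas by auto
  have "{\<omega>\<in>space M. x \<le> \<bar>\<Sum>j\<in>J. W j \<omega>\<bar>} = {\<omega>\<in>space M. x\<^sup>2 \<le> (\<Sum>j\<in>J. W j \<omega>)\<^sup>2}"
    using x by (auto simp: abs_le_square_iff[symmetric])
  also have "prob \<dots> \<le> expectation (\<lambda>\<omega>. (\<Sum>j\<in>J. W j \<omega>)\<^sup>2) / x\<^sup>2"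
    using x sm by (intro integral_Markov_inequality_measure[where A="{}", simplified] i2) auto
  finally show ?thesis unfolding e2 .
qed

end

section \<open>Block contrasts of the noise\<close>

lemma mat_col_measurable:
  assumes "t \<in> {1..n}"
  shows "mat_col p t \<in> mat_space p n \<rightarrow>\<^sub>M (\<Pi>\<^sub>M j\<in>{1..p}. borel)"
  unfolding mat_col_def mat_space_def using assms
  by (intro measurable_restrict measurable_component_singleton) auto

lemma entry_measurable:
  assumes "j \<in> {1..p}" "t \<in> {1..n}"
  shows "(\<lambda>X. X (j, t)) \<in> borel_measurable (mat_space p n)"
  unfolding mat_space_def using assms by (intro measurable_component_singleton) auto

text \<open>The variable whose square is averaged in \<open>second_moments\<close>, with the block
  length b = t / G as parameter. Applied to the noise, the mean or the data alike, it is linear in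
  the matrix.\<close>

definition contrast :: "nat \<Rightarrow> nat \<Rightarrow> nat \<Rightarrow> nat \<Rightarrow> (nat \<times> nat \<Rightarrow> real) \<Rightarrow> real" where
  "contrast n b g j X = 1 / real b * (\<Sum>i = (g - 1) * b + 1..g * b. (X (j, i) - X (j, n + 1 - i)) / sqrt 2)"

definition block_cols :: "nat \<Rightarrow> nat \<Rightarrow> nat \<Rightarrow> nat set" where
  "block_cols n b g = {(g - 1) * b + 1..g * b} \<union> (\<lambda>i. n + 1 - i) ` {(g - 1) * b + 1..g * b}"

definition block_stat ::
    "nat \<Rightarrow> nat \<Rightarrow> nat \<Rightarrow> nat \<Rightarrow> (nat \<Rightarrow> real) \<Rightarrow> (nat \<times> nat \<Rightarrow> real) \<Rightarrow> real" where
  "block_stat n p b g w X = (\<Sum>j=1..p. (contrast n b g j X)\<^sup>2 - w j)"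

lemma block_cols_subset: "2 * (g * b) \<le> n \<Longrightarrow> block_cols n b g \<subseteq> {1..n}"
  unfolding block_cols_def by auto

text \<open>At least r whole blocks of at least one column lie between the blocks s and t, and
  reflection preserves this distance. A block and the mirror image of the other are separated as
  well, because all unreflected columns lie in the first half. Reflection reverses the order, so
  only distances can be claimed.\<close>

lemma block_cols_separated:
  assumes st: "s + r < t" and n: "2 * (t * b) \<le> n" and b: "1 \<le> b"
    and x: "x \<in> block_cols n b s" and y: "y \<in> block_cols n b t"
  shows "int r \<le> \<bar>int x - int y\<bar>"
proof -
  obtain i where i: "i \<in> {(s - 1) * b + 1..s * b}" "x = i \<or> x = n + 1 - i"
    using x unfolding block_cols_def by blast
  obtain l where l: "l \<in> {(t - 1) * b + 1..t * b}" "y = l \<or> y = n + 1 - l"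
    using y unfolding block_cols_def by blast
  have "(s + r) * b \<le> (t - 1) * b" using st by (intro mult_right_mono) auto
  moreover have "r * 1 \<le> r * b" using b by (rule mult_le_mono2)
  ultimately have "s * b + r \<le> (t - 1) * b" unfolding distrib_right by linarith
  then have 1: "i + r < l" using i(1) l(1) by simp
  have 2: "2 * l \<le> n" using l(1) n by simp
  show ?thesis using 1 2 i(2) l(2) by (elim disjE) (auto simp: of_nat_diff)
qed

lemma contrast_measurable:
  assumes "\<And>i. i \<in> block_cols n b g \<Longrightarrow> (\<lambda>X. X (j, i)) \<in> borel_measurable N"
  shows "contrast n b g j \<in> borel_measurable N"
  unfolding contrast_def[abs_def] using assms unfolding block_cols_def
  by (intro borel_measurable_times borel_measurable_sum borel_measurable_divide borel_measurable_diff) auto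

text \<open>\<open>col_events\<close> packaged as a measure space, so that random variables can be
  called measurable with respect to it.\<close>

definition col_sigma :: "nat \<Rightarrow> (nat \<times> nat \<Rightarrow> real) measure \<Rightarrow> nat set \<Rightarrow> (nat \<times> nat \<Rightarrow> real) measure" where
  "col_sigma p P S = sigma (space P)
     (\<Union>t\<in>S. {mat_col p t -` B \<inter> space P | B. B \<in> sets (\<Pi>\<^sub>M j\<in>{1..p}. borel)})"

lemma space_col_sigma [simp]: "space (col_sigma p P S) = space P"
  unfolding col_sigma_def by (rule space_measure_of) auto

lemma sets_col_sigma: "sets (col_sigma p P S) = col_events p P S"
  unfolding col_sigma_def col_events_def by (rule sets_measure_of) auto

lemma entry_measurable_col_sigma:
  assumes "j \<in> {1..p}" "t \<in> S"
  shows "(\<lambda>X. X (j, t)) \<in> borel_measurable (col_sigma p P S)"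
proof -
  have "mat_col p t \<in> col_sigma p P S \<rightarrow>\<^sub>M (\<Pi>\<^sub>M j\<in>{1..p}. borel)"
  proof (rule measurableI)
    fix B :: "(nat \<Rightarrow> real) set" assume "B \<in> sets (\<Pi>\<^sub>M j\<in>{1..p}. borel)"
    then show "mat_col p t -` B \<inter> space (col_sigma p P S) \<in> sets (col_sigma p P S)"
      unfolding sets_col_sigma space_col_sigma col_events_def using assms by (intro sigma_sets.Basic) auto
  qed (simp add: mat_col_def space_PiM)
  from measurable_compose[OF this measurable_component_singleton[OF assms(1)]]
  show ?thesis using assms by (simp add: mat_col_def)
qed

section \<open>Mixing and moments of the noise class\<close>

locale temp_noise =
  fixes \<alpha> K c\<^sub>1 c\<^sub>2 :: real and p n :: nat and P :: "(nat \<times> nat \<Rightarrow> real) measure"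
  assumes P: "P \<in> P_Temp \<alpha> K c\<^sub>1 c\<^sub>2 p n"
    and \<alpha>: "\<alpha> > 4" and K: "K > 0" and c1: "c\<^sub>1 > 0" and c2: "c\<^sub>2 > 0"

sublocale temp_noise \<subseteq> prob_space P
  using P unfolding P_Temp_def by auto

context temp_noise
begin

lemma sets_P [measurable_cong]: "sets P = sets (mat_space p n)"
  using P unfolding P_Temp_def by auto

lemma rows_indep: "indep_vars (\<lambda>_. \<Pi>\<^sub>M t\<in>{1..n}. borel) (mat_row n) {1..p}"
  using P unfolding P_Temp_def by auto

lemma entry_meas:
  assumes "j \<in> {1..p}" "t \<in> {1..n}"
  shows "(\<lambda>E. E (j, t)) \<in> borel_measurable P"
  using entry_measurable[OF assms] measurable_cong_sets[OF sets_P refl] by blast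

lemma col_events_sets:
  assumes "S \<subseteq> {1..n}"
  shows "col_events p P S \<subseteq> sets P"
  unfolding col_events_def
proof (rule sets.sigma_sets_subset, safe)
  fix t and B :: "(nat \<Rightarrow> real) set" assume t: "t \<in> S" and B: "B \<in> sets (\<Pi>\<^sub>M j\<in>{1..p}. borel)"
  have "mat_col p t \<in> P \<rightarrow>\<^sub>M (\<Pi>\<^sub>M j\<in>{1..p}. borel)"
    using mat_col_measurable[of t n p] measurable_cong_sets[OF sets_P refl] assms t by blast
  then show "mat_col p t -` B \<inter> space P \<in> sets P" using B by (rule measurable_sets)
qed

lemma abs_prob_diff_le_1: "\<bar>prob C - prob A * prob B\<bar> \<le> 1"
proof -
  have "0 \<le> prob A * prob B" "prob A * prob B \<le> 1" "0 \<le> prob C" "prob C \<le> 1"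
    by (auto intro: mult_le_one)
  then show ?thesis by linarith
qed

lemma mixing_events:
  assumes S: "S \<subseteq> {1..n}" "T \<subseteq> {1..n}" and d: "\<And>s t. s \<in> S \<Longrightarrow> t \<in> T \<Longrightarrow> int r \<le> \<bar>int s - int t\<bar>"
    and r: "r \<in> {1..n-1}" and AB: "A \<in> col_events p P S" "B \<in> col_events p P T"
  shows "\<bar>prob (A \<inter> B) - prob A * prob B\<bar> \<le> c\<^sub>1 * exp (- c\<^sub>2 * real r)"
proof -
  have le1: "\<bar>prob (A \<inter> B) - prob A * prob B\<bar> \<le> 1" for A B
    by (rule abs_prob_diff_le_1)
  have "\<bar>prob (A \<inter> B) - prob A * prob B\<bar> \<le> alpha_mix p n P r"
    unfolding alpha_mix_def
  proof (rule cSup_upper)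
    show "bdd_above {\<bar>prob (A \<inter> B) - prob A * prob B\<bar> | A B S T.
     S \<subseteq> {1..n} \<and> T \<subseteq> {1..n} \<and> (\<forall>s\<in>S. \<forall>t\<in>T. \<bar>int s - int t\<bar> \<ge> int r) \<and>
     A \<in> col_events p P S \<and> B \<in> col_events p P T}"
      by (rule bdd_aboveI[of _ 1]) (use le1 in auto)
  qed (use S d AB in blast)
  also have "\<dots> \<le> c\<^sub>1 * exp (- c\<^sub>2 * real r)" using P r unfolding P_Temp_def by auto
  finally show ?thesis .
qed

text \<open>The noise class controls only lags from 1 to n - 1. Lag 0 is covered by the trivial
  bound 1, whence \<open>max 1 c\<^sub>1\<close>; lags of n or more cannot occur between nonempty
  sets of columns.\<close>

lemma mixing_weak_dep:
  fixes r :: nat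
  assumes S: "S \<subseteq> {1..n}" "T \<subseteq> {1..n}" "S \<noteq> {}" "T \<noteq> {}"
    and d: "\<And>s t. s \<in> S \<Longrightarrow> t \<in> T \<Longrightarrow> r \<le> (s - t) + (t - s)"
    and X: "X \<in> borel_measurable (col_sigma p P S)" and Y: "Y \<in> borel_measurable (col_sigma p P T)"
  shows "weak_dep P (max 1 c\<^sub>1 * exp (- c\<^sub>2 * real r)) X Y"
  unfolding weak_dep_def
proof (intro ballI)
  fix A B :: "real set" assume A: "A \<in> sets borel" and B: "B \<in> sets borel"
  define A' B' where "A' = {\<omega>\<in>space P. X \<omega> \<in> A}" and "B' = {\<omega>\<in>space P. Y \<omega> \<in> B}"
  have AB: "A' \<in> col_events p P S" "B' \<in> col_events p P T"
    using measurable_sets[OF X A] measurable_sets[OF Y B]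
    unfolding A'_def B'_def sets_col_sigma by (auto simp: vimage_def Int_def conj_commute)
  have "\<bar>prob (A' \<inter> B') - prob A' * prob B'\<bar> \<le> max 1 c\<^sub>1 * exp (- c\<^sub>2 * real r)"
  proof (cases "r = 0")
    case True
    then show ?thesis using abs_prob_diff_le_1[of "A' \<inter> B'" A' B'] by (simp add: order_trans[OF _ max.cobounded1])
  next
    case False
    obtain s t where st: "s \<in> S" "t \<in> T" using S by blast
    have "r \<le> (s - t) + (t - s)" using d st by blast
    moreover have "s \<in> {1..n}" "t \<in> {1..n}" using S st by auto
    ultimately have r: "r \<in> {1..n-1}" using False by auto
    have "\<bar>prob (A' \<inter> B') - prob A' * prob B'\<bar> \<le> c\<^sub>1 * exp (- c\<^sub>2 * real r)"
    proof (rule mixing_events[OF S(1,2) _ r AB])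
      show "int r \<le> \<bar>int s - int t\<bar>" if "s \<in> S" "t \<in> T" for s t using d[OF that] by linarith
    qed
    also have "\<dots> \<le> max 1 c\<^sub>1 * exp (- c\<^sub>2 * real r)" by (intro mult_right_mono) auto
    finally show ?thesis .
  qed
  moreover have "{\<omega>\<in>space P. X \<omega> \<in> A \<and> Y \<omega> \<in> B} = A' \<inter> B'" unfolding A'_def B'_def by auto
  ultimately show "\<bar>prob {\<omega>\<in>space P. X \<omega> \<in> A \<and> Y \<omega> \<in> B} - prob {\<omega>\<in>space P. X \<omega> \<in> A} * prob {\<omega>\<in>space P. Y \<omega> \<in> B}\<bar>
      \<le> max 1 c\<^sub>1 * exp (- c\<^sub>2 * real r)"
    unfolding A'_def B'_def by simp
qed

lemma entry_moments:
  assumes jt: "j \<in> {1..p}" "t \<in> {1..n}"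
  shows "expectation (\<lambda>E. E (j, t)) = 0" "integrable P (\<lambda>E. E (j, t))"
    "integrable P (\<lambda>E. \<bar>E (j, t)\<bar> powr \<alpha>)" "expectation (\<lambda>E. \<bar>E (j, t)\<bar> powr \<alpha>) \<le> K powr \<alpha>"
proof -
  note [measurable] = entry_meas[OF jt]
  have nc: "distr P borel (\<lambda>E. E (j, t)) \<in> noise_class \<alpha> K" using P jt unfolding P_Temp_def by auto
  show "expectation (\<lambda>E. E (j, t)) = 0" "integrable P (\<lambda>E. E (j, t))"
    using nc unfolding noise_class_def by (auto simp: integral_distr integrable_distr_eq)
  have i: "integrable P (\<lambda>E. \<bar>E (j, t) / K\<bar> powr \<alpha>)" and e: "expectation (\<lambda>E. \<bar>E (j, t) / K\<bar> powr \<alpha>) \<le> 1"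
    using nc unfolding noise_class_def by (auto simp: integral_distr integrable_distr_eq)
  have eq: "(\<lambda>E. \<bar>E (j, t)\<bar> powr \<alpha>) = (\<lambda>E. K powr \<alpha> * \<bar>E (j, t) / K\<bar> powr \<alpha>)"
    using K by (auto simp: powr_divide)
  show "integrable P (\<lambda>E. \<bar>E (j, t)\<bar> powr \<alpha>)" unfolding eq using i by auto
  show "expectation (\<lambda>E. \<bar>E (j, t)\<bar> powr \<alpha>) \<le> K powr \<alpha>"
    unfolding eq using e by (simp add: mult_left_le)
qed

lemma row_geom_mixing:
  assumes j: "j \<in> {1..p}"
  shows "geom_mixing P (\<lambda>t E. E (j, t)) {1..n} (col_sigma p P) \<alpha> (K powr \<alpha>) (max 1 c\<^sub>1) c\<^sub>2"
proof unfold_locales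
  show "weak_dep P (max 1 c\<^sub>1 * exp (- c\<^sub>2 * real r)) X Y"
    if "S \<subseteq> {1..n}" "T \<subseteq> {1..n}" "S \<noteq> {}" "T \<noteq> {}"
      "\<And>s t. s \<in> S \<Longrightarrow> t \<in> T \<Longrightarrow> r \<le> (s - t) + (t - s)"
      "X \<in> borel_measurable (col_sigma p P S)" "Y \<in> borel_measurable (col_sigma p P T)" for S T X Y r
    using that by (rule mixing_weak_dep)
qed (use j \<alpha> c2 entry_meas entry_moments entry_measurable_col_sigma in auto)

text \<open>The 4 arises from (x - y)^4 <= 8 (x^4 + y^4), the factor (sqrt 2)^4 = 4 in the
  denominator, and the two sums S and S'. The maximum with 1 serves the second moment bound, where a
  term 1/b has to be absorbed.\<close>

definition "noise_const = max 1 (4 * fourth_const \<alpha> (K powr \<alpha>) (max 1 c\<^sub>1) c\<^sub>2)"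

lemma contrast_moments:
  assumes j: "j \<in> {1..p}" and b: "1 \<le> b" and g: "1 \<le> g" "2 * (g * b) \<le> n"
  shows "expectation (contrast n b g j) = 0" "integrable P (contrast n b g j)"
    "integrable P (\<lambda>E. (contrast n b g j E) ^ 4)" "expectation (\<lambda>E. (contrast n b g j E) ^ 4) \<le> noise_const / (real b)\<^sup>2"
    "integrable P (\<lambda>E. (contrast n b g j E)\<^sup>2)" "expectation (\<lambda>E. (contrast n b g j E)\<^sup>2) \<le> noise_const / real b"
proof -
  interpret geom_mixing P "\<lambda>t E. E (j, t)" "{1..n}" "col_sigma p P" \<alpha> "K powr \<alpha>" "max 1 c\<^sub>1" c\<^sub>2
    using j by (rule row_geom_mixing)
  define J where "J = {(g - 1) * b + 1..g * b}"
  define J' where "J' = (\<lambda>i. n + 1 - i) ` J"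
  define H where "H = fourth_const \<alpha> (K powr \<alpha>) (max 1 c\<^sub>1) c\<^sub>2"
  have J: "J \<subseteq> {1..n}" "J' \<subseteq> {1..n}" "finite J" "finite J'"
    using block_cols_subset[OF g(2)] unfolding block_cols_def J_def J'_def by auto
  have cJ: "card J = b" unfolding J_def using g(1) by (cases g) auto
  have inj: "inj_on (\<lambda>i. n + 1 - i) J"
  proof (rule inj_onI)
    fix x y assume xy: "x \<in> J" "y \<in> J" "n + 1 - x = n + 1 - y"
    then have "x \<le> n" "y \<le> n" using J(1) by auto
    with xy(3) show "x = y" by linarith
  qed
  have cJ': "card J' = b" unfolding J'_def using inj cJ by (simp add: card_image)
  define S S' where "S E = (\<Sum>i\<in>J. E (j, i))" and "S' E = (\<Sum>i\<in>J'. E (j, i))" for E :: "nat \<times> nat \<Rightarrow> real"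
  have N: "contrast n b g j E = (S E - S' E) / (real b * sqrt 2)" for E
    unfolding contrast_def J_def[symmetric] S_def S'_def J'_def sum.reindex[OF inj] comp_def
    by (simp add: sum_subtractf flip: sum_divide_distrib)
  have i1: "integrable P (\<lambda>E. E (j, t))" "expectation (\<lambda>E. E (j, t)) = 0" if "t \<in> J \<union> J'" for t
    using entry_moments[OF j, of t] that J by auto
  have iS: "integrable P S" "integrable P S'" "expectation S = 0" "expectation S' = 0"
    unfolding S_def[abs_def] S'_def[abs_def] using i1 by (auto simp: Bochner_Integration.integral_sum)
  show i: "integrable P (contrast n b g j)" unfolding N[abs_def] using iS by auto
  show "expectation (contrast n b g j) = 0" unfolding N[abs_def] using iS by simp
  have m4: "integrable P (\<lambda>E. (S E) ^ 4)" "integrable P (\<lambda>E. (S' E) ^ 4)"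
    "expectation (\<lambda>E. (S E) ^ 4) \<le> H * (real b)\<^sup>2" "expectation (\<lambda>E. (S' E) ^ 4) \<le> H * (real b)\<^sup>2"
    unfolding S_def S'_def H_def using fourth_moment_sum[OF J(3,1)] fourth_moment_sum[OF J(4,2)] cJ cJ' by auto
  have quart: "(x - y) ^ 4 \<le> 8 * (x ^ 4 + y ^ 4)" for x y :: real
  proof -
    have sq: "(u - v)\<^sup>2 \<le> 2 * (u\<^sup>2 + v\<^sup>2)" for u v :: real
      using zero_le_power2[of "u + v"] by (simp add: power2_eq_square algebra_simps)
    have sq': "(u + v)\<^sup>2 \<le> 2 * (u\<^sup>2 + v\<^sup>2)" for u v :: real
      using zero_le_power2[of "u - v"] by (simp add: power2_eq_square algebra_simps)
    have "(x - y) ^ 4 = ((x - y)\<^sup>2)\<^sup>2" by (simp flip: power_mult)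
    also have "\<dots> \<le> (2 * (x\<^sup>2 + y\<^sup>2))\<^sup>2" by (intro power_mono sq) auto
    also have "\<dots> = 4 * (x\<^sup>2 + y\<^sup>2)\<^sup>2" by (simp only: power_mult_distrib) simp
    also have "\<dots> \<le> 4 * (2 * ((x\<^sup>2)\<^sup>2 + (y\<^sup>2)\<^sup>2))" by (intro mult_left_mono sq') auto
    finally show ?thesis by (simp flip: power_mult)
  qed
  have N4: "(contrast n b g j E) ^ 4 \<le> 2 / (real b) ^ 4 * ((S E) ^ 4 + (S' E) ^ 4)" for E
  proof -
    have s4: "sqrt 2 ^ 4 = 4" using power_mult[of "sqrt 2" 2 2] by simp
    have "(contrast n b g j E) ^ 4 = (S E - S' E) ^ 4 / (4 * (real b) ^ 4)"
      unfolding N power_divide power_mult_distrib s4 by (simp add: mult.commute)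
    also have "\<dots> \<le> (8 * ((S E) ^ 4 + (S' E) ^ 4)) / (4 * (real b) ^ 4)" by (intro divide_right_mono quart) auto
    also have "\<dots> = 2 / (real b) ^ 4 * ((S E) ^ 4 + (S' E) ^ 4)" using b by (simp add: field_simps)
    finally show ?thesis .
  qed
  have [measurable]: "contrast n b g j \<in> borel_measurable P" using i by blast
  show i4: "integrable P (\<lambda>E. (contrast n b g j E) ^ 4)"
    by (rule Bochner_Integration.integrable_bound[where f="\<lambda>E. 2 / (real b) ^ 4 * ((S E) ^ 4 + (S' E) ^ 4)"])
      (use m4 in \<open>auto intro!: AE_I2 order_trans[OF N4]\<close>)
  have "expectation (\<lambda>E. (contrast n b g j E) ^ 4) \<le> expectation (\<lambda>E. 2 / (real b) ^ 4 * ((S E) ^ 4 + (S' E) ^ 4))"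
    using i4 m4 N4 by (intro integral_mono) auto
  also have "\<dots> = 2 / (real b) ^ 4 * (expectation (\<lambda>E. (S E) ^ 4) + expectation (\<lambda>E. (S' E) ^ 4))"
    using m4 by simp
  also have "\<dots> \<le> 2 / (real b) ^ 4 * (H * (real b)\<^sup>2 + H * (real b)\<^sup>2)"
    using m4 by (intro mult_left_mono add_mono) auto
  also have "\<dots> = 4 * H / (real b)\<^sup>2" using b by (simp add: field_simps power4_eq_xxxx power2_eq_square)
  also have "\<dots> \<le> noise_const / (real b)\<^sup>2" unfolding noise_const_def H_def by (intro divide_right_mono) auto
  finally show e4: "expectation (\<lambda>E. (contrast n b g j E) ^ 4) \<le> noise_const / (real b)\<^sup>2" .
  \<comment> \<open>The inequality of arithmetic and geometric means, weighted by b because the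
    fourth moment is of order 1/b^2; both terms then have order 1/b.\<close>
  have am: "z\<^sup>2 \<le> (real b * z ^ 4 + 1 / real b) / 2" for z :: real
  proof -
    have "0 \<le> (real b * z\<^sup>2 - 1)\<^sup>2 / (2 * real b)" by simp
    also have "\<dots> = (real b * z ^ 4 + 1 / real b) / 2 - z\<^sup>2"
      using b by (simp add: field_simps power2_eq_square power4_eq_xxxx)
    finally show ?thesis by simp
  qed
  show i2: "integrable P (\<lambda>E. (contrast n b g j E)\<^sup>2)"
  proof (rule Bochner_Integration.integrable_bound)
    show "integrable P (\<lambda>E. (real b * (contrast n b g j E) ^ 4 + 1 / real b) / 2)" using i4 by auto
    show "AE E in P. norm ((contrast n b g j E)\<^sup>2) \<le> norm ((real b * (contrast n b g j E) ^ 4 + 1 / real b) / 2)"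
    proof (rule AE_I2)
      fix E
      have "norm ((contrast n b g j E)\<^sup>2) = (contrast n b g j E)\<^sup>2" by simp
      also note am
      also have "(real b * (contrast n b g j E) ^ 4 + 1 / real b) / 2 \<le> norm ((real b * (contrast n b g j E) ^ 4 + 1 / real b) / 2)"
        unfolding real_norm_def by (rule abs_ge_self)
      finally show "norm ((contrast n b g j E)\<^sup>2) \<le> norm ((real b * (contrast n b g j E) ^ 4 + 1 / real b) / 2)" .
    qed
  qed measurable
  have "expectation (\<lambda>E. (contrast n b g j E)\<^sup>2) \<le> expectation (\<lambda>E. (real b * (contrast n b g j E) ^ 4 + 1 / real b) / 2)"
    using i2 i4 am by (intro integral_mono) auto
  also have "\<dots> = (real b * expectation (\<lambda>E. (contrast n b g j E) ^ 4) + 1 / real b) / 2"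
    using i4 by (simp add: prob_space)
  also have "\<dots> \<le> (real b * (noise_const / (real b)\<^sup>2) + noise_const / real b) / 2"
    using e4 b unfolding noise_const_def by (intro divide_right_mono add_mono mult_left_mono) auto
  also have "\<dots> = noise_const / real b" using b by (simp add: field_simps power2_eq_square)
  finally show "expectation (\<lambda>E. (contrast n b g j E)\<^sup>2) \<le> noise_const / real b" .
qed

lemma noise_const_ge_1: "1 \<le> noise_const" unfolding noise_const_def by simp

text \<open>The summands are the centred noise part of (d_j + Y_j)^2, with Y_j the noise contrast
  and d_j the contrast of the mean, so that null (d = 0) and alternative are treated at once. They
  are centred and independent over the rows, and Chebyshev's inequality applies.\<close>

lemma deviation:
  fixes d :: "nat \<Rightarrow> real" and w :: "nat \<Rightarrow> real"
  assumes b: "1 \<le> b" and g: "1 \<le> g" "2 * (g * b) \<le> n" and x: "x > 0"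
    and w: "\<And>j. j \<in> {1..p} \<Longrightarrow> w j = expectation (\<lambda>E. (contrast n b g j E)\<^sup>2)"
  shows "prob {E\<in>space P. x \<le> \<bar>\<Sum>j=1..p. (contrast n b g j E)\<^sup>2 - w j + 2 * d j * contrast n b g j E\<bar>}
    \<le> (2 * noise_const * real p / (real b)\<^sup>2 + 8 * noise_const * (\<Sum>j=1..p. (d j)\<^sup>2) / real b) / x\<^sup>2"
proof -
  note cm = contrast_moments[OF _ b g]
  define W where "W j E = (contrast n b g j E)\<^sup>2 - w j + 2 * d j * contrast n b g j E" for j E
  have iW: "integrable P (W j)" "expectation (W j) = 0" if "j \<in> {1..p}" for j
    unfolding W_def using cm[OF that] w[OF that] by (auto simp: prob_space)
  have W2: "(W j E)\<^sup>2 \<le> 2 * ((contrast n b g j E) ^ 4 - 2 * w j * (contrast n b g j E)\<^sup>2 + (w j)\<^sup>2) + 8 * (d j)\<^sup>2 * (contrast n b g j E)\<^sup>2" for j E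
    using zero_le_power2[of "((contrast n b g j E)\<^sup>2 - w j) - 2 * d j * contrast n b g j E"]
    unfolding W_def by (simp add: power2_eq_square power4_eq_xxxx algebra_simps)
  have sqW: "integrable P (\<lambda>E. (W j E)\<^sup>2)" "expectation (\<lambda>E. (W j E)\<^sup>2) \<le> 2 * noise_const / (real b)\<^sup>2 + 8 * noise_const * (d j)\<^sup>2 / real b"
    if j: "j \<in> {1..p}" for j
  proof -
    let ?U = "\<lambda>E. 2 * ((contrast n b g j E) ^ 4 - 2 * w j * (contrast n b g j E)\<^sup>2 + (w j)\<^sup>2) + 8 * (d j)\<^sup>2 * (contrast n b g j E)\<^sup>2"
    have U: "integrable P ?U" using cm[OF j] by auto
    have [measurable]: "W j \<in> borel_measurable P" using iW[OF j] by blast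
    show i: "integrable P (\<lambda>E. (W j E)\<^sup>2)"
      by (rule Bochner_Integration.integrable_bound[OF U]) (auto intro!: AE_I2 order_trans[OF W2])
    have "expectation (\<lambda>E. (W j E)\<^sup>2) \<le> expectation ?U"
      using i U W2 by (intro integral_mono) auto
    also have "\<dots> = 2 * (expectation (\<lambda>E. (contrast n b g j E) ^ 4) - 2 * w j * w j + (w j)\<^sup>2) + 8 * (d j)\<^sup>2 * w j"
      using cm[OF j] w[OF j] by (simp add: prob_space)
    also have "\<dots> \<le> 2 * expectation (\<lambda>E. (contrast n b g j E) ^ 4) + 8 * (d j)\<^sup>2 * w j"
      by (simp add: power2_eq_square)
    also have "\<dots> \<le> 2 * (noise_const / (real b)\<^sup>2) + 8 * (d j)\<^sup>2 * (noise_const / real b)"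
      using cm[OF j] w[OF j] by (intro add_mono mult_left_mono) auto
    finally show "expectation (\<lambda>E. (W j E)\<^sup>2) \<le> 2 * noise_const / (real b)\<^sup>2 + 8 * noise_const * (d j)\<^sup>2 / real b" by (simp add: mult_ac)
  qed
  \<comment> \<open>The argument \<open>\<lambda>(_, t). r t\<close> is the matrix all of whose rows
    are r. This exhibits \<open>W j\<close> as a function of row j alone, so that independence of
    the rows carries over.\<close>
  define h where "h j r = (contrast n b g j (\<lambda>(_, t). r t))\<^sup>2 - w j + 2 * d j * contrast n b g j (\<lambda>(_, t). r t)" for j and r :: "nat \<Rightarrow> real"
  have cols: "block_cols n b g \<subseteq> {1..n}" using g(2) by (rule block_cols_subset)
  have hm: "h j \<in> borel_measurable (\<Pi>\<^sub>M t\<in>{1..n}. borel)" for j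
  proof -
    have "(\<lambda>r. contrast n b g j (\<lambda>(_, t). r t)) \<in> borel_measurable (\<Pi>\<^sub>M t\<in>{1..n}. borel)"
      unfolding contrast_def using cols unfolding block_cols_def
      by (intro borel_measurable_times borel_measurable_sum borel_measurable_divide borel_measurable_diff)
        (auto intro!: measurable_component_singleton)
    then show ?thesis unfolding h_def by measurable
  qed
  have Wh: "W j E = h j (mat_row n j E)" for j E
  proof -
    have "contrast n b g j E = contrast n b g j (\<lambda>(_, t). mat_row n j E t)"
      unfolding contrast_def mat_row_def using cols unfolding block_cols_def
      by (intro arg_cong2[where f="(*)"] sum.cong refl) auto
    then show ?thesis unfolding W_def h_def by simp
  qed
  have ind: "indep_vars (\<lambda>_. borel) W {1..p}"
  proof -
    have "indep_vars (\<lambda>_. borel) (\<lambda>j E. h j (mat_row n j E)) {1..p}"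
      by (rule indep_vars_compose2[OF rows_indep hm])
    then show ?thesis by (simp add: Wh[abs_def])
  qed
  have "prob {E\<in>space P. x \<le> \<bar>\<Sum>j\<in>{1..p}. W j E\<bar>} \<le> (\<Sum>j\<in>{1..p}. expectation (\<lambda>E. (W j E)\<^sup>2)) / x\<^sup>2"
    using ind iW sqW x by (intro indep_sum_tail) auto
  also have "\<dots> \<le> (\<Sum>j\<in>{1..p}. 2 * noise_const / (real b)\<^sup>2 + 8 * noise_const * (d j)\<^sup>2 / real b) / x\<^sup>2"
    using sqW by (intro divide_right_mono sum_mono) auto
  also have "\<dots> = (2 * noise_const * real p / (real b)\<^sup>2 + 8 * noise_const * (\<Sum>j=1..p. (d j)\<^sup>2) / real b) / x\<^sup>2"
    by (simp add: sum.distrib sum_distrib_left sum_divide_distrib mult_ac)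
  finally show ?thesis unfolding W_def .
qed

end

section \<open>Levels of single votes and of majorities\<close>

definition add_mean :: "nat \<Rightarrow> nat \<Rightarrow> (nat \<times> nat \<Rightarrow> real) \<Rightarrow> (nat \<times> nat \<Rightarrow> real) \<Rightarrow> nat \<times> nat \<Rightarrow> real" where
  "add_mean p n \<theta> E = (\<lambda>x\<in>{1..p} \<times> {1..n}. \<theta> x + E x)"

lemma contrast_add_mean:
  assumes "j \<in> {1..p}" "2 * (g * b) \<le> n"
  shows "contrast n b g j (add_mean p n \<theta> E) = contrast n b g j \<theta> + contrast n b g j E"
proof -
  have "(\<Sum>i = (g - 1) * b + 1..g * b. (add_mean p n \<theta> E (j, i) - add_mean p n \<theta> E (j, n + 1 - i)) / sqrt 2)
    = (\<Sum>i = (g - 1) * b + 1..g * b. (\<theta> (j, i) - \<theta> (j, n + 1 - i)) / sqrt 2 + (E (j, i) - E (j, n + 1 - i)) / sqrt 2)"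
    using block_cols_subset[OF assms(2)] assms(1) unfolding block_cols_def add_mean_def
    by (intro sum.cong refl) (auto simp: diff_divide_distrib add_divide_distrib)
  then show ?thesis unfolding contrast_def by (simp add: sum.distrib distrib_left)
qed

lemma block_stat_add_mean:
  assumes "2 * (g * b) \<le> n"
  shows "block_stat n p b g w (add_mean p n \<theta> E)
    = (\<Sum>j=1..p. (contrast n b g j \<theta>)\<^sup>2) + (\<Sum>j=1..p. (contrast n b g j E)\<^sup>2 - w j + 2 * contrast n b g j \<theta> * contrast n b g j E)"
  unfolding block_stat_def sum.distrib[symmetric] using assms
  by (intro sum.cong refl) (simp add: contrast_add_mean power2_eq_square algebra_simps)

lemma block_stat_add_mean_measurable:
  assumes "2 * (g * b) \<le> n"
  shows "(\<lambda>E. block_stat n p b g w (add_mean p n \<theta> E)) \<in> borel_measurable (col_sigma p P (block_cols n b g))"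
proof -
  have [measurable]: "contrast n b g j \<in> borel_measurable (col_sigma p P (block_cols n b g))" if "j \<in> {1..p}" for j
    using that by (intro contrast_measurable entry_measurable_col_sigma)
  show ?thesis unfolding block_stat_add_mean[OF assms] by measurable
qed

lemma col_events_mono:
  assumes "S \<subseteq> T"
  shows "col_events p P S \<subseteq> col_events p P T"
  unfolding col_events_def using assms by (intro sigma_sets_mono' UN_mono) auto

context temp_noise
begin

lemma block_stat_events:
  assumes "2 * (g * b) \<le> n" "B \<in> sets borel"
  shows "{E\<in>space P. block_stat n p b g w (add_mean p n \<theta> E) \<in> B} \<in> col_events p P (block_cols n b g)"
  using measurable_sets[OF block_stat_add_mean_measurable[OF assms(1), of p w \<theta> P] assms(2)]
  unfolding sets_col_sigma by (simp add: vimage_def Int_def conj_commute)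

text \<open>The hypothesis \<open>sep\<close> describes how sparse the Cantor-like set must be: a
  gap of d 2^k blocks spans at least as many columns, and its mixing error is then below
  (u^2)^(2^(k+1)), the form that \<open>prob_cantor_majority_le\<close> asks for.\<close>

lemma majority_tail:
  assumes b: "1 \<le> b" and \<Delta>: "2 * (\<Delta> * b) \<le> n" and d: "1 \<le> d"
    and sep: "\<And>m::nat. 1 \<le> m \<Longrightarrow> c\<^sub>1 * exp (- c\<^sub>2 * real (d * m)) \<le> (u\<^sup>2) ^ (2 * m)"
    and u: "0 \<le> u" "u \<le> 1" and len: "cantor_len d k \<le> \<Delta>"
    and A: "\<And>g. g \<in> {1..\<Delta>} \<Longrightarrow> A g \<in> col_events p P (block_cols n b g)"
    and prob: "\<And>g. g \<in> {1..\<Delta>} \<Longrightarrow> prob (A g) \<le> u\<^sup>2"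
  shows "prob {\<omega>\<in>space P. 2 ^ k \<le> 2 * card {g\<in>cantor d k. \<omega> \<in> A g}} \<le> (4 * u) ^ (2 ^ k)"
proof (rule prob_cantor_majority_le[OF _ prob _ u len])
  have gb: "2 * (g * b) \<le> n" if "g \<in> {1..\<Delta>}" for g
  proof -
    have "g * b \<le> \<Delta> * b" using that by (intro mult_right_mono) auto
    then show ?thesis using \<Delta> by linarith
  qed
  show "A g \<in> events" if "g \<in> {1..\<Delta>}" for g
    using A[OF that] col_events_sets[OF block_cols_subset[OF gb[OF that]]] by blast
  fix S T k assume S: "S \<subseteq> {1..\<Delta>}" and T: "T \<subseteq> {1..\<Delta>}" and k: "d * 2 ^ k < \<Delta>"
    and st: "\<And>s t. s \<in> S \<Longrightarrow> t \<in> T \<Longrightarrow> s + d * 2 ^ k < t"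
  have ev: "all_in P A S \<in> col_events p P (\<Union>g\<in>S. block_cols n b g)" if "S \<subseteq> {1..\<Delta>}" for S
  proof -
    have "all_in (col_sigma p P (\<Union>g\<in>S. block_cols n b g)) A S \<in> sets (col_sigma p P (\<Union>g\<in>S. block_cols n b g))"
    proof (rule all_in_sets)
      show "finite S" using that finite_subset by blast
      show "A g \<in> sets (col_sigma p P (\<Union>g\<in>S. block_cols n b g))" if "g \<in> S" for g
        unfolding sets_col_sigma using A[of g] \<open>g \<in> S\<close> \<open>S \<subseteq> {1..\<Delta>}\<close>
          col_events_mono[of "block_cols n b g" "\<Union>g\<in>S. block_cols n b g" p P] by blast
    qed
    then show ?thesis unfolding sets_col_sigma all_in_def by simp
  qed
  have "\<bar>prob (all_in P A S \<inter> all_in P A T) - prob (all_in P A S) * prob (all_in P A T)\<bar>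
      \<le> c\<^sub>1 * exp (- c\<^sub>2 * real (d * 2 ^ k))"
  proof (rule mixing_events[OF _ _ _ _ ev[OF S] ev[OF T]])
    show "(\<Union>g\<in>S. block_cols n b g) \<subseteq> {1..n}" using S gb by (intro UN_least block_cols_subset) blast
    show "(\<Union>g\<in>T. block_cols n b g) \<subseteq> {1..n}" using T gb by (intro UN_least block_cols_subset) blast
    show "int (d * 2 ^ k) \<le> \<bar>int x - int y\<bar>"
      if xy: "x \<in> (\<Union>g\<in>S. block_cols n b g)" "y \<in> (\<Union>g\<in>T. block_cols n b g)" for x y
    proof -
      obtain s t where "s \<in> S" "x \<in> block_cols n b s" "t \<in> T" "y \<in> block_cols n b t" using xy by blast
      then show ?thesis using T by (intro block_cols_separated[OF st gb b]) auto
    qed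
    have "\<Delta> * 1 \<le> \<Delta> * b" using b by (rule mult_le_mono2)
    then have "d * 2 ^ k < n" using k \<Delta> by linarith
    moreover have "1 * 1 \<le> d * 2 ^ k" using d by (intro mult_le_mono) auto
    ultimately show "d * 2 ^ k \<in> {1..n - 1}" by simp
  qed
  also have "\<dots> \<le> (u\<^sup>2) ^ (2 ^ Suc k)" using sep[of "2 ^ k"] by simp
  finally show "\<bar>prob (all_in P A S \<inter> all_in P A T) - prob (all_in P A S) * prob (all_in P A T)\<bar> \<le> (u\<^sup>2) ^ (2 ^ Suc k)" .
qed

text \<open>Without a jump the contrasts see noise only, and Chebyshev's bound is 2
  \<open>noise_const\<close> / R^2. The constant 18 is dictated by \<open>alt_level\<close>, so that
  one R serves both errors.\<close>

lemma null_level: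
  assumes b: "1 \<le> b" and g: "1 \<le> g" "2 * (g * b) \<le> n" and p: "1 \<le> p"
    and w: "\<And>j. j \<in> {1..p} \<Longrightarrow> w j = expectation (\<lambda>E. (contrast n b g j E)\<^sup>2)"
    and R: "1 \<le> R" "18 * noise_const \<le> \<eta> * R"
    and \<theta>: "\<And>j. j \<in> {1..p} \<Longrightarrow> contrast n b g j \<theta> = 0"
  shows "prob {E\<in>space P. R * sqrt (real p) / real b \<le> block_stat n p b g w (add_mean p n \<theta> E)} \<le> \<eta>"
proof -
  define x where "x = R * sqrt (real p) / real b"
  have x: "x > 0" unfolding x_def using R p b by simp
  have dev: "prob {E\<in>space P. x \<le> \<bar>\<Sum>j=1..p. (contrast n b g j E)\<^sup>2 - w j + 2 * 0 * contrast n b g j E\<bar>}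
    \<le> (2 * noise_const * real p / (real b)\<^sup>2 + 8 * noise_const * (\<Sum>j=1..p. 0\<^sup>2) / real b) / x\<^sup>2"
    by (rule deviation[OF b g x w])
  have stat: "block_stat n p b g w (add_mean p n \<theta> E) = (\<Sum>j=1..p. (contrast n b g j E)\<^sup>2 - w j + 2 * 0 * contrast n b g j E)" for E
    unfolding block_stat_add_mean[OF g(2)] using \<theta> by simp
  have "prob {E\<in>space P. x \<le> block_stat n p b g w (add_mean p n \<theta> E)}
      \<le> prob {E\<in>space P. x \<le> \<bar>\<Sum>j=1..p. (contrast n b g j E)\<^sup>2 - w j + 2 * 0 * contrast n b g j E\<bar>}"
    unfolding stat
  proof (rule finite_measure_mono)
    have "{E\<in>space P. \<bar>block_stat n p b g w (add_mean p n \<theta> E)\<bar> \<in> {x..}} \<in> events"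
      using block_stat_events[OF g(2), of "{y. \<bar>y\<bar> \<in> {x..}}" w \<theta>] col_events_sets[OF block_cols_subset[OF g(2)]] by auto
    then show "{E\<in>space P. x \<le> \<bar>\<Sum>j=1..p. (contrast n b g j E)\<^sup>2 - w j + 2 * 0 * contrast n b g j E\<bar>} \<in> events"
      unfolding stat by simp
  qed auto
  also note dev
  also have "(2 * noise_const * real p / (real b)\<^sup>2 + 8 * noise_const * (\<Sum>j=1..p. 0\<^sup>2) / real b) / x\<^sup>2 = 2 * noise_const / R\<^sup>2"
    unfolding x_def using b p R by (simp add: field_simps)
  also have "\<dots> \<le> \<eta>"
  proof -
    have "\<eta> * R \<ge> 0" using R noise_const_ge_1 by linarith
    then have "\<eta> \<ge> 0" using R by (simp add: zero_le_mult_iff)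
    then have "\<eta> * R * 1 \<le> \<eta> * R * R" using R by (intro mult_left_mono) auto
    then have "2 * noise_const \<le> \<eta> * R\<^sup>2" using R noise_const_ge_1 by (simp add: power2_eq_square mult.assoc)
    then show ?thesis using R by (simp add: divide_le_eq)
  qed
  finally show ?thesis unfolding x_def .
qed

text \<open>With signal energy s and y = sqrt p / b, missing the threshold R y <= s/2 forces a noise
  deviation of at least s/2. From 2y <= s and 1/b <= y the variance bound is at most 9
  \<open>noise_const\<close> s y. Dividing by (s/2)^2 gives 36 \<open>noise_const\<close> y / s <=
  18 \<open>noise_const\<close> / R.\<close>

lemma alt_level:
  assumes b: "1 \<le> b" and g: "1 \<le> g" "2 * (g * b) \<le> n" and p: "1 \<le> p"
    and w: "\<And>j. j \<in> {1..p} \<Longrightarrow> w j = expectation (\<lambda>E. (contrast n b g j E)\<^sup>2)"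
    and R: "1 \<le> R" "18 * noise_const \<le> \<eta> * R"
    and \<theta>: "2 * (R * sqrt (real p) / real b) \<le> (\<Sum>j=1..p. (contrast n b g j \<theta>)\<^sup>2)"
  shows "prob {E\<in>space P. block_stat n p b g w (add_mean p n \<theta> E) < R * sqrt (real p) / real b} \<le> \<eta>"
proof -
  define s where "s = (\<Sum>j=1..p. (contrast n b g j \<theta>)\<^sup>2)"
  define y where "y = sqrt (real p) / real b"
  have y: "y > 0" unfolding y_def using b p by simp
  have s: "2 * R * y \<le> s" using \<theta> unfolding s_def y_def by simp
  have Ry: "R * y > 0" using R y by simp
  have s0: "s > 0" using s Ry by linarith
  let ?D = "\<lambda>E. \<Sum>j=1..p. (contrast n b g j E)\<^sup>2 - w j + 2 * contrast n b g j \<theta> * contrast n b g j E"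
  have stat: "block_stat n p b g w (add_mean p n \<theta> E) = s + ?D E" for E
    unfolding block_stat_add_mean[OF g(2)] s_def by simp
  have "prob {E\<in>space P. block_stat n p b g w (add_mean p n \<theta> E) < R * y} \<le> prob {E\<in>space P. s / 2 \<le> \<bar>?D E\<bar>}"
  proof (rule finite_measure_mono)
    have "{E\<in>space P. \<bar>block_stat n p b g w (add_mean p n \<theta> E) - s\<bar> \<in> {s / 2..}} \<in> events"
      using block_stat_events[OF g(2), of "{z. \<bar>z - s\<bar> \<in> {s / 2..}}" w \<theta>] col_events_sets[OF block_cols_subset[OF g(2)]] by auto
    then show "{E\<in>space P. s / 2 \<le> \<bar>?D E\<bar>} \<in> events" unfolding stat by simp
    show "{E\<in>space P. block_stat n p b g w (add_mean p n \<theta> E) < R * y} \<subseteq> {E\<in>space P. s / 2 \<le> \<bar>?D E\<bar>}"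
    proof safe
      fix E assume "block_stat n p b g w (add_mean p n \<theta> E) < R * y"
      then have "s + ?D E < s / 2" using s unfolding stat by linarith
      then show "s / 2 \<le> \<bar>?D E\<bar>" by linarith
    qed
  qed
  also have "\<dots> \<le> (2 * noise_const * real p / (real b)\<^sup>2 + 8 * noise_const * s / real b) / (s / 2)\<^sup>2"
    unfolding s_def by (rule deviation[OF b g _ w]) (use s0 in \<open>simp add: s_def\<close>)
  also have "\<dots> \<le> (2 * noise_const * y\<^sup>2 + 8 * noise_const * s * y) / (s / 2)\<^sup>2"
  proof (intro divide_right_mono add_mono)
    show "2 * noise_const * real p / (real b)\<^sup>2 \<le> 2 * noise_const * y\<^sup>2" unfolding y_def by (simp add: power_divide)
    have "1 / real b \<le> y" unfolding y_def using p by (intro divide_right_mono) auto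
    then have "8 * noise_const * s * (1 / real b) \<le> 8 * noise_const * s * y" using s0 noise_const_ge_1 by (intro mult_left_mono) auto
    then show "8 * noise_const * s / real b \<le> 8 * noise_const * s * y" by simp
  qed simp
  also have "\<dots> \<le> \<eta>"
  proof -
    have "2 * y \<le> 2 * R * y" using R y by simp
    then have ys: "2 * y \<le> s" using s by linarith
    have "2 * noise_const * y\<^sup>2 \<le> noise_const * s * y"
      using mult_left_mono[OF ys, of "noise_const * y"] noise_const_ge_1 y by (simp add: power2_eq_square mult_ac)
    then have "2 * noise_const * y\<^sup>2 + 8 * noise_const * s * y \<le> 9 * noise_const * s * y" by linarith
    also have "\<dots> \<le> \<eta> * R / 2 * (s * y)" 
      using mult_right_mono[OF R(2), of "s * y / 2"] s0 y by (simp add: mult_ac)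
    also have "\<dots> = \<eta> * (2 * R * y) * s / 4" by simp
    also have "\<dots> \<le> \<eta> * s * s / 4"
    proof -
      have "\<eta> * R \<ge> 0" using R noise_const_ge_1 by linarith
      then have "\<eta> \<ge> 0" using R by (simp add: zero_le_mult_iff)
      then show ?thesis using s s0 by (intro divide_right_mono mult_right_mono mult_left_mono) auto
    qed
    finally have "2 * noise_const * y\<^sup>2 + 8 * noise_const * s * y \<le> \<eta> * (s / 2)\<^sup>2" by (simp add: power2_eq_square)
    then show ?thesis using s0 by (simp add: divide_le_eq)
  qed
  finally show ?thesis unfolding y_def by simp
qed

end

section \<open>Choice of the number of blocks\<close>

text \<open>Here 32 is the value of 8n at n = 4, so the iterated logarithm in the rate always
  exceeds 1.\<close>

lemma exp_exp_1_less: "exp (exp 1) < (32::real)"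
proof -
  have "exp (exp 1) \<le> exp (3::real)" using exp_le by simp
  also have "\<dots> = exp 1 ^ 3" by (simp flip: exp_of_nat_mult)
  also have "\<dots> \<le> 3 ^ 3" using exp_le by (intro power_mono) auto
  finally show ?thesis by simp
qed

lemma less_ln_if_exp_less:
  fixes a x :: real
  assumes "exp a < x"
  shows "a < ln x"
proof -
  have "0 < x" using assms by (rule less_trans[OF exp_gt_zero])
  then have "ln (exp a) < ln x" using assms by (subst ln_less_cancel_iff) auto
  then show ?thesis by simp
qed

lemma ln_ln_gt_1:
  fixes x :: real
  assumes "32 \<le> x"
  shows "1 < ln (ln x)"
proof -
  have "exp (exp 1) < x" using exp_exp_1_less assms by simp
  then show ?thesis by (intro less_ln_if_exp_less)
qed

lemma ln_2_ge_half: "1 / 2 \<le> ln (2::real)"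
proof -
  have "1 \<le> ln (4::real)" using exp_le by (subst ln_ge_iff) auto
  moreover have "ln (4::real) = 2 * ln 2" using ln_realpow[of 2 2] by simp
  ultimately show ?thesis by simp
qed

lemma ex_power_2_between:
  fixes x :: real
  assumes "1 \<le> x"
  shows "\<exists>k::nat. x \<le> 2 ^ k \<and> 2 ^ k \<le> 2 * x"
proof -
  define k where "k = (LEAST k::nat. x \<le> 2 ^ k)"
  have "\<exists>k::nat. x \<le> 2 ^ k" using real_arch_pow[of 2 x] by (auto intro: less_imp_le)
  then have k: "x \<le> 2 ^ k" unfolding k_def by (rule LeastI_ex)
  have "2 ^ k \<le> 2 * x"
  proof (cases k)
    case (Suc l)
    then have "\<not> x \<le> 2 ^ l" using not_less_Least[of l "\<lambda>k. x \<le> 2 ^ k"] unfolding k_def by auto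
    then show ?thesis using Suc by simp
  qed (use assms in simp)
  with k show ?thesis by blast
qed

text \<open>With L = ln ln (8n), a power of two N = 2^k = O(L) has k = O(1 + ln L), so the span of
  the Cantor-like set is O(L (1 + ln L)). Here ln L <= l = ln ln ln (64n), and l stays away from 0,
  which lets constants be absorbed.\<close>

lemma scale_choice:
  fixes \<epsilon> :: real and d :: nat
  assumes \<epsilon>: "0 < \<epsilon>" "\<epsilon> < 1"
  shows "\<exists>C>0. \<forall>n::nat\<ge>4. \<exists>k m. ln (ln (8 * real n)) + ln (8 / \<epsilon>) \<le> 2 ^ k \<and> cantor_len d k \<le> 2 ^ m \<and>
    real (2 ^ m) \<le> C * (ln (ln (8 * real n)) * (ln (ln (ln (64 * real n))))\<^sup>2)"
proof -
  \<comment> \<open>The value of ln ln ln (64n) at n = 4, a lower bound for all admissible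
    n.\<close>
  define l0 where "l0 = ln (ln (ln (256::real)))"
  have l0: "l0 > 0" unfolding l0_def by (intro ln_gt_zero ln_ln_gt_1) simp
  define e0 where "e0 = ln (8 / \<epsilon>)"
  have e0: "e0 > 0" unfolding e0_def using \<epsilon> by (simp add: ln_gt_zero)
  \<comment> \<open>Since L > 1, 2 (L + e0) <= c L.\<close>
  define c where "c = 2 * (1 + e0)"
  have c: "c \<ge> 1" and lnc: "ln c \<ge> 0" unfolding c_def using e0 by auto
  define C where "C = 2 * c * ((1 + 2 * real d * ln c) / l0\<^sup>2 + 2 * real d / l0)"
  have "C > 0" unfolding C_def using c lnc l0
    by (intro mult_pos_pos add_pos_nonneg divide_pos_pos) (auto intro: add_pos_nonneg)
  moreover have "\<exists>k m. ln (ln (8 * real n)) + ln (8 / \<epsilon>) \<le> 2 ^ k \<and> cantor_len d k \<le> 2 ^ m \<and>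
    real (2 ^ m) \<le> C * (ln (ln (8 * real n)) * (ln (ln (ln (64 * real n))))\<^sup>2)" if n: "n \<ge> 4" for n :: nat
  proof -
    define L where "L = ln (ln (8 * real n))"
    define l where "l = ln (ln (ln (64 * real n)))"
    have L: "L > 1" unfolding L_def using n by (intro ln_ln_gt_1) simp
    have ll: "1 < ln (ln (64 * real n))" using n by (intro ln_ln_gt_1) simp
    have ge: "1 < ln (8 * real n)"
    proof -
      have "exp 1 < 8 * real n" using exp_le n by linarith
      then show ?thesis by (rule less_ln_if_exp_less)
    qed
    have "L \<le> ln (ln (64 * real n))"
    proof -
      have "ln (8 * real n) \<le> ln (64 * real n)" using n by (subst ln_le_cancel_iff) auto
      then show ?thesis unfolding L_def using ge by (subst ln_le_cancel_iff) auto
    qed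
    then have lnL: "ln L \<le> l" unfolding l_def using L by (subst ln_le_cancel_iff) auto
    have l: "l0 \<le> l"
    proof -
      have 1: "ln 256 \<le> ln (64 * real n)" using n by (subst ln_le_cancel_iff) auto
      have 0: "1 < ln (ln (256::real))" by (rule ln_ln_gt_1) simp
      then have 3: "(0::real) < ln 256" by simp
      have 2: "ln (ln 256) \<le> ln (ln (64 * real n))" by (rule ln_mono[OF 1 3])
      have "0 < ln (ln (256::real))" using 0 by linarith
      with 2 show ?thesis unfolding l0_def l_def by (rule ln_mono)
    qed
    obtain k :: nat where k: "L + e0 \<le> 2 ^ k" "2 ^ k \<le> 2 * (L + e0)"
      using ex_power_2_between[of "L + e0"] L e0 by auto
    have len1: "1 \<le> real (cantor_len d k)" using cantor_len_pos[of d k] by simp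
    obtain m :: nat where m: "real (cantor_len d k) \<le> 2 ^ m" "2 ^ m \<le> 2 * real (cantor_len d k)"
      using ex_power_2_between[OF len1] by auto
    have "e0 * 1 \<le> e0 * L" using L e0 by (intro mult_left_mono) auto
    then have kc: "2 ^ k \<le> c * L" using k(2) unfolding c_def by (simp add: algebra_simps)
    then have "ln (2 ^ k) \<le> ln (c * L)" using c L by (subst ln_le_cancel_iff) auto
    also have "\<dots> = ln c + ln L" using c L by (subst ln_mult) auto
    finally have "real k * ln 2 \<le> ln c + l" using lnL by (simp add: ln_realpow)
    moreover have "real k * (1 / 2) \<le> real k * ln 2" using ln_2_ge_half by (intro mult_left_mono) auto
    ultimately have "real k * (1 / 2) \<le> ln c + l" by (rule order_trans[rotated])
    then have kl: "real k \<le> 2 * (ln c + l)" by simp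
    have "real (cantor_len d k) \<le> real (2 ^ k * (1 + d * k))" using cantor_len_le by (simp only: of_nat_le_iff)
    also have "\<dots> = 2 ^ k * (1 + real d * real k)" by (simp add: algebra_simps)
    also have "\<dots> \<le> c * L * (1 + real d * (2 * (ln c + l)))"
      using kc kl c L by (intro mult_mono add_mono mult_left_mono) auto
    finally have len: "real (cantor_len d k) \<le> c * L * (1 + real d * (2 * (ln c + l)))" .
    \<comment> \<open>The left side is affine in l; since l / l0 >= 1, the constant term may be
      multiplied by (l / l0)^2 and the linear term by l / l0.\<close>
    have quad: "1 + real d * (2 * (ln c + l)) \<le> ((1 + 2 * real d * ln c) / l0\<^sup>2 + 2 * real d / l0) * l\<^sup>2"
    proof -
      have r1: "1 \<le> l / l0" using l l0 by simp
      have r2: "1 \<le> (l / l0)\<^sup>2" using r1 by (simp add: one_le_power)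
      have "(1 + 2 * real d * ln c) * 1 \<le> (1 + 2 * real d * ln c) * (l / l0)\<^sup>2"
        using r2 lnc by (intro mult_left_mono) auto
      moreover have "(2 * real d * l) * 1 \<le> (2 * real d * l) * (l / l0)"
        using r1 l l0 by (intro mult_left_mono) auto
      ultimately show ?thesis by (simp add: power_divide power2_eq_square algebra_simps add_divide_distrib)
    qed
    have "real (2 ^ m) \<le> 2 * (c * L * (1 + real d * (2 * (ln c + l))))" using m(2) len by simp
    also have "\<dots> \<le> 2 * (c * L * (((1 + 2 * real d * ln c) / l0\<^sup>2 + 2 * real d / l0) * l\<^sup>2))"
      using quad c L by (intro mult_left_mono) auto
    also have "\<dots> = C * (L * l\<^sup>2)" unfolding C_def by (simp only: mult_ac)
    finally have "real (2 ^ m) \<le> C * (L * l\<^sup>2)" .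
    moreover have "cantor_len d k \<le> 2 ^ m" using m(1) by (simp flip: of_nat_le_iff)
    ultimately show ?thesis using k(1) unfolding L_def l_def e0_def by blast
  qed
  ultimately show ?thesis by blast
qed

text \<open>It suffices to have the case m = 1 with \<open>max 1 c\<^sub>1\<close> in place of
  \<open>c\<^sub>1\<close>: its m-th power is the claim, because
  \<open>c\<^sub>1 \<le> (max 1 c\<^sub>1) ^ m\<close>.\<close>

lemma ex_separation:
  fixes c\<^sub>1 c\<^sub>2 q :: real
  assumes "c\<^sub>2 > 0" and q: "0 < q" "q < 1"
  shows "\<exists>d::nat\<ge>1. \<forall>m::nat\<ge>1. c\<^sub>1 * exp (- c\<^sub>2 * real (d * m)) \<le> q ^ (2 * m)"
proof -
  define d where "d = nat \<lceil>ln (max 1 c\<^sub>1 / q\<^sup>2) / c\<^sub>2\<rceil> + 1"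
  have "ln (max 1 c\<^sub>1 / q\<^sup>2) / c\<^sub>2 \<le> real d" unfolding d_def by linarith
  then have "ln (max 1 c\<^sub>1 / q\<^sup>2) \<le> c\<^sub>2 * real d" using assms by (simp add: field_simps)
  then have le: "exp (ln (max 1 c\<^sub>1 / q\<^sup>2)) \<le> exp (c\<^sub>2 * real d)" by simp
  have "0 < max 1 c\<^sub>1 / q\<^sup>2" using q by simp
  with le have "max 1 c\<^sub>1 / q\<^sup>2 \<le> exp (c\<^sub>2 * real d)" by (simp only: exp_ln)
  then have base: "max 1 c\<^sub>1 * exp (- c\<^sub>2 * real d) \<le> q\<^sup>2" using q by (simp add: exp_minus field_simps)
  have "c\<^sub>1 * exp (- c\<^sub>2 * real (d * m)) \<le> q ^ (2 * m)" if m: "1 \<le> m" for m :: nat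
  proof -
    have "c\<^sub>1 \<le> max 1 c\<^sub>1 ^ 1" by simp
    also have "\<dots> \<le> max 1 c\<^sub>1 ^ m" using m by (intro power_increasing) auto
    finally have "c\<^sub>1 * exp (- c\<^sub>2 * real (d * m)) \<le> max 1 c\<^sub>1 ^ m * exp (- c\<^sub>2 * real (d * m))" by (intro mult_right_mono) auto
    also have "\<dots> = (max 1 c\<^sub>1 * exp (- c\<^sub>2 * real d)) ^ m"
      unfolding power_mult_distrib by (simp flip: exp_of_nat_mult add: mult_ac)
    also have "\<dots> \<le> (q\<^sup>2) ^ m" using base by (intro power_mono) auto
    finally show ?thesis by (simp add: power_mult)
  qed
  moreover have "d \<ge> 1" unfolding d_def by simp
  ultimately show ?thesis by blast
qed

section \<open>The dyadic grid of scales\<close>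

lemma finite_dyadic_grid: "finite (dyadic_grid n)"
  unfolding dyadic_grid_def by simp

lemma dyadic_gridD:
  assumes t: "t \<in> dyadic_grid n" and n: "n \<ge> 2"
  shows "(\<exists>m. t = 2 ^ m) \<and> 2 * t \<le> n"
proof -
  obtain m where m: "t = 2 ^ m" "m \<le> nat \<lfloor>log 2 (real n / 2)\<rfloor>" using t unfolding dyadic_grid_def by auto
  have "0 \<le> log 2 (real n / 2)" using n by simp
  then have "real m \<le> log 2 (real n / 2)" using m(2) by linarith
  then have "2 ^ m \<le> real n / 2" using n by (simp add: le_log_iff powr_realpow)
  then have "real (2 * 2 ^ m) \<le> real n" by simp
  then show ?thesis using m(1) by (simp only: of_nat_le_iff) auto
qed

lemma dyadic_gridI:
  assumes "2 * 2 ^ m \<le> n"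
  shows "2 ^ m \<in> dyadic_grid n"
proof -
  have n: "n > 0" using assms by (cases n) auto
  have "real (2 * 2 ^ m) \<le> real n" using assms by (simp only: of_nat_le_iff)
  then have "2 powr (real m) \<le> real n / 2" by (simp add: powr_realpow)
  then have "real m \<le> log 2 (real n / 2)" using n by (simp add: le_log_iff)
  then have "m \<le> nat \<lfloor>log 2 (real n / 2)\<rfloor>" by (simp add: le_nat_floor)
  then show ?thesis unfolding dyadic_grid_def by auto
qed

lemma card_dyadic_grid_le:
  assumes n: "n \<ge> 2"
  shows "real (card (dyadic_grid n)) \<le> 2 * ln (8 * real n)"
proof -
  have "card (dyadic_grid n) \<le> nat \<lfloor>log 2 (real n / 2)\<rfloor> + 1"
    unfolding dyadic_grid_def by (rule order_trans[OF card_image_le]) auto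
  moreover have "0 \<le> log 2 (real n / 2)" using n by simp
  ultimately have "real (card (dyadic_grid n)) \<le> log 2 (real n / 2) + 1" by linarith
  also have "\<dots> = ln (real n) / ln 2" using n by (simp add: log_def ln_div diff_divide_distrib)
  also have "\<dots> \<le> ln (real n) / (1 / 2)" using n ln_2_ge_half by (intro divide_left_mono) auto
  also have "\<dots> \<le> 2 * ln (8 * real n)" using n by simp
  finally show ?thesis .
qed

section \<open>The test\<close>

text \<open>Scales below \<Delta> take part only through t = 1, a single vote on the first and last
  column; \<open>real 1\<close> keeps its threshold in the common form with block length 1. A scale
  rejects already with half of the votes, and accepting then needs more than half on the other side,
  so \<open>prob_cantor_majority_le\<close> fits both kinds of error.\<close>

definition rejects ::
    "nat \<Rightarrow> nat \<Rightarrow> nat \<Rightarrow> nat \<Rightarrow> nat \<Rightarrow> real \<Rightarrow> (nat \<times> nat \<times> nat \<Rightarrow> real) \<Rightarrow> (nat \<times> nat \<Rightarrow> real) \<Rightarrow> bool" where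
  "rejects p n \<Delta> d k R v X \<longleftrightarrow>
     R * sqrt (real p) / real 1 \<le> block_stat n p 1 1 (\<lambda>j. v (1, 1, j)) X \<or>
     (\<exists>t\<in>{t\<in>dyadic_grid n. \<Delta> \<le> t}. 2 ^ k \<le> 2 * card {g\<in>cantor d k.
        R * sqrt (real p) / real (t div \<Delta>) \<le> block_stat n p (t div \<Delta>) g (\<lambda>j. v (t, g, j)) X})"

lemma block_stat_measurable:
  assumes "2 * (g * b) \<le> n"
  shows "block_stat n p b g w \<in> borel_measurable (mat_space p n)"
proof -
  have [measurable]: "contrast n b g j \<in> borel_measurable (mat_space p n)" if "j \<in> {1..p}" for j
    using that block_cols_subset[OF assms] by (intro contrast_measurable entry_measurable) auto
  show ?thesis unfolding block_stat_def[abs_def] by measurable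
qed

lemma sets_Collect_card_ge:
  fixes Q :: "nat \<Rightarrow> 'a \<Rightarrow> bool"
  assumes "finite G" "\<And>g. g \<in> G \<Longrightarrow> {x\<in>space M. Q g x} \<in> sets M"
  shows "{x\<in>space M. N \<le> 2 * card {g\<in>G. Q g x}} \<in> sets M"
proof -
  have "{x\<in>space M. N \<le> 2 * card {g\<in>G. Q g x}}
      = (\<Union>H\<in>{H\<in>Pow G. N \<le> 2 * card H}. all_in M (\<lambda>g. {x\<in>space M. Q g x}) H)" (is "?l = ?r")
  proof (intro set_eqI iffI)
    fix x assume "x \<in> ?l"
    then show "x \<in> ?r" unfolding all_in_def by (auto intro!: exI[of _ "{g\<in>G. Q g x}"])
  next
    fix x assume "x \<in> ?r"
    then obtain H where H: "H \<subseteq> G" "N \<le> 2 * card H" "x \<in> space M" "\<forall>g\<in>H. Q g x" unfolding all_in_def by auto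
    then have "card H \<le> card {g\<in>G. Q g x}" using assms(1) by (intro card_mono) auto
    then show "x \<in> ?l" using H by simp
  qed
  also have "\<dots> \<in> sets M"
    using assms finite_subset[OF _ assms(1)] by (intro sets.finite_UN all_in_sets) auto
  finally show ?thesis .
qed

lemma add_mean_measurable:
  assumes "sets P = sets (mat_space p n)"
  shows "add_mean p n \<theta> \<in> P \<rightarrow>\<^sub>M mat_space p n"
  unfolding add_mean_def[abs_def] measurable_cong_sets[OF assms refl] unfolding mat_space_def
  by (intro measurable_restrict borel_measurable_add borel_measurable_const measurable_component_singleton)

lemma contrast_null:
  assumes \<theta>: "\<theta> \<in> Theta_null p n" and gb: "2 * (g * b) \<le> n" and j: "j \<in> {1..p}"
  shows "contrast n b g j \<theta> = 0"
proof -
  obtain \<mu> where \<mu>: "\<And>t. t \<in> {1..n} \<Longrightarrow> mat_col p t \<theta> = \<mu>" using \<theta> unfolding Theta_null_def by auto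
  have eq: "\<theta> (j, i) = \<mu> j" if "i \<in> {1..n}" for i
    using fun_cong[OF \<mu>[OF that], of j] j by (simp add: mat_col_def)
  have "(\<Sum>i = (g - 1) * b + 1..g * b. (\<theta> (j, i) - \<theta> (j, n + 1 - i)) / sqrt 2) = 0"
  proof (intro sum.neutral ballI)
    fix i assume "i \<in> {(g - 1) * b + 1..g * b}"
    then have "i \<in> {1..n}" "n + 1 - i \<in> {1..n}"
      using block_cols_subset[OF gb] unfolding block_cols_def by blast+
    then show "(\<theta> (j, i) - \<theta> (j, n + 1 - i)) / sqrt 2 = 0" using eq[of i] eq[of "n + 1 - i"] by simp
  qed
  then show ?thesis unfolding contrast_def by simp
qed

text \<open>Column i lies before the change and column n + 1 - i after it exactly in the stated
  range, so every reflected difference there equals the full jump.\<close>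

lemma Theta_altE:
  assumes "\<theta> \<in> Theta_alt p n \<rho>"
  obtains t\<^sub>0 \<delta> where "t\<^sub>0 \<in> {1..n-1}"
    "\<And>j i. j \<in> {1..p} \<Longrightarrow> i \<in> {1..n} \<Longrightarrow> i \<le> t\<^sub>0 \<Longrightarrow> i \<le> n - t\<^sub>0 \<Longrightarrow> \<theta> (j, i) - \<theta> (j, n + 1 - i) = \<delta> j"
    "\<rho>\<^sup>2 \<le> real t\<^sub>0 * (real n - real t\<^sub>0) / real n * (\<Sum>j=1..p. (\<delta> j)\<^sup>2)"
proof -
  obtain t\<^sub>0 \<mu>1 \<mu>2 where t0: "t\<^sub>0 \<in> {1..n-1}"
    and 1: "\<And>t. t \<in> {1..t\<^sub>0} \<Longrightarrow> mat_col p t \<theta> = \<mu>1" and 2: "\<And>t. t \<in> {t\<^sub>0<..n} \<Longrightarrow> mat_col p t \<theta> = \<mu>2"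
    and \<rho>: "\<rho>\<^sup>2 \<le> real t\<^sub>0 * (real n - real t\<^sub>0) / real n * (L2_set (\<lambda>j. \<mu>1 j - \<mu>2 j) {1..p})\<^sup>2"
    using assms unfolding Theta_alt_def by auto
  show thesis
  proof (rule that[OF t0])
    fix j i assume j: "j \<in> {1..p}" and i: "i \<in> {1..n}" "i \<le> t\<^sub>0" "i \<le> n - t\<^sub>0"
    then have "i \<in> {1..t\<^sub>0}" "n + 1 - i \<in> {t\<^sub>0<..n}" using t0 by auto
    then show "\<theta> (j, i) - \<theta> (j, n + 1 - i) = \<mu>1 j - \<mu>2 j"
      using fun_cong[OF 1[of i], of j] fun_cong[OF 2[of "n + 1 - i"], of j] j by (simp add: mat_col_def)
  next
    show "\<rho>\<^sup>2 \<le> real t\<^sub>0 * (real n - real t\<^sub>0) / real n * (\<Sum>j=1..p. (\<mu>1 j - \<mu>2 j)\<^sup>2)"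
      using \<rho> by (simp add: L2_set_def sum_nonneg)
  qed
qed

lemma contrast_alt:
  assumes eq: "\<And>i. i \<in> {1..n} \<Longrightarrow> i \<le> t \<Longrightarrow> \<theta> (j, i) - \<theta> (j, n + 1 - i) = \<delta>"
    and gb: "2 * (g * b) \<le> n" "1 \<le> b" "1 \<le> g" "g * b \<le> t"
  shows "contrast n b g j \<theta> = \<delta> / sqrt 2"
proof -
  have card: "card {(g - 1) * b + 1..g * b} = b" using gb(3) by (cases g) auto
  have "(\<Sum>i = (g - 1) * b + 1..g * b. (\<theta> (j, i) - \<theta> (j, n + 1 - i)) / sqrt 2) = (\<Sum>i = (g - 1) * b + 1..g * b. \<delta> / sqrt 2)"
    using block_cols_subset[OF gb(1)] gb(4) unfolding block_cols_def by (intro sum.cong refl) (subst eq, auto)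
  then show ?thesis unfolding contrast_def sum_constant card using gb(2) by simp
qed

lemma min_power_2_dvd: "min ((2::nat) ^ a) (2 ^ m) dvd 2 ^ a"
  unfolding min_def by (auto intro: le_imp_power_dvd)

lemma second_moments_eq:
  assumes t: "t \<in> dyadic_grid n" "n \<ge> 2" and g: "g \<in> {1..min t (2 ^ m)}" and j: "j \<in> {1..p}"
  shows "second_moments p n (2 ^ m) P (t, g, j) = (\<integral>E. (contrast n (t div min t (2 ^ m)) g j E)\<^sup>2 \<partial>P)"
proof -
  obtain a where a: "t = 2 ^ a" using dyadic_gridD[OF t] by auto
  have "min t (2 ^ m) dvd t" unfolding a by (rule min_power_2_dvd)
  then have "real (t div min t (2 ^ m)) = real t / real (min t (2 ^ m))" by (rule real_of_nat_div)
  then have eq: "real (min t (2 ^ m)) / real t = 1 / real (t div min t (2 ^ m))" by simp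
  have "second_moments p n (2 ^ m) P (t, g, j) = (\<integral>E. (real (min t (2 ^ m)) / real t *
      (\<Sum>i = (g - 1) * (t div min t (2 ^ m)) + 1..g * (t div min t (2 ^ m)). (E (j, i) - E (j, n + 1 - i)) / sqrt 2))\<^sup>2 \<partial>P)"
    unfolding second_moments_def using t g j by (simp add: Let_def)
  then show ?thesis unfolding contrast_def eq .
qed

lemma rejects_measurable:
  assumes n: "n \<ge> 2" and len: "cantor_len d k \<le> 2 ^ m"
  shows "{X\<in>space (mat_space p n). R * sqrt (real p) / real 1 \<le> block_stat n p 1 1 w X} \<in> sets (mat_space p n)"
    and "\<And>t v. t \<in> dyadic_grid n \<Longrightarrow> 2 ^ m \<le> t \<Longrightarrow> {X\<in>space (mat_space p n). 2 ^ k \<le> 2 * card {g\<in>cantor d k.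
        R * sqrt (real p) / real (t div 2 ^ m) \<le> block_stat n p (t div 2 ^ m) g (\<lambda>j. v (t, g, j)) X}} \<in> sets (mat_space p n)"
    and "{X\<in>space (mat_space p n). rejects p n (2 ^ m) d k R v X} \<in> sets (mat_space p n)"
proof -
  have stat: "{X\<in>space (mat_space p n). c \<le> block_stat n p b g w X} \<in> sets (mat_space p n)" if "2 * (g * b) \<le> n" for c b g w
    using block_stat_measurable[OF that, of p w] by measurable
  show S0: "{X\<in>space (mat_space p n). R * sqrt (real p) / real 1 \<le> block_stat n p 1 1 w X} \<in> sets (mat_space p n)" for w
    using n by (intro stat) simp
  show St: "{X\<in>space (mat_space p n). 2 ^ k \<le> 2 * card {g\<in>cantor d k.
        R * sqrt (real p) / real (t div 2 ^ m) \<le> block_stat n p (t div 2 ^ m) g (\<lambda>j. v (t, g, j)) X}} \<in> sets (mat_space p n)"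
    if t: "t \<in> dyadic_grid n" "2 ^ m \<le> t" for t v
  proof (intro sets_Collect_card_ge finite_cantor stat)
    fix g assume "g \<in> cantor d k"
    then have "g \<le> 2 ^ m" using cantor_bounds[of g d k] len by simp
    then have "g * (t div 2 ^ m) \<le> 2 ^ m * (t div 2 ^ m)" by (rule mult_le_mono1)
    also have "\<dots> \<le> t" by (rule times_div_less_eq_dividend)
    finally show "2 * (g * (t div 2 ^ m)) \<le> n" using dyadic_gridD[OF t(1) n] by linarith
  qed
  have "{X\<in>space (mat_space p n). rejects p n (2 ^ m) d k R v X}
      = {X\<in>space (mat_space p n). R * sqrt (real p) / real 1 \<le> block_stat n p 1 1 (\<lambda>j. v (1, 1, j)) X} \<union>
       (\<Union>t\<in>{t\<in>dyadic_grid n. 2 ^ m \<le> t}. {X\<in>space (mat_space p n). 2 ^ k \<le> 2 * card {g\<in>cantor d k.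
        R * sqrt (real p) / real (t div 2 ^ m) \<le> block_stat n p (t div 2 ^ m) g (\<lambda>j. v (t, g, j)) X}})"
    unfolding rejects_def by (rule set_eqI) (simp only: mem_Collect_eq Un_iff UN_iff, blast)
  also have "\<dots> \<in> sets (mat_space p n)"
    by (intro sets.Un sets.finite_UN S0 St) (use finite_dyadic_grid in simp_all)
  finally show "{X\<in>space (mat_space p n). rejects p n (2 ^ m) d k R v X} \<in> sets (mat_space p n)" .
qed

lemma exp_neg_power_le:
  assumes \<epsilon>: "0 < \<epsilon>" and n: "n \<ge> (1::nat)" and k: "ln (ln (8 * real n)) + ln (8 / \<epsilon>) \<le> 2 ^ k"
  shows "exp (- (2 ^ k)) \<le> \<epsilon> / 8 / ln (8 * real n)" "1 \<le> ln (8 * real n)"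
proof -
  have "exp 1 < 8 * real n" using exp_le n by linarith
  then have 1: "1 < ln (8 * real n)" by (rule less_ln_if_exp_less)
  then show "1 \<le> ln (8 * real n)" by simp
  have "exp (- (2 ^ k)) \<le> exp (- (ln (ln (8 * real n)) + ln (8 / \<epsilon>)))" using k by simp
  also have "\<dots> = inverse (ln (8 * real n) * (8 / \<epsilon>))"
    unfolding exp_minus exp_add using 1 \<epsilon> by simp
  also have "\<dots> = \<epsilon> / 8 / ln (8 * real n)" using \<epsilon> by (simp add: field_simps)
  finally show "exp (- (2 ^ k)) \<le> \<epsilon> / 8 / ln (8 * real n)" .
qed

text \<open>The value u = exp(-1)/4 is chosen for 4u = exp(-1). In the condition on R, the level u^2
  is for votes that enter a majority and \<epsilon>/4 for the lone vote at t = 1, which no majority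
  protects.\<close>

locale block_test = temp_noise +
  fixes \<epsilon> R :: real and d k m :: nat
  assumes n: "4 \<le> n" and p: "1 \<le> p" and \<epsilon>: "0 < \<epsilon>" "\<epsilon> < 1" and d: "1 \<le> d"
    and sep: "\<And>l::nat. 1 \<le> l \<Longrightarrow> c\<^sub>1 * exp (- c\<^sub>2 * real (d * l)) \<le> ((exp (- 1) / 4)\<^sup>2) ^ (2 * l)"
    and len: "cantor_len d k \<le> 2 ^ m" and k: "ln (ln (8 * real n)) + ln (8 / \<epsilon>) \<le> 2 ^ k"
    and R: "1 \<le> R" "18 * noise_const \<le> min ((exp (- 1) / 4)\<^sup>2) (\<epsilon> / 4) * R"
begin

abbreviation "v \<equiv> second_moments p n (2 ^ m) P"

lemma scale:
  assumes t: "t \<in> dyadic_grid n" "2 ^ m \<le> t"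
  shows "1 \<le> t div 2 ^ m" "2 ^ m * (t div 2 ^ m) = t" "2 * t \<le> n"
    "\<And>g j. g \<in> {1..2 ^ m} \<Longrightarrow> j \<in> {1..p} \<Longrightarrow> v (t, g, j) = expectation (\<lambda>E. (contrast n (t div 2 ^ m) g j E)\<^sup>2)"
    "\<And>g. g \<in> {1..2 ^ m} \<Longrightarrow> g * (t div 2 ^ m) \<le> t"
proof -
  obtain a where a: "t = 2 ^ a" "2 * t \<le> n" using dyadic_gridD[OF t(1)] n by auto
  show "2 * t \<le> n" by (rule a)
  have "(2::nat) ^ m \<le> 2 ^ a" using t(2) a by simp
  then have "m \<le> a" by simp
  then have "(2::nat) ^ m dvd t" unfolding a by (rule le_imp_power_dvd)
  then show eq: "2 ^ m * (t div 2 ^ m) = t" by simp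
  then show "1 \<le> t div 2 ^ m" using a(1) by (cases "t div 2 ^ m") auto
  have "min t (2 ^ m) = 2 ^ m" using t(2) by simp
  then show "v (t, g, j) = expectation (\<lambda>E. (contrast n (t div 2 ^ m) g j E)\<^sup>2)"
    if "g \<in> {1..2 ^ m}" "j \<in> {1..p}" for g j
    using second_moments_eq[OF t(1), of g m j] that n by simp
  show "g * (t div 2 ^ m) \<le> t" if "g \<in> {1..2 ^ m}" for g
  proof -
    have "g * (t div 2 ^ m) \<le> 2 ^ m * (t div 2 ^ m)" using that by (intro mult_le_mono1) simp
    then show ?thesis unfolding eq .
  qed
qed

lemma first_scale:
  assumes "j \<in> {1..p}"
  shows "v (1, 1, j) = expectation (\<lambda>E. (contrast n 1 1 j E)\<^sup>2)"
proof -
  have "(1::nat) \<in> dyadic_grid n" using dyadic_gridI[of 0 n] n by simp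
  moreover have "min (1::nat) (2 ^ m) = 1" by simp
  ultimately show ?thesis using second_moments_eq[of 1 n 1 m j] assms n by simp
qed

text \<open>The set \<open>B\<close> of wrong outcomes is left open: it is the half line above the
  threshold for the null and the one below it for the alternative.\<close>

lemma scale_tail:
  assumes t: "t \<in> dyadic_grid n" "2 ^ m \<le> t" and B: "B \<in> sets borel"
    and level: "\<And>g. g \<in> {1..2 ^ m} \<Longrightarrow>
      prob {E\<in>space P. block_stat n p (t div 2 ^ m) g (\<lambda>j. v (t, g, j)) (add_mean p n \<theta> E) \<in> B} \<le> (exp (- 1) / 4)\<^sup>2"
  shows "prob {E\<in>space P. 2 ^ k \<le> 2 * card {g\<in>cantor d k.
      block_stat n p (t div 2 ^ m) g (\<lambda>j. v (t, g, j)) (add_mean p n \<theta> E) \<in> B}} \<le> exp (- (2 ^ k))"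
proof -
  note s = scale[OF t]
  define A where "A g = {E\<in>space P. block_stat n p (t div 2 ^ m) g (\<lambda>j. v (t, g, j)) (add_mean p n \<theta> E) \<in> B}" for g
  have "prob {E\<in>space P. 2 ^ k \<le> 2 * card {g\<in>cantor d k. E \<in> A g}} \<le> (4 * (exp (- 1) / 4)) ^ (2 ^ k)"
  proof (rule majority_tail[OF s(1) _ d sep _ _ len])
    show "2 * (2 ^ m * (t div 2 ^ m)) \<le> n" using s by simp
    show "A g \<in> col_events p P (block_cols n (t div 2 ^ m) g)" if "g \<in> {1..2 ^ m}" for g
      unfolding A_def using s(3) s(5)[OF that] by (intro block_stat_events B) simp
    show "prob (A g) \<le> (exp (- 1) / 4)\<^sup>2" if "g \<in> {1..2 ^ m}" for g
      unfolding A_def by (rule level[OF that])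
    have "exp (- 1) \<le> (1::real)" by simp
    then show "exp (- 1) / 4 \<le> (1::real)" by linarith
  qed auto
  also have "(4 * (exp (- 1) / 4)) ^ (2 ^ k) = exp (- (2 ^ k) :: real)"
    by (simp flip: exp_of_nat_mult)
  finally show ?thesis unfolding A_def by (simp cong: conj_cong)
qed

lemma vimage_add_mean:
  assumes "{X\<in>space (mat_space p n). Q X} \<in> sets (mat_space p n)"
  shows "{E\<in>space P. Q (add_mean p n \<theta> E)} \<in> events"
proof -
  have eq: "add_mean p n \<theta> -` {X\<in>space (mat_space p n). Q X} \<inter> space P = {E\<in>space P. Q (add_mean p n \<theta> E)}"
    using measurable_space[OF add_mean_measurable[OF sets_P, of \<theta>]] by auto
  show ?thesis using measurable_sets[OF add_mean_measurable[OF sets_P, of \<theta>] assms] unfolding eq .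
qed

lemma null_error:
  assumes \<theta>: "\<theta> \<in> Theta_null p n"
  shows "prob {E\<in>space P. rejects p n (2 ^ m) d k R v (add_mean p n \<theta> E)} \<le> \<epsilon> / 2"
proof -
  have n2: "2 \<le> n" using n by simp
  let ?\<T> = "{t\<in>dyadic_grid n. 2 ^ m \<le> t}"
  define Q0 where "Q0 X \<longleftrightarrow> R * sqrt (real p) / real 1 \<le> block_stat n p 1 1 (\<lambda>j. v (1, 1, j)) X" for X
  define Q where "Q t X \<longleftrightarrow> 2 ^ k \<le> 2 * card {g\<in>cantor d k.
        R * sqrt (real p) / real (t div 2 ^ m) \<le> block_stat n p (t div 2 ^ m) g (\<lambda>j. v (t, g, j)) X}" for t X
  have Q0: "{E\<in>space P. Q0 (add_mean p n \<theta> E)} \<in> events"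
    unfolding Q0_def by (intro vimage_add_mean rejects_measurable(1)[OF n2 len])
  have Q: "{E\<in>space P. Q t (add_mean p n \<theta> E)} \<in> events" if "t \<in> ?\<T>" for t
    unfolding Q_def using that by (intro vimage_add_mean rejects_measurable(2)[OF n2 len]) auto
  have fin: "finite ?\<T>" using finite_dyadic_grid by simp
  have "prob {E\<in>space P. Q0 (add_mean p n \<theta> E)} \<le> min ((exp (- 1) / 4)\<^sup>2) (\<epsilon> / 4)"
    unfolding Q0_def
    by (rule null_level[OF _ _ _ p _ R]) (use n first_scale contrast_null[OF \<theta>] in auto)
  then have p0: "prob {E\<in>space P. Q0 (add_mean p n \<theta> E)} \<le> \<epsilon> / 4" by simp
  have pt: "prob {E\<in>space P. Q t (add_mean p n \<theta> E)} \<le> exp (- (2 ^ k))" if t: "t \<in> ?\<T>" for t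
  proof -
    from t have t': "t \<in> dyadic_grid n" "2 ^ m \<le> t" by auto
    note s = scale[OF t']
    have "prob {E\<in>space P. 2 ^ k \<le> 2 * card {g\<in>cantor d k.
      block_stat n p (t div 2 ^ m) g (\<lambda>j. v (t, g, j)) (add_mean p n \<theta> E) \<in> {R * sqrt (real p) / real (t div 2 ^ m)..}}} \<le> exp (- (2 ^ k))"
    proof (rule scale_tail[OF t'])
      fix g :: nat assume g: "g \<in> {1..2 ^ m}"
      have gb: "2 * (g * (t div 2 ^ m)) \<le> n" using s(3) s(5)[OF g] by simp
      have "prob {E\<in>space P. R * sqrt (real p) / real (t div 2 ^ m) \<le> block_stat n p (t div 2 ^ m) g (\<lambda>j. v (t, g, j)) (add_mean p n \<theta> E)}
          \<le> min ((exp (- 1) / 4)\<^sup>2) (\<epsilon> / 4)"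
        by (rule null_level[OF s(1) _ gb p _ R]) (use g s(4) contrast_null[OF \<theta> gb] in auto)
      then show "prob {E\<in>space P. block_stat n p (t div 2 ^ m) g (\<lambda>j. v (t, g, j)) (add_mean p n \<theta> E)
          \<in> {R * sqrt (real p) / real (t div 2 ^ m)..}} \<le> (exp (- 1) / 4)\<^sup>2" by simp
    qed simp
    then show ?thesis unfolding Q_def by simp
  qed
  have "{E\<in>space P. rejects p n (2 ^ m) d k R v (add_mean p n \<theta> E)}
      = {E\<in>space P. Q0 (add_mean p n \<theta> E)} \<union> (\<Union>t\<in>?\<T>. {E\<in>space P. Q t (add_mean p n \<theta> E)})"
    unfolding rejects_def Q0_def[symmetric] Q_def[symmetric] by blast
  then have "prob {E\<in>space P. rejects p n (2 ^ m) d k R v (add_mean p n \<theta> E)}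
      \<le> prob {E\<in>space P. Q0 (add_mean p n \<theta> E)} + prob (\<Union>t\<in>?\<T>. {E\<in>space P. Q t (add_mean p n \<theta> E)})"
    using Q0 Q fin by (simp only:) (intro measure_Un_le sets.finite_UN, auto)
  also have "\<dots> \<le> \<epsilon> / 4 + (\<Sum>t\<in>?\<T>. prob {E\<in>space P. Q t (add_mean p n \<theta> E)})"
    using Q fin by (intro add_mono p0 finite_measure_subadditive_finite) auto
  also have "\<dots> \<le> \<epsilon> / 4 + (\<Sum>t\<in>?\<T>. exp (- (2 ^ k)))"
    by (intro add_left_mono sum_mono pt)
  \<comment> \<open>There are at most 2 ln (8n) scales, each failing with probability at most
    \<epsilon> / (8 ln (8n)); the summand ln (8/\<epsilon>) in the choice of k provides the
    latter.\<close>
  also have "\<dots> \<le> \<epsilon> / 4 + \<epsilon> / 4"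
  proof (intro add_left_mono)
    have "real (card ?\<T>) \<le> real (card (dyadic_grid n))"
      using finite_dyadic_grid by (simp only: of_nat_le_iff) (intro card_mono, auto)
    also have "\<dots> \<le> 2 * ln (8 * real n)" by (rule card_dyadic_grid_le[OF n2])
    finally have "real (card ?\<T>) * exp (- (2 ^ k)) \<le> 2 * ln (8 * real n) * (\<epsilon> / 8 / ln (8 * real n))"
      using exp_neg_power_le[OF \<epsilon>(1) _ k] n by (intro mult_mono) auto
    also have "\<dots> = \<epsilon> / 4" using exp_neg_power_le(2)[OF \<epsilon>(1) _ k] n by simp
    finally show "(\<Sum>t\<in>?\<T>. exp (- (2 ^ k))) \<le> \<epsilon> / 4" by simp
  qed
  finally show ?thesis by simp
qed

text \<open>Let q be the distance of the change to the nearer end; the weight t0 (n - t0) / n is at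
  most q. All blocks within the first q columns carry the full jump. The 8 is a product of three
  factors 2: signal over threshold in \<open>alt_level\<close>, the energy halved by the sqrt 2 in
  the contrast, and the rounding of q down to a power of two.\<close>

lemma alt_error:
  assumes \<theta>: "\<theta> \<in> Theta_alt p n \<rho>" and \<rho>: "8 * R * 2 ^ m * sqrt (real p) \<le> \<rho>\<^sup>2"
  shows "prob {E\<in>space P. \<not> rejects p n (2 ^ m) d k R v (add_mean p n \<theta> E)} \<le> \<epsilon> / 2"
proof -
  have n2: "2 \<le> n" using n by simp
  obtain t\<^sub>0 \<delta> where t0: "t\<^sub>0 \<in> {1..n-1}"
    and \<delta>: "\<And>j i. j \<in> {1..p} \<Longrightarrow> i \<in> {1..n} \<Longrightarrow> i \<le> t\<^sub>0 \<Longrightarrow> i \<le> n - t\<^sub>0 \<Longrightarrow> \<theta> (j, i) - \<theta> (j, n + 1 - i) = \<delta> j"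
    and \<rho>2: "\<rho>\<^sup>2 \<le> real t\<^sub>0 * (real n - real t\<^sub>0) / real n * (\<Sum>j=1..p. (\<delta> j)\<^sup>2)"
    using Theta_altE[OF \<theta>] by metis
  define S where "S = (\<Sum>j=1..p. (\<delta> j)\<^sup>2)"
  define q where "q = min t\<^sub>0 (n - t\<^sub>0)"
  have q: "1 \<le> q" "2 * q \<le> n" "q \<le> t\<^sub>0" "q \<le> n - t\<^sub>0" unfolding q_def using t0 by auto
  have S0: "0 \<le> S" unfolding S_def by (intro sum_nonneg) auto
  have "real t\<^sub>0 * (real n - real t\<^sub>0) / real n \<le> real q"
  proof (cases "t\<^sub>0 \<le> n - t\<^sub>0")
    case True
    then have "real q = real t\<^sub>0" unfolding q_def by simp
    moreover have "real t\<^sub>0 * (real n - real t\<^sub>0) \<le> real t\<^sub>0 * real n" by (intro mult_left_mono) auto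
    ultimately show ?thesis using n by (simp add: divide_le_eq)
  next
    case False
    then have "real q = real n - real t\<^sub>0" unfolding q_def using t0 by (simp add: of_nat_diff)
    moreover have "real t\<^sub>0 * (real n - real t\<^sub>0) \<le> real n * (real n - real t\<^sub>0)"
      using t0 by (intro mult_right_mono) auto
    ultimately show ?thesis using n by (simp add: divide_le_eq mult.commute)
  qed
  then have "real t\<^sub>0 * (real n - real t\<^sub>0) / real n * S \<le> real q * S" using S0 by (rule mult_right_mono)
  with \<rho> \<rho>2 have qS: "8 * R * 2 ^ m * sqrt (real p) \<le> real q * S" unfolding S_def by linarith
  have contr: "contrast n b g j \<theta> = \<delta> j / sqrt 2"
    if "j \<in> {1..p}" "2 * (g * b) \<le> n" "1 \<le> b" "1 \<le> g" "g * b \<le> q" for b g j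
    using that q by (intro contrast_alt[where t=q] \<delta>) auto
  have energy: "(\<Sum>j=1..p. (contrast n b g j \<theta>)\<^sup>2) = S / 2"
    if "2 * (g * b) \<le> n" "1 \<le> b" "1 \<le> g" "g * b \<le> q" for b g
  proof -
    have "(\<Sum>j=1..p. (contrast n b g j \<theta>)\<^sup>2) = (\<Sum>j=1..p. (\<delta> j)\<^sup>2 / 2)"
      using that by (intro sum.cong refl) (simp add: contr power_divide)
    then show ?thesis unfolding S_def by (simp add: sum_divide_distrib)
  qed
  show ?thesis
  proof (cases "2 ^ m \<le> q")
    \<comment> \<open>Here q < 2^m, so the factor 2^m in the separation is used up by q, and the
      jump itself is large enough for the single vote at t = 1.\<close>
    case False
    then have "real q \<le> 2 ^ m" by (metis less_imp_le not_le of_nat_le_iff of_nat_numeral of_nat_power)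
    then have "real q * S \<le> 2 ^ m * S" using S0 by (rule mult_right_mono)
    with qS have "8 * R * 2 ^ m * sqrt (real p) \<le> 2 ^ m * S" by (rule order_trans)
    then have "2 ^ m * (8 * R * sqrt (real p)) \<le> 2 ^ m * S" by (simp only: mult_ac)
    then have S: "8 * R * sqrt (real p) \<le> S" by (rule mult_left_le_imp_le) simp
    have "0 \<le> R * sqrt (real p)" using R by simp
    with S have S: "2 * (R * sqrt (real p) / real 1) \<le> S / 2" by simp
    have "{E\<in>space P. \<not> rejects p n (2 ^ m) d k R v (add_mean p n \<theta> E)}
        \<subseteq> {E\<in>space P. block_stat n p 1 1 (\<lambda>j. v (1, 1, j)) (add_mean p n \<theta> E) < R * sqrt (real p) / real 1}"
      unfolding rejects_def by auto
    moreover have "{E\<in>space P. block_stat n p 1 1 (\<lambda>j. v (1, 1, j)) (add_mean p n \<theta> E) < R * sqrt (real p) / real 1} \<in> events"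
      using block_stat_measurable[of 1 1 n p "\<lambda>j. v (1, 1, j)"] n by (intro vimage_add_mean) (simp add: borel_measurable_less)
    ultimately have "prob {E\<in>space P. \<not> rejects p n (2 ^ m) d k R v (add_mean p n \<theta> E)}
        \<le> prob {E\<in>space P. block_stat n p 1 1 (\<lambda>j. v (1, 1, j)) (add_mean p n \<theta> E) < R * sqrt (real p) / real 1}"
      by (rule finite_measure_mono)
    also have "\<dots> \<le> min ((exp (- 1) / 4)\<^sup>2) (\<epsilon> / 4)"
      by (rule alt_level[OF _ _ _ p _ R]) (use n q S first_scale energy[of 1 1] in auto)
    finally show ?thesis using \<epsilon> by simp
  next
    case True
    \<comment> \<open>The largest dyadic scale t <= q; it loses less than a factor 2, and all its
      blocks stay within the first q columns.\<close>
    obtain a where a: "2 ^ a \<le> q" "q < 2 ^ (a + 1)" using ex_power_ivl1[of 2 q] q(1) by auto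
    define t :: nat where "t = 2 ^ a"
    have "(2::nat) ^ m < 2 ^ (a + 1)" using True a(2) by (rule le_less_trans)
    then have "m < a + 1" by (rule power_less_imp_less_exp[rotated]) simp
    then have mt: "2 ^ m \<le> t" unfolding t_def by simp
    have tq: "t \<le> q" "q \<le> 2 * t" using a unfolding t_def by auto
    have grid: "t \<in> dyadic_grid n" unfolding t_def using a(1) q(2) by (intro dyadic_gridI) linarith
    note s = scale[OF grid mt]
    define b where "b = t div 2 ^ m"
    have bt: "real t = 2 ^ m * real b"
      unfolding b_def by (subst s(2)[symmetric]) (simp only: of_nat_mult of_nat_power of_nat_numeral)
    have b1: "1 \<le> b" unfolding b_def by (rule s(1))
    have "real q * S \<le> real (2 * t) * S" using tq S0 by (intro mult_right_mono) auto
    with qS have "8 * R * 2 ^ m * sqrt (real p) \<le> real (2 * t) * S" by (rule order_trans)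
    then have "2 ^ m * (8 * R * sqrt (real p)) \<le> 2 ^ m * (2 * real b * S)"
      unfolding of_nat_mult bt of_nat_numeral by (simp only: mult_ac)
    then have "8 * R * sqrt (real p) \<le> 2 * real b * S" by (rule mult_left_le_imp_le) simp
    then have S: "2 * (R * sqrt (real p) / real b) \<le> S / 2" using b1 by (simp add: field_simps)
    let ?r = "R * sqrt (real p) / real b"
    let ?B = "\<lambda>g E. block_stat n p b g (\<lambda>j. v (t, g, j)) (add_mean p n \<theta> E)"
    \<comment> \<open>Votes for and against add up to 2^k, so a missed majority means at least half
      of the votes are wrong.\<close>
    have cs: "card {g\<in>cantor d k. ?r \<le> ?B g E} + card {g\<in>cantor d k. ?B g E < ?r} = 2 ^ k" for E
    proof -
      have "card {g\<in>cantor d k. ?r \<le> ?B g E} + card {g\<in>cantor d k. ?B g E < ?r}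
        = card ({g\<in>cantor d k. ?r \<le> ?B g E} \<union> {g\<in>cantor d k. ?B g E < ?r})"
        using finite_cantor[of d k] by (intro card_Un_disjoint[symmetric]) auto
      also have "{g\<in>cantor d k. ?r \<le> ?B g E} \<union> {g\<in>cantor d k. ?B g E < ?r} = cantor d k" by auto
      finally show ?thesis by (simp add: card_cantor)
    qed
    have "{E\<in>space P. \<not> rejects p n (2 ^ m) d k R v (add_mean p n \<theta> E)}
        \<subseteq> {E\<in>space P. 2 ^ k \<le> 2 * card {g\<in>cantor d k. ?B g E \<in> {..<?r}}}"
    proof safe
      fix E assume "\<not> rejects p n (2 ^ m) d k R v (add_mean p n \<theta> E)"
      then have "\<not> 2 ^ k \<le> 2 * card {g\<in>cantor d k. ?r \<le> ?B g E}"
        unfolding rejects_def b_def using grid mt by blast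
      then have "2 ^ k \<le> 2 * card {g\<in>cantor d k. ?B g E < ?r}" using cs[of E] by linarith
      then show "2 ^ k \<le> 2 * card {g\<in>cantor d k. ?B g E \<in> {..<?r}}" by simp
    qed
    moreover have "{E\<in>space P. 2 ^ k \<le> 2 * card {g\<in>cantor d k. ?B g E \<in> {..<?r}}} \<in> events"
    proof (intro sets_Collect_card_ge finite_cantor)
      fix g assume "g \<in> cantor d k"
      then have "g \<in> {1..2 ^ m}" using cantor_bounds[of g d k] len by simp
      then have gb: "2 * (g * b) \<le> n" using s(3) s(5)[of g] unfolding b_def by simp
      show "{E\<in>space P. ?B g E \<in> {..<?r}} \<in> events"
        using block_stat_events[OF gb, of "{..<?r}" "\<lambda>j. v (t, g, j)" \<theta>] col_events_sets[OF block_cols_subset[OF gb]] by auto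
    qed
    ultimately have "prob {E\<in>space P. \<not> rejects p n (2 ^ m) d k R v (add_mean p n \<theta> E)}
        \<le> prob {E\<in>space P. 2 ^ k \<le> 2 * card {g\<in>cantor d k. ?B g E \<in> {..<?r}}}"
      by (rule finite_measure_mono)
    also have "\<dots> \<le> exp (- (2 ^ k))"
      unfolding b_def
    proof (rule scale_tail[OF grid mt], unfold b_def[symmetric])
      fix g :: nat assume g: "g \<in> {1..2 ^ m}"
      have gt: "g * b \<le> t" using s(5)[OF g] unfolding b_def .
      have gb: "2 * (g * b) \<le> n" using s(3) gt by simp
      have "prob {E\<in>space P. ?B g E < ?r} \<le> min ((exp (- 1) / 4)\<^sup>2) (\<epsilon> / 4)"
        by (rule alt_level[OF b1 _ gb p _ R])
          (use g s(4)[folded b_def] gt tq S energy[OF gb b1] in auto)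
      then show "prob {E\<in>space P. ?B g E \<in> {..<?r}} \<le> (exp (- 1) / 4)\<^sup>2" by simp
    qed simp
    also have "\<dots> \<le> \<epsilon> / 8 / ln (8 * real n)" using exp_neg_power_le(1)[OF \<epsilon>(1) _ k] n by simp
    also have "\<dots> \<le> \<epsilon> / 8 / 1"
      using exp_neg_power_le(2)[OF \<epsilon>(1) _ k] n \<epsilon> by (intro divide_left_mono) auto
    finally show ?thesis using \<epsilon> by simp
  qed
qed

lemma integral_law_data_indicator:
  assumes "{X\<in>space (mat_space p n). Q X} \<in> sets (mat_space p n)"
  shows "(\<integral>X. (if Q X then 1 else 0 :: real) \<partial>law_data p n \<theta> P) = prob {E\<in>space P. Q (add_mean p n \<theta> E)}"
proof -
  have sm: "add_mean p n \<theta> \<in> P \<rightarrow>\<^sub>M mat_space p n" by (rule add_mean_measurable[OF sets_P])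
  have [measurable]: "Measurable.pred (mat_space p n) Q" using assms by (simp add: pred_def)
  have "(\<integral>X. (if Q X then 1 else 0 :: real) \<partial>law_data p n \<theta> P) = (\<integral>E. (if Q (add_mean p n \<theta> E) then 1 else 0 :: real) \<partial>P)"
    unfolding law_data_def add_mean_def[symmetric] by (rule integral_distr[OF sm]) measurable
  also have "\<dots> = (\<integral>E. indicator {E\<in>space P. Q (add_mean p n \<theta> E)} E \<partial>P)"
    by (intro Bochner_Integration.integral_cong refl) (simp add: indicator_def)
  also have "\<dots> = prob {E\<in>space P. Q (add_mean p n \<theta> E)}"
    by simp (rule arg_cong[where f=prob], auto)
  finally show ?thesis .
qed

end

theorem theorem12:
  fixes \<alpha> K c\<^sub>1 c\<^sub>2 \<epsilon> :: real
  assumes "\<alpha> > 4" and "K > 0" and "c\<^sub>1 > 0" and "c\<^sub>2 > 0" and "0 < \<epsilon>" and "\<epsilon> < 1"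
  shows "\<exists>C>0. \<forall>n::nat. even n \<and> n \<ge> 4 \<longrightarrow>
    (\<exists>\<Delta>::nat. (\<exists>k::nat. \<Delta> = 2 ^ k) \<and>
      (\<forall>p::nat. p \<ge> 1 \<longrightarrow>
        (\<exists>\<phi>. is_test_family p n \<phi> \<and>
          (\<forall>\<rho>::real. \<rho>\<^sup>2 \<ge> C * sqrt (real p) * ln (ln (8 * real n)) * (ln (ln (ln (64 * real n))))\<^sup>2 \<longrightarrow>
            testing_error \<alpha> K c\<^sub>1 c\<^sub>2 p n \<Delta> \<rho> \<phi> \<le> ennreal \<epsilon>))))"
proof -
  define u where "u = exp (- 1) / (4::real)"
  have "exp (- 1) \<le> (1::real)" by simp
  then have "u < 1" unfolding u_def by linarith
  moreover have "0 < u" unfolding u_def by simp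
  ultimately have u: "0 < u\<^sup>2" "u\<^sup>2 < 1" by (auto simp: abs_square_less_1)
  obtain d :: nat where d: "1 \<le> d" "\<And>l::nat. 1 \<le> l \<Longrightarrow> c\<^sub>1 * exp (- c\<^sub>2 * real (d * l)) \<le> (u\<^sup>2) ^ (2 * l)"
    using ex_separation[OF assms(4) u, of c\<^sub>1] by blast
  define \<eta> where "\<eta> = min (u\<^sup>2) (\<epsilon> / 4)"
  have \<eta>: "\<eta> > 0" unfolding \<eta>_def using u assms by simp
  \<comment> \<open>Outside the locale \<open>noise_const\<close> takes \<alpha>, K,
    \<open>c\<^sub>1\<close>, \<open>c\<^sub>2\<close> only. Hence R, and with it the final
    constant, is uniform in n, p and the noise distribution.\<close>
  define f where "f = temp_noise.noise_const \<alpha> K c\<^sub>1 c\<^sub>2"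
  define R where "R = max 1 (18 * f / \<eta>)"
  have R: "1 \<le> R" "18 * f \<le> \<eta> * R"
  proof -
    have "18 * f / \<eta> \<le> R" unfolding R_def by simp
    then show "18 * f \<le> \<eta> * R" using \<eta> by (simp add: divide_le_eq mult.commute)
  qed (simp add: R_def)
  obtain C where C: "C > 0" "\<And>n::nat. n \<ge> 4 \<Longrightarrow> \<exists>k m. ln (ln (8 * real n)) + ln (8 / \<epsilon>) \<le> 2 ^ k \<and> cantor_len d k \<le> 2 ^ m \<and>
    real (2 ^ m) \<le> C * (ln (ln (8 * real n)) * (ln (ln (ln (64 * real n))))\<^sup>2)"
    using scale_choice[OF assms(5,6), of d] by blast
  \<comment> \<open>\<open>alt_error\<close> asks for a squared separation of 8 R \<Delta> sqrt p,
    and C bounds \<Delta> = 2^m by a multiple of the iterated logarithms.\<close>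
  have "8 * R * C > 0" using R C by simp
  moreover have "\<exists>\<Delta>::nat. (\<exists>k::nat. \<Delta> = 2 ^ k) \<and>
      (\<forall>p::nat. p \<ge> 1 \<longrightarrow>
        (\<exists>\<phi>. is_test_family p n \<phi> \<and>
          (\<forall>\<rho>::real. \<rho>\<^sup>2 \<ge> 8 * R * C * sqrt (real p) * ln (ln (8 * real n)) * (ln (ln (ln (64 * real n))))\<^sup>2 \<longrightarrow>
            testing_error \<alpha> K c\<^sub>1 c\<^sub>2 p n \<Delta> \<rho> \<phi> \<le> ennreal \<epsilon>)))"
    if n: "n \<ge> 4" for n :: nat
  proof -
    obtain k m where k: "ln (ln (8 * real n)) + ln (8 / \<epsilon>) \<le> 2 ^ k" and len: "cantor_len d k \<le> 2 ^ m"
      and m: "real (2 ^ m) \<le> C * (ln (ln (8 * real n)) * (ln (ln (ln (64 * real n))))\<^sup>2)"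
      using C(2)[OF n] by blast
    have "\<exists>\<phi>. is_test_family p n \<phi> \<and>
          (\<forall>\<rho>::real. \<rho>\<^sup>2 \<ge> 8 * R * C * sqrt (real p) * ln (ln (8 * real n)) * (ln (ln (ln (64 * real n))))\<^sup>2 \<longrightarrow>
            testing_error \<alpha> K c\<^sub>1 c\<^sub>2 p n (2 ^ m) \<rho> \<phi> \<le> ennreal \<epsilon>)" if p: "p \<ge> 1" for p :: nat
    proof -
      define \<phi> :: "(nat \<times> nat \<times> nat \<Rightarrow> real) \<Rightarrow> (nat \<times> nat \<Rightarrow> real) \<Rightarrow> real"
        where "\<phi> v X = (if rejects p n (2 ^ m) d k R v X then 1 else 0)" for v X
      have n2: "2 \<le> n" using n by simp
      note rm = rejects_measurable(3)[OF n2 len, of p R]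
      have "is_test_family p n \<phi>"
        unfolding is_test_family_def
      proof
        fix v
        show "\<phi> v \<in> mat_space p n \<rightarrow>\<^sub>M count_space {0, 1}"
          unfolding \<phi>_def[abs_def] by (rule measurable_If[OF _ _ rm]) simp_all
      qed
      moreover have "testing_error \<alpha> K c\<^sub>1 c\<^sub>2 p n (2 ^ m) \<rho> \<phi> \<le> ennreal \<epsilon>"
        if \<rho>: "\<rho>\<^sup>2 \<ge> 8 * R * C * sqrt (real p) * ln (ln (8 * real n)) * (ln (ln (ln (64 * real n))))\<^sup>2" for \<rho> :: real
      proof -
        have "8 * R * sqrt (real p) * real (2 ^ m)
            \<le> 8 * R * sqrt (real p) * (C * (ln (ln (8 * real n)) * (ln (ln (ln (64 * real n))))\<^sup>2))"
          using R by (intro mult_left_mono[OF m]) auto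
        with \<rho> have \<rho>': "8 * R * 2 ^ m * sqrt (real p) \<le> \<rho>\<^sup>2" by (simp add: mult_ac)
        have bt: "block_test \<alpha> K c\<^sub>1 c\<^sub>2 p n P \<epsilon> R d k m" if "P \<in> P_Temp \<alpha> K c\<^sub>1 c\<^sub>2 p n" for P
        proof -
          interpret temp_noise \<alpha> K c\<^sub>1 c\<^sub>2 p n P using that assms by unfold_locales
          show ?thesis
            by unfold_locales (use n p assms d k len R in \<open>auto simp: u_def \<eta>_def f_def\<close>)
        qed
        have "testing_error \<alpha> K c\<^sub>1 c\<^sub>2 p n (2 ^ m) \<rho> \<phi> \<le> ennreal (\<epsilon> / 2) + ennreal (\<epsilon> / 2)"
          unfolding testing_error_def
        proof (intro add_mono SUP_least ennreal_leI)
          fix P \<theta> assume P: "P \<in> P_Temp \<alpha> K c\<^sub>1 c\<^sub>2 p n"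
          interpret block_test \<alpha> K c\<^sub>1 c\<^sub>2 p n P \<epsilon> R d k m by (rule bt[OF P])
          have not: "{X\<in>space (mat_space p n). \<not> rejects p n (2 ^ m) d k R v X} \<in> sets (mat_space p n)"
            using rm[of v] by (rule sets.sets_Collect_neg)
          show "(\<integral>X. \<phi> v X \<partial>law_data p n \<theta> P) \<le> \<epsilon> / 2" if "\<theta> \<in> Theta_null p n"
            unfolding \<phi>_def integral_law_data_indicator[OF rm] by (rule null_error[OF that])
          have "(\<lambda>X. 1 - \<phi> v X) = (\<lambda>X. if \<not> rejects p n (2 ^ m) d k R v X then 1 else 0)"
            unfolding \<phi>_def by auto
          then show "(\<integral>X. 1 - \<phi> v X \<partial>law_data p n \<theta> P) \<le> \<epsilon> / 2" if "\<theta> \<in> Theta_alt p n \<rho>"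
            using integral_law_data_indicator[OF not, of \<theta>] alt_error[OF that \<rho>'] by simp
        qed
        also have "\<dots> = ennreal \<epsilon>" using assms by (simp flip: ennreal_plus)
        finally show ?thesis .
      qed
      ultimately show ?thesis by blast
    qed
    then show ?thesis by blast
  qed
  ultimately show ?thesis by blast
qed

end
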